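(* Let $\underline{\mathbb{G}}=(\mathbb{G},\mathcal{V},\omega_{\mathcal{V}},\mathcal{B},\omega_{\mathcal{B}})$ be a packaged ribbon graph whose underlying ribbon graph $\mathbb{G}$ is connected, and let $\prec$ be a total order on $E(\mathbb{G})$. Then \[\boldsymbol{T}(\underline{\mathbb{G}};\boldsymbol{x},\boldsymbol{y})=\sum_{Q\in\mathcal{Q}_{\mathbb{G}}}x^{\,n(G(\mathbb{G}^*|D_Q^*\cup N_Q^*;\,\mathcal{B}))}\,y^{\,n(G(\mathbb{G}|D_Q\cup N_Q;\,\mathcal{V}))}\;\boldsymbol{T}\big(\underline{\mathbb{G}}\setminus (D_Q^*\cup N_Q^* )/(D_Q\cup N_Q);\boldsymbol{x},\boldsymbol{y}\big),\] where $\underline{\mathbb{G}}\setminus (D_Q^*\cup N_Q^* )/(D_Q\cup N_Q)$ is the packaged ribbon graph obtained from $\underline{\mathbb{G}}$ by deleting the edges of $D_Q^*\cup N_Q^*$ and contracting the edges of $D_Q\cup N_Q$.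
   Context: Ribbon graphs. A ribbon graph $\mathbb{G}=(V,E)$ is a surface with boundary given as a union of discs $V$ (vertices) and discs $E$ (edges) such that a vertex and an edge are disjoint or meet in an arc, each such arc lies on the boundary of exactly one vertex and one edge, and each edge contains exactly two such arcs. $v(\cdot),e(\cdot),b(\cdot),k(\cdot)$ denote numbers of vertices, edges, boundary components and connected components. $\mathbb{G}\setminus e=(V,E-e)$ is deletion; $\mathbb{G}|A$ denotes the spanning ribbon subgraph with edge set $A$ (and $A^c=E-A$). Contraction $\mathbb{G}/e$: with $u,v$ the end vertices of $e$, attach a disc to each boundary curve of $e\cup u\cup v$ and remove $e,u,v$. A loop is an edge with one end vertex; it is non-orientable if the loop together with its vertex is a Möbius band, orientable otherwise. For $A\subseteq E$, the partial dual $\mathbb{G}^A$ is obtained by capping the boundary components of $\mathbb{G}|A$ with discs (the new vertex set) and deleting the interiors of the old vertices; $\mathbb{G}^*=\mathbb{G}^E$ is the dual, whose vertices correspond to boundary components of $\mathbb{G}$ and whose edges are those of $\mathbb{G}$. Quasi-trees and activity. A quasi-tree is a ribbon graph with exactly one boundary component; $\mathcal{Q}_{\mathbb{G}}$ is the set of spanning ribbon subgraphs of $\mathbb{G}$ that are quasi-trees. For $Q\in\mathcal{Q}_{\mathbb{G}}$, $\mathbb{G}^{E(Q)}$ has exactly one vertex; edges $e,f$ link with respect to $Q$ if, travelling around the boundary of that vertex, their ends appear in cyclic order $e\,f\,e\,f$. With respect to $Q$ and $\prec$: an edge is live if it links no $\prec$-smaller edge, dead otherwise; non-orientable if it is a non-orientable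 loop in $\mathbb{G}^{E(Q)}$; internal if in $E(Q)$, external otherwise. $D_Q$ / $D_Q^*$ are the internally / externally dead edges; $N_Q$ / $N_Q^*$ are the internally / externally live non-orientable edges. Packaged ribbon graphs. $\underline{\mathbb{G}}=(\mathbb{G},\mathcal{V},\omega_{\mathcal{V}},\mathcal{B},\omega_{\mathcal{B}})$ where $\mathcal{V}$ is a partition of $V(\mathbb{G})$, $\mathcal{B}$ a partition of the set of boundary components of $\mathbb{G}$, and $\omega_{\mathcal{V}}:\mathcal{V}\to\mathbb{N}_0$, $\omega_{\mathcal{B}}:\mathcal{B}\to\mathbb{N}_0$ are weightings; $[x]$ is the block containing $x$. Deletion $\underline{\mathbb{G}}\setminus e$: underlying ribbon graph $\mathbb{G}\setminus e$, $\mathcal{V},\omega_{\mathcal{V}}$ unchanged; (1) if $e$ meets two boundary components $a,b$ with $[a]\ne[b]$, they merge into $a'$, the blocks $[a],[b]$ are replaced by $[a]\cup[b]\cup\{a'\}-\{a,b\}$ with weight $\omega_{\mathcal{B}}([a])+\omega_{\mathcal{B}}([b])$; (2) if $[a]=[b]$, the block becomes $[a]\cup\{a'\}-\{a,b\}$ with weight increased by 1; (3) if $e$ meets one boundary component $a$ twice and deletion creates two components $a',b'$, the block becomes $[a]\cup\{a',b'\}-\{a\}$ with weight increased by 1; (4) if $e$ meets one boundary component $a$ twice and the number of boundary components is unchanged, the block becomes $[a]\cup\{a'\}-\{a\}$ with weight increased by 1; other blocks unchanged. Contraction $\underline{\mathbb{G}}/e$: underlying ribbon graph $\mathbb{G}/e$;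 boundary components of $\mathbb{G}/e$ correspond naturally to those of $\mathbb{G}$, giving $\mathcal{B}$ and $\omega_{\mathcal{B}}$; for vertices: (1) $e$ a non-loop with ends $u,v$, $[u]\ne[v]$: new vertex $u'$, blocks replaced by $[u]\cup[v]\cup\{u'\}-\{u,v\}$ of weight $\omega_{\mathcal{V}}([u])+\omega_{\mathcal{V}}([v])$; (2) non-loop with $[u]=[v]$: block becomes $[u]\cup\{u'\}-\{u,v\}$, weight $+1$; (3) orientable loop at $u$ (contraction yields vertices $u',v'$): block becomes $[u]\cup\{u',v'\}-\{u\}$, weight $+1$; (4) non-orientable loop at $u$ (yields one vertex $u'$): block becomes $[u]\cup\{u'\}-\{u\}$, weight $+1$; other blocks unchanged. The dual $\underline{\mathbb{G}}^*$ has ribbon graph $\mathbb{G}^*$, vertex partition/weights induced by $\mathcal{B},\omega_{\mathcal{B}}$ and boundary partition/weights induced by $\mathcal{V},\omega_{\mathcal{V}}$. Packagings. For a packaged ribbon graph, the packaging $G(\mathbb{G};\mathcal{V})$ is the vertex-weighted graph with vertex set $\mathcal{V}$ (weights $\omega_{\mathcal{V}}$) and an edge $([u],[v])$ for each edge $uv$ of $\mathbb{G}$. For a spanning ribbon subgraph $\mathbb{G}|A$, $G(\mathbb{G}|A;\mathcal{V})$ is the corresponding packaging using only edges in $A$; similarly $G(\mathbb{G}^*|A;\mathcal{B})$ uses the dual, whose vertices are the boundary components of $\mathbb{G}$ partitioned by $\mathcal{B}$ with weights $\omega_{\mathcal{B}}$. For a subgraph $K$ of a packaging, $\mathbb{G}[K]$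 is the ribbon subgraph of $\mathbb{G}$ whose vertices are all vertices of $\mathbb{G}$ lying in blocks that are vertices of $K$ and whose edges are those corresponding to edges of $K$ (analogously $\mathbb{G}^*[H]$). $n(G)=e(G)-v(G)+k(G)$ is the nullity. Packaged surface Tutte polynomial, in variables $\boldsymbol{x}=(x,x_0,x_1,\dots)$, $\boldsymbol{y}=(y,y_0,y_1,\dots)$: \[\boldsymbol{T}(\underline{\mathbb{G}};\boldsymbol{x},\boldsymbol{y})=\sum_{A\subseteq E} x^{n(G(\mathbb{G}^*|A^c;\mathcal{B}))}y^{n(G(\mathbb{G}|A;\mathcal{V}))}\prod_{H}x_{\gamma(\mathbb{G}^*,H)}\prod_{K}y_{\gamma(\mathbb{G},K)},\] products over the connected components $H$ of $G(\mathbb{G}^*|A^c;\mathcal{B})$ and $K$ of $G(\mathbb{G}|A;\mathcal{V})$, where $\gamma(\mathbb{G},K)=2k(K)+e(K)-v(K)+\sum_{[v]\in V(K)}\omega_{\mathcal{V}}([v])-b(\mathbb{G}[K])$ and $\gamma(\mathbb{G}^*,H)=2k(H)+e(H)-v(H)+\sum_{[b]\in V(H)}\omega_{\mathcal{B}}([b])-b(\mathbb{G}^*[H])$. *)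

theory Defs
  imports Main "HOL-Library.Disjoint_Sets"
begin

section \<open>Ribbon graphs\<close>

text \<open>
  A ribbon graph is encoded by flags and three involutions.  The boundary circle of every vertex
  disc is cut into finitely many arcs, alternating between \<^emph>\<open>corner\<close> arcs and \<^emph>\<open>slots\<close>; the flags
  are the end points of these arcs.  A slot is either an arc in which the vertex meets an edge disc,
  or an arc to which no edge is attached.  The involution \<open>tau1\<close> exchanges the two end points of a
  corner arc, and \<open>tau2\<close> exchanges the two end points of a slot.  An edge disc meets the vertices in
  two slots, hence has four flags, and \<open>tau0\<close> exchanges the end points of each of its two free
  sides; on a slot without an edge \<open>tau0\<close> agrees with \<open>tau2\<close>.

  Consequently the vertices are the orbits of \<open>tau1, tau2\<close> (their boundary circles), the boundary
  components are the orbits of \<open>tau0, tau1\<close>, the edges are the four-element orbits of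
  \<open>tau0, tau2\<close>, and the connected components of the surface are the orbits of all three.  Slots
  without an edge make isolated vertices representable (two flags, all three involutions equal) and
  let deletion and contraction keep the flag set: there, vertices (resp. boundary components) that
  persist are literally the same sets of flags before and after.
\<close>

record 'f ribbon =
  flags :: "'f set"
  tau0 :: "'f \<Rightarrow> 'f"
  tau1 :: "'f \<Rightarrow> 'f"
  tau2 :: "'f \<Rightarrow> 'f"

definition free_involution_on :: "'f set \<Rightarrow> ('f \<Rightarrow> 'f) \<Rightarrow> bool" where
  "free_involution_on D t \<longleftrightarrow> (\<forall>a\<in>D. t a \<in> D \<and> t a \<noteq> a \<and> t (t a) = a)"

definition ribbon_graph :: "'f ribbon \<Rightarrow> bool" where
  "ribbon_graph G \<longleftrightarrow>
     finite (flags G) \<and>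
     free_involution_on (flags G) (tau0 G) \<and>
     free_involution_on (flags G) (tau1 G) \<and>
     free_involution_on (flags G) (tau2 G) \<and>
     (\<forall>a\<in>flags G. tau0 G (tau2 G a) = tau2 G (tau0 G a))"

definition orbits :: "'f set \<Rightarrow> ('f \<Rightarrow> 'f) set \<Rightarrow> 'f set set" where
  "orbits D T = (\<lambda>a. {(b, t b) | b t. b \<in> D \<and> t \<in> T}\<^sup>* `` {a}) ` D"

definition vertices :: "'f ribbon \<Rightarrow> 'f set set" where
  "vertices G = orbits (flags G) {tau1 G, tau2 G}"

definition edges :: "'f ribbon \<Rightarrow> 'f set set" where
  "edges G = {e \<in> orbits (flags G) {tau0 G, tau2 G}. card e = 4}"

definition boundaries :: "'f ribbon \<Rightarrow> 'f set set" where
  "boundaries G = orbits (flags G) {tau0 G, tau1 G}"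

definition surface_components :: "'f ribbon \<Rightarrow> 'f set set" where
  "surface_components G = orbits (flags G) {tau0 G, tau1 G, tau2 G}"

definition connected_ribbon :: "'f ribbon \<Rightarrow> bool" where
  "connected_ribbon G \<longleftrightarrow> card (surface_components G) = 1"

text \<open>
  The ribbon subgraph with vertex set \<open>W\<close> and edge set \<open>A\<close>; the slots of all other edges become
  slots without an edge.
\<close>

definition ribbon_subgraph :: "'f ribbon \<Rightarrow> 'f set set \<Rightarrow> 'f set set \<Rightarrow> 'f ribbon" where
  "ribbon_subgraph G W A =
     G\<lparr>flags := \<Union>W, tau0 := (\<lambda>a. if a \<in> \<Union>A then tau0 G a else tau2 G a)\<rparr>"

definition spanning_subgraph :: "'f ribbon \<Rightarrow> 'f set set \<Rightarrow> 'f ribbon" where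
  "spanning_subgraph G A = ribbon_subgraph G (vertices G) A"

definition delete :: "'f set \<Rightarrow> 'f ribbon \<Rightarrow> 'f ribbon" where
  "delete e G = G\<lparr>tau0 := (\<lambda>a. if a \<in> e then tau2 G a else tau0 G a)\<rparr>"

text \<open>
  Contraction: the boundary curves of \<open>e \<union> u \<union> v\<close>, which become the boundary circles of the new
  vertices, run along the free sides of \<open>e\<close> (that is, along \<open>tau0\<close>) in place of its slots.
\<close>

definition contract :: "'f set \<Rightarrow> 'f ribbon \<Rightarrow> 'f ribbon" where
  "contract e G = G\<lparr>tau2 := (\<lambda>a. if a \<in> e then tau0 G a else tau2 G a)\<rparr>"

text \<open>
  Partial dual: the new vertex circles are the boundary components of the spanning ribbon subgraph
  on \<open>A\<close>, so on an edge of \<open>A\<close> the free sides and the slots exchange their roles.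
\<close>

definition partial_dual :: "'f ribbon \<Rightarrow> 'f set set \<Rightarrow> 'f ribbon" where
  "partial_dual G A =
     G\<lparr>tau0 := (\<lambda>a. if a \<in> \<Union>A then tau2 G a else tau0 G a),
       tau2 := (\<lambda>a. if a \<in> \<Union>A then tau0 G a else tau2 G a)\<rparr>"

definition dual :: "'f ribbon \<Rightarrow> 'f ribbon" where
  "dual G = partial_dual G (edges G)"

definition end_vertices :: "'f ribbon \<Rightarrow> 'f set \<Rightarrow> 'f set set" where
  "end_vertices G e = {v \<in> vertices G. v \<inter> e \<noteq> {}}"

text \<open>
  Colour a flag by a local orientation of the surface; every involution is a local reflection.
\<close>

definition orientable :: "'f ribbon \<Rightarrow> bool" where
  "orientable G \<longleftrightarrow>
     (\<exists>c :: 'f \<Rightarrow> bool. \<forall>a\<in>flags G.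
        c (tau0 G a) \<noteq> c a \<and> c (tau1 G a) \<noteq> c a \<and> c (tau2 G a) \<noteq> c a)"

text \<open>
  A loop together with its vertex is an annulus or a Moebius band, according to orientability.
\<close>

definition nonorientable_loop :: "'f ribbon \<Rightarrow> 'f set \<Rightarrow> bool" where
  "nonorientable_loop G e \<longleftrightarrow>
     (\<exists>v. end_vertices G e = {v} \<and> \<not> orientable (ribbon_subgraph G {v} {e}))"


section \<open>Quasi-trees and activities\<close>

definition quasi_tree :: "'f ribbon \<Rightarrow> bool" where
  "quasi_tree G \<longleftrightarrow> card (boundaries G) = 1"

definition quasi_trees :: "'f ribbon \<Rightarrow> 'f ribbon set" where
  "quasi_trees G = {Q. (\<exists>A. A \<subseteq> edges G \<and> Q = spanning_subgraph G A) \<and> quasi_tree Q}"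

text \<open>
  Starting at a flag \<open>a\<close>, iterating \<open>turn\<close> travels once around the boundary of the vertex of \<open>a\<close> in
  one direction; the flags visited are the first end points of the successive slots, each slot of
  the vertex being met exactly once before returning to \<open>a\<close>.
\<close>

definition turn :: "'f ribbon \<Rightarrow> 'f \<Rightarrow> 'f" where
  "turn G a = tau1 G (tau2 G a)"

definition circuit_length :: "'f ribbon \<Rightarrow> 'f \<Rightarrow> nat" where
  "circuit_length G a = (LEAST n. 0 < n \<and> (turn G ^^ n) a = a)"

definition interlaced :: "'f ribbon \<Rightarrow> 'f set \<Rightarrow> 'f set \<Rightarrow> bool" where
  "interlaced G e f \<longleftrightarrow>
     (\<exists>a i j k. 0 < i \<and> i < j \<and> j < k \<and> k < circuit_length G a \<and>
        a \<in> e \<and> (turn G ^^ i) a \<in> f \<and> (turn G ^^ j) a \<in> e \<and> (turn G ^^ k) a \<in> f)"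

definition links :: "'f ribbon \<Rightarrow> 'f ribbon \<Rightarrow> 'f set \<Rightarrow> 'f set \<Rightarrow> bool" where
  "links G Q e f \<longleftrightarrow> interlaced (partial_dual G (edges Q)) e f"

definition live :: "'f ribbon \<Rightarrow> 'f set rel \<Rightarrow> 'f ribbon \<Rightarrow> 'f set \<Rightarrow> bool" where
  "live G r Q e \<longleftrightarrow> \<not> (\<exists>f\<in>edges G. (f, e) \<in> r \<and> links G Q e f)"

definition nonorientable_edge :: "'f ribbon \<Rightarrow> 'f ribbon \<Rightarrow> 'f set \<Rightarrow> bool" where
  "nonorientable_edge G Q e \<longleftrightarrow> nonorientable_loop (partial_dual G (edges Q)) e"

definition int_dead :: "'f ribbon \<Rightarrow> 'f set rel \<Rightarrow> 'f ribbon \<Rightarrow> 'f set set" where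
  "int_dead G r Q = {e \<in> edges Q. \<not> live G r Q e}"

definition ext_dead :: "'f ribbon \<Rightarrow> 'f set rel \<Rightarrow> 'f ribbon \<Rightarrow> 'f set set" where
  "ext_dead G r Q = {e \<in> edges G - edges Q. \<not> live G r Q e}"

definition int_live_nonor :: "'f ribbon \<Rightarrow> 'f set rel \<Rightarrow> 'f ribbon \<Rightarrow> 'f set set" where
  "int_live_nonor G r Q = {e \<in> edges Q. live G r Q e \<and> nonorientable_edge G Q e}"

definition ext_live_nonor :: "'f ribbon \<Rightarrow> 'f set rel \<Rightarrow> 'f ribbon \<Rightarrow> 'f set set" where
  "ext_live_nonor G r Q = {e \<in> edges G - edges Q. live G r Q e \<and> nonorientable_edge G Q e}"


section \<open>Packaged ribbon graphs\<close>

record 'f packaged =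
  ribbon :: "'f ribbon"
  vpart :: "'f set set set"
  vweight :: "'f set set \<Rightarrow> nat"
  bpart :: "'f set set set"
  bweight :: "'f set set \<Rightarrow> nat"

definition packaged_ribbon_graph :: "'f packaged \<Rightarrow> bool" where
  "packaged_ribbon_graph P \<longleftrightarrow>
     ribbon_graph (ribbon P) \<and>
     partition_on (vertices (ribbon P)) (vpart P) \<and>
     partition_on (boundaries (ribbon P)) (bpart P)"

text \<open>
  The block update common to deletion (acting on boundary components) and contraction (acting on
  vertices).  Here \<open>S\<close> is the set of circles after the operation.  The edge \<open>e\<close> touches one or two
  circles, lying in one or two blocks; these blocks are united, the touched circles are removed and
  the new circles along \<open>e\<close> are inserted.  With two distinct blocks the weights are added;
  with a single block its weight increases by 1 (two circles merging inside one block, one circle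
  splitting into two, or one circle turning into one).
  Weights off the blocks of the new partition are reset to 0, so that the outcome of successive
  operations does not depend on their order even as a total function.
\<close>

definition touched_blocks :: "'f set \<Rightarrow> 'f set set set \<Rightarrow> 'f set set set" where
  "touched_blocks e p = {X \<in> p. \<exists>s\<in>X. s \<inter> e \<noteq> {}}"

definition new_block :: "'f set \<Rightarrow> 'f set set \<Rightarrow> 'f set set set \<Rightarrow> 'f set set" where
  "new_block e S p = (\<Union>(touched_blocks e p) - {s. s \<inter> e \<noteq> {}}) \<union> {s \<in> S. s \<inter> e \<noteq> {}}"

definition update_part :: "'f set \<Rightarrow> 'f set set \<Rightarrow> 'f set set set \<Rightarrow> 'f set set set" where
  "update_part e S p = insert (new_block e S p) (p - touched_blocks e p)"

definition update_weight ::
  "'f set \<Rightarrow> 'f set set \<Rightarrow> 'f set set set \<Rightarrow> ('f set set \<Rightarrow> nat) \<Rightarrow> 'f set set \<Rightarrow> nat" where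
  "update_weight e S p w X =
     (if X = new_block e S p then
        (if card (touched_blocks e p) = 1 then w (the_elem (touched_blocks e p)) + 1
         else (\<Sum>Y\<in>touched_blocks e p. w Y))
      else if X \<in> p - touched_blocks e p then w X
      else 0)"

definition pdelete :: "'f set \<Rightarrow> 'f packaged \<Rightarrow> 'f packaged" where
  "pdelete e P = (let G' = delete e (ribbon P) in
     P\<lparr>ribbon := G',
       bpart := update_part e (boundaries G') (bpart P),
       bweight := update_weight e (boundaries G') (bpart P) (bweight P)\<rparr>)"

definition pcontract :: "'f set \<Rightarrow> 'f packaged \<Rightarrow> 'f packaged" where
  "pcontract e P = (let G' = contract e (ribbon P) in
     P\<lparr>ribbon := G',
       vpart := update_part e (vertices G') (vpart P),
       vweight := update_weight e (vertices G') (vpart P) (vweight P)\<rparr>)"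

definition pdelete_set :: "'f set set \<Rightarrow> 'f packaged \<Rightarrow> 'f packaged" where
  "pdelete_set A P = Finite_Set.fold pdelete P A"

definition pcontract_set :: "'f set set \<Rightarrow> 'f packaged \<Rightarrow> 'f packaged" where
  "pcontract_set A P = Finite_Set.fold pcontract P A"


section \<open>Packagings\<close>

record ('v, 'e) wgraph =
  wverts :: "'v set"
  wedges :: "'e set"
  wends :: "'e \<Rightarrow> 'v set"
  wweight :: "'v \<Rightarrow> nat"

definition wreach :: "('v, 'e) wgraph \<Rightarrow> 'v rel" where
  "wreach H = {(u, v). \<exists>e\<in>wedges H. u \<in> wends H e \<and> v \<in> wends H e}\<^sup>*"

definition wcomponents :: "('v, 'e) wgraph \<Rightarrow> ('v, 'e) wgraph set" where
  "wcomponents H =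
     (\<lambda>u. let C = wreach H `` {u} in
        H\<lparr>wverts := C, wedges := {e \<in> wedges H. wends H e \<subseteq> C}\<rparr>) ` wverts H"

text \<open>
  The difference is never truncated, because a graph with \<open>e\<close> edges has at least \<open>v - e\<close>
  connected components.
\<close>

definition nullity :: "('v, 'e) wgraph \<Rightarrow> nat" where
  "nullity H = card (wedges H) + card (wcomponents H) - card (wverts H)"

definition packaging ::
  "'f ribbon \<Rightarrow> 'f set set set \<Rightarrow> ('f set set \<Rightarrow> nat) \<Rightarrow> ('f set set, 'f set) wgraph" where
  "packaging G p w =
     \<lparr>wverts = p, wedges = edges G,
      wends = (\<lambda>e. {X \<in> p. \<exists>v\<in>X. v \<in> end_vertices G e}), wweight = w\<rparr>"

definition unpackage :: "'f ribbon \<Rightarrow> ('f set set, 'f set) wgraph \<Rightarrow> 'f ribbon" where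
  "unpackage G K = ribbon_subgraph G (\<Union>(wverts K)) (wedges K)"

definition gamma :: "'f ribbon \<Rightarrow> ('f set set, 'f set) wgraph \<Rightarrow> int" where
  "gamma G K =
     2 * int (card (wcomponents K)) + int (card (wedges K)) - int (card (wverts K))
     + int (\<Sum>X\<in>wverts K. wweight K X) - int (card (boundaries (unpackage G K)))"

definition vpackaging :: "'f packaged \<Rightarrow> 'f set set \<Rightarrow> ('f set set, 'f set) wgraph" where
  "vpackaging P A = packaging (spanning_subgraph (ribbon P) A) (vpart P) (vweight P)"

definition bpackaging :: "'f packaged \<Rightarrow> 'f set set \<Rightarrow> ('f set set, 'f set) wgraph" where
  "bpackaging P A = packaging (spanning_subgraph (dual (ribbon P)) A) (bpart P) (bweight P)"

text \<open>
  The packaged surface Tutte polynomial.  The variables \<open>x, y\<close> and the two families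
  \<open>xs, ys\<close> range over an arbitrary commutative semiring, so an identity valid for all of
  them is an identity of polynomials.  The families are indexed by integers because \<open>gamma\<close> can be
  negative when the weights are arbitrary (three isolated vertices in one block of weight 0 give
  \<open>-2\<close>).
\<close>

definition tutte ::
  "'f packaged \<Rightarrow> 'a::comm_semiring_1 \<Rightarrow> (int \<Rightarrow> 'a) \<Rightarrow> 'a \<Rightarrow> (int \<Rightarrow> 'a) \<Rightarrow> 'a" where
  "tutte P x xs y ys =
     (\<Sum>A\<in>Pow (edges (ribbon P)).
        x ^ nullity (bpackaging P (edges (ribbon P) - A)) *
        y ^ nullity (vpackaging P A) *
        (\<Prod>H\<in>wcomponents (bpackaging P (edges (ribbon P) - A)).
           xs (gamma (dual (ribbon P)) H)) *
        (\<Prod>K\<in>wcomponents (vpackaging P A). ys (gamma (ribbon P) K)))"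

end

theory Submission
  imports Defs
begin

text \<open>
  For a quasi-tree \<open>Q\<close> the partial dual by \<open>E(Q)\<close> has a single vertex,
  and an edge set \<open>B\<close> is again the edge set of a quasi-tree iff dualising further by the symmetric
  difference of \<open>E(Q)\<close> and \<open>B\<close> keeps one vertex. Cutting the vertex circle at the ends of the edges shows: if \<open>e\<close> is non-orientable one
  may switch \<open>e\<close>; if \<open>e\<close> is orientable and links \<open>f\<close> one may switch \<open>e\<close> and \<open>f\<close> together; if \<open>e\<close> is
  orientable and links no other edge of a set, no switch of that set containing \<open>e\<close> is possible.
  Looking at the largest edge in which two quasi-trees differ, it follows that every edge set \<open>A\<close>
  agrees with exactly one quasi-tree \<open>Q\<close> on the edges that are dead or non-orientable with respect
  to \<open>Q\<close>, so the edge sets split into intervals indexed by quasi-trees.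

  Within an interval the summand of the polynomial is computed in the minor: contracting an edge of
  \<open>A\<close> contracts the packaging, and the weight increments for loops of the packaging are exactly what
  keeps \<open>gamma\<close> unchanged, while the nullity drops by one for loops and is unchanged otherwise.
  Deletion is the dual statement.
\<close>

section \<open>Orbits of involutions\<close>

text \<open>A summand of the polynomial splits into two halves: the \<open>y\<close> factors see
  only vertex blocks and \<open>A\<close>, and the \<open>x\<close> factors are the same expression
  for the dual and the complement of \<open>A\<close>. An edge outside its set is invisible to a
  half, so each half only ever has to cope with contracting an edge of its set.

  Existence of the quasi-tree for \<open>A\<close> needs a measure. Reading the difference of
  \<open>A\<close> and a quasi-tree as a binary number, with digits placed by the edge order, the
  nearest quasi-tree works: a wrong fixed edge could be corrected at the expense of smaller edges
  only. That there is any quasi-tree uses connectedness, through a partial dual with fewest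
  vertices.

  The obstacle in the last stage is that contracting a set is a \<open>Finite_Set.fold\<close>,
  whose value is known only once the order is shown irrelevant, while weights change by case
  distinction. The final weight of a block turns out to be an invariant of the component shrunk to
  it: edges minus vertices plus weights plus one.\<close>

definition orbit_rel :: "'f set \<Rightarrow> ('f \<Rightarrow> 'f) set \<Rightarrow> 'f rel" where
  "orbit_rel D T = {(b, t b) | b t. b \<in> D \<and> t \<in> T}\<^sup>*"

lemma orbits_eq: "orbits D T = (\<lambda>a. orbit_rel D T `` {a}) ` D"
  by (simp add: orbits_def orbit_rel_def)

lemma orbit_rel_step: "a \<in> D \<Longrightarrow> t \<in> T \<Longrightarrow> (a, t a) \<in> orbit_rel D T"
  unfolding orbit_rel_def by (rule r_into_rtrancl) blast

lemma orbit_rel_refl [simp]: "(a, a) \<in> orbit_rel D T"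
  by (simp add: orbit_rel_def)

lemma orbit_rel_trans:
  "(a, b) \<in> orbit_rel D T \<Longrightarrow> (b, c) \<in> orbit_rel D T \<Longrightarrow> (a, c) \<in> orbit_rel D T"
  unfolding orbit_rel_def by (rule rtrancl_trans)

lemma orbit_rel_closed:
  assumes "(a, b) \<in> orbit_rel D T" "a \<in> S"
    and "\<And>c t. c \<in> S \<Longrightarrow> c \<in> D \<Longrightarrow> t \<in> T \<Longrightarrow> t c \<in> S"
  shows "b \<in> S"
  using assms(1) unfolding orbit_rel_def
  by (induction rule: rtrancl_induct) (use assms in auto)

lemma orbit_rel_subset:
  assumes "\<And>a t. a \<in> D \<Longrightarrow> t \<in> T \<Longrightarrow> (a, t a) \<in> orbit_rel D' T'"
  shows "orbit_rel D T \<subseteq> orbit_rel D' T'"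
proof -
  have "{(b, t b) | b t. b \<in> D \<and> t \<in> T} \<subseteq> orbit_rel D' T'"
    using assms by blast
  then show ?thesis
    unfolding orbit_rel_def by (rule rtrancl_subset_rtrancl)
qed

lemma orbits_cong:
  assumes "\<And>a. a \<in> D \<Longrightarrow> (\<lambda>t. t a) ` T = (\<lambda>t. t a) ` T'"
  shows "orbits D T = orbits D T'"
proof -
  have "{(b, t b) | b t. b \<in> D \<and> t \<in> T} = {(b, t b) | b t. b \<in> D \<and> t \<in> T'}" (is "?L = ?R")
  proof (rule set_eqI)
    fix z :: "'a \<times> 'a"
    have "z \<in> ?L \<longleftrightarrow> fst z \<in> D \<and> snd z \<in> (\<lambda>t. t (fst z)) ` T" by (cases z) auto
    also have "\<dots> \<longleftrightarrow> fst z \<in> D \<and> snd z \<in> (\<lambda>t. t (fst z)) ` T'" using assms by metis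
    also have "\<dots> \<longleftrightarrow> z \<in> ?R" by (cases z) auto
    finally show "z \<in> ?L \<longleftrightarrow> z \<in> ?R" .
  qed
  then show ?thesis by (simp add: orbits_def)
qed

locale involutions =
  fixes D :: "'f set" and T :: "('f \<Rightarrow> 'f) set"
  assumes inv: "\<And>t. t \<in> T \<Longrightarrow> free_involution_on D t"
begin

lemma closed: "t \<in> T \<Longrightarrow> a \<in> D \<Longrightarrow> t a \<in> D"
  using inv[of t] by (simp add: free_involution_on_def)

lemma rel_sym:
  assumes "(a, b) \<in> orbit_rel D T"
  shows "(b, a) \<in> orbit_rel D T"
proof -
  have "sym {(b, t b) | b t. b \<in> D \<and> t \<in> T}"
  proof (rule symI)
    fix a b assume "(a, b) \<in> {(b, t b) | b t. b \<in> D \<and> t \<in> T}"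
    then obtain t where t: "a \<in> D" "t \<in> T" "b = t a" by blast
    then have "(b, a) = (b, t b)" "b \<in> D"
      using inv[OF t(2)] by (simp_all add: free_involution_on_def)
    then show "(b, a) \<in> {(b, t b) | b t. b \<in> D \<and> t \<in> T}" using t(2) by blast
  qed
  then have "sym (orbit_rel D T)"
    unfolding orbit_rel_def by (rule sym_rtrancl)
  then show ?thesis using assms by (rule symD)
qed

lemma rel_in: "(a, b) \<in> orbit_rel D T \<Longrightarrow> a \<in> D \<Longrightarrow> b \<in> D"
  by (rule orbit_rel_closed[where S = D]) (auto intro: closed)

lemma orbit_eqI: "(a, b) \<in> orbit_rel D T \<Longrightarrow> orbit_rel D T `` {a} = orbit_rel D T `` {b}"
  using rel_sym by (auto dest: orbit_rel_trans)

lemma orbit_of: "s \<in> orbits D T \<Longrightarrow> a \<in> s \<Longrightarrow> s = orbit_rel D T `` {a}"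
  unfolding orbits_eq using orbit_eqI by auto

lemma partition_orbits: "partition_on D (orbits D T)"
proof (rule partition_onI)
  show "\<Union> (orbits D T) = D"
    unfolding orbits_eq using rel_in by fastforce
  show "{} \<notin> orbits D T"
    unfolding orbits_eq by (auto intro: orbit_rel_refl)
  fix p p' assume "p \<in> orbits D T" "p' \<in> orbits D T" "p \<noteq> p'"
  then show "disjnt p p'"
    unfolding disjnt_iff using orbit_of by metis
qed

lemma orbits_closed: "s \<in> orbits D T \<Longrightarrow> a \<in> s \<Longrightarrow> t \<in> T \<Longrightarrow> t a \<in> s"
proof -
  assume s: "s \<in> orbits D T" "a \<in> s" "t \<in> T"
  then have "a \<in> D" using partition_orbits partition_onD1 by blast
  then have "(a, t a) \<in> orbit_rel D T" using s by (simp add: orbit_rel_step)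
  then show "t a \<in> s" using orbit_of[OF s(1,2)] by auto
qed

lemma card_orbits_1_iff:
  "card (orbits D T) = 1 \<longleftrightarrow> D \<noteq> {} \<and> (\<forall>a\<in>D. \<forall>b\<in>D. (a, b) \<in> orbit_rel D T)"
proof
  assume "card (orbits D T) = 1"
  then obtain X where X: "orbits D T = {X}" by (auto simp: card_1_singleton_iff)
  then have "X = D" using partition_onD1[OF partition_orbits] by simp
  moreover have "X \<noteq> {}" using partition_onD3[OF partition_orbits] X by auto
  ultimately show "D \<noteq> {} \<and> (\<forall>a\<in>D. \<forall>b\<in>D. (a, b) \<in> orbit_rel D T)"
    using orbit_of[of X] X by auto
next
  assume *: "D \<noteq> {} \<and> (\<forall>a\<in>D. \<forall>b\<in>D. (a, b) \<in> orbit_rel D T)"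
  then have "orbit_rel D T `` {a} = D" if "a \<in> D" for a
    using that rel_in by auto
  then have "orbits D T = {D}" unfolding orbits_eq using * by auto
  then show "card (orbits D T) = 1" by simp
qed

end

text \<open>Each finer orbit lies in one coarser orbit, and this map is onto. It glues the orbits of
  \<open>a\<close> and \<open>b\<close>, so it is not injective and the count drops.\<close>

lemma card_orbits_less:
  assumes "finite D" "involutions D T" "involutions D T'"
    and sub: "orbit_rel D T \<subseteq> orbit_rel D T'"
    and ab: "a \<in> D" "b \<in> D" "(a, b) \<in> orbit_rel D T'" "(a, b) \<notin> orbit_rel D T"
  shows "card (orbits D T') < card (orbits D T)"
proof -
  interpret T: involutions D T by fact
  interpret T': involutions D T' by fact
  have fin: "finite (orbits D T)" unfolding orbits_eq using assms(1) by simp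
  define f where "f X = orbit_rel D T' `` X" for X
  have f: "f (orbit_rel D T `` {c}) = orbit_rel D T' `` {c}" for c
    unfolding f_def using sub by (auto dest: orbit_rel_trans)
  have im: "f ` orbits D T = orbits D T'"
    unfolding orbits_eq image_image using f by simp
  have "\<not> inj_on f (orbits D T)"
  proof
    assume "inj_on f (orbits D T)"
    moreover have "f (orbit_rel D T `` {a}) = f (orbit_rel D T `` {b})"
      unfolding f by (rule T'.orbit_eqI) (rule ab)
    ultimately have "orbit_rel D T `` {a} = orbit_rel D T `` {b}"
      by (rule inj_onD) (use ab(1,2) in \<open>simp_all add: orbits_eq\<close>)
    then show False using ab(4) by auto
  qed
  then have "card (f ` orbits D T) \<noteq> card (orbits D T)"
    using eq_card_imp_inj_on[OF fin] by blast
  then show ?thesis using card_image_le[OF fin, of f] unfolding im by simp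
qed

text \<open>An orbit that misses \<open>e\<close> is traversed without using the involutions on
  \<open>e\<close>, so it is an orbit of any family with the same images elsewhere. Circles away
  from an edge thus survive an operation on it as literally the same sets.\<close>

lemma orbits_avoiding_subset:
  assumes "involutions D T" "involutions D T'"
    and agree: "\<And>a. a \<in> D - e \<Longrightarrow> (\<lambda>t. t a) ` T = (\<lambda>t. t a) ` T'"
  shows "{s \<in> orbits D T. s \<inter> e = {}} \<subseteq> {s \<in> orbits D T'. s \<inter> e = {}}"
proof
  interpret T: involutions D T by fact
  interpret T': involutions D T' by fact
  fix s assume "s \<in> {s \<in> orbits D T. s \<inter> e = {}}"
  then have s: "s \<in> orbits D T" "s \<inter> e = {}" by auto
  then obtain x where x: "x \<in> D" "s = orbit_rel D T `` {x}" unfolding orbits_eq by auto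
  have 1: "y \<in> orbit_rel D T' `` {x}" if "(x, y) \<in> orbit_rel D T" for y
  proof -
    have "y \<in> s \<inter> orbit_rel D T' `` {x}"
    proof (rule orbit_rel_closed[OF that])
      show "x \<in> s \<inter> orbit_rel D T' `` {x}" using x by auto
      fix c t assume c: "c \<in> s \<inter> orbit_rel D T' `` {x}" "c \<in> D" "t \<in> T"
      then have "c \<in> D - e" using s by auto
      then obtain t' where "t' \<in> T'" "t c = t' c" using agree c(3) by (metis (no_types, lifting) imageE imageI)
      then have "(c, t c) \<in> orbit_rel D T'" using orbit_rel_step[OF c(2), of t' T'] by simp
      moreover have "t c \<in> s" using T.orbits_closed[OF s(1)] c by auto
      ultimately show "t c \<in> s \<inter> orbit_rel D T' `` {x}"
        using c(1) by (auto dest: orbit_rel_trans)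
    qed
    then show ?thesis by simp
  qed
  have 2: "y \<in> s" if "(x, y) \<in> orbit_rel D T'" for y
  proof (rule orbit_rel_closed[OF that])
    show "x \<in> s" using x by auto
    fix c t assume c: "c \<in> s" "c \<in> D" "t \<in> T'"
    then have "c \<in> D - e" using s by auto
    then obtain t' where "t' \<in> T" "t c = t' c" using agree c(3) by (metis (no_types, lifting) imageE imageI)
    then show "t c \<in> s" using T.orbits_closed[OF s(1) c(1)] by auto
  qed
  have "s = orbit_rel D T' `` {x}" using 1 2 x by auto
  then show "s \<in> {s \<in> orbits D T'. s \<inter> e = {}}" using s x unfolding orbits_eq by auto
qed

lemma orbits_avoiding_eq:
  assumes "involutions D T" "involutions D T'"
    and "\<And>a. a \<in> D - e \<Longrightarrow> (\<lambda>t. t a) ` T = (\<lambda>t. t a) ` T'"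
  shows "{s \<in> orbits D T. s \<inter> e = {}} = {s \<in> orbits D T'. s \<inter> e = {}}"
  using orbits_avoiding_subset[OF assms] orbits_avoiding_subset[of D T' T e] assms
  by (metis (no_types, lifting) subset_antisym)


section \<open>Twisted ribbon graphs\<close>

text \<open>
  Deletion, contraction, partial duality and passage to a spanning subgraph all replace \<open>tau0\<close> by
  \<open>tau2\<close> on one union of edges and \<open>tau2\<close> by \<open>tau0\<close> on another.
\<close>

definition twist :: "'f set \<Rightarrow> 'f set \<Rightarrow> 'f ribbon \<Rightarrow> 'f ribbon" where
  "twist U V G =
     G\<lparr>tau0 := (\<lambda>a. if a \<in> U then tau2 G a else tau0 G a),
       tau2 := (\<lambda>a. if a \<in> V then tau0 G a else tau2 G a)\<rparr>"

lemma twist_simps [simp]: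
  "flags (twist U V G) = flags G"
  "tau0 (twist U V G) a = (if a \<in> U then tau2 G a else tau0 G a)"
  "tau1 (twist U V G) = tau1 G"
  "tau2 (twist U V G) a = (if a \<in> V then tau0 G a else tau2 G a)"
  by (simp_all add: twist_def)

text \<open>Saturation under the edge orbits, which makes a twist keep the commutation of
  \<open>tau0\<close> and \<open>tau2\<close>. Complements of unions of edges qualify too; they
  occur in spanning subgraphs.\<close>

definition slot_closed :: "'f ribbon \<Rightarrow> 'f set \<Rightarrow> bool" where
  "slot_closed G U \<longleftrightarrow> (\<forall>a\<in>flags G. (tau0 G a \<in> U \<longleftrightarrow> a \<in> U) \<and> (tau2 G a \<in> U \<longleftrightarrow> a \<in> U))"

definition edge_at :: "'f ribbon \<Rightarrow> 'f \<Rightarrow> 'f set" where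
  "edge_at G a = {a, tau0 G a, tau2 G a, tau0 G (tau2 G a)}"

locale rgraph =
  fixes G :: "'f ribbon"
  assumes rg: "ribbon_graph G"
begin

lemma finite_flags: "finite (flags G)"
  using rg by (simp add: ribbon_graph_def)

lemma tau_in [simp]:
  "a \<in> flags G \<Longrightarrow> tau0 G a \<in> flags G"
  "a \<in> flags G \<Longrightarrow> tau1 G a \<in> flags G"
  "a \<in> flags G \<Longrightarrow> tau2 G a \<in> flags G"
  using rg by (auto simp: ribbon_graph_def free_involution_on_def)

lemma tau_tau [simp]:
  "a \<in> flags G \<Longrightarrow> tau0 G (tau0 G a) = a"
  "a \<in> flags G \<Longrightarrow> tau1 G (tau1 G a) = a"
  "a \<in> flags G \<Longrightarrow> tau2 G (tau2 G a) = a"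
  using rg by (auto simp: ribbon_graph_def free_involution_on_def)

lemma tau_neq [simp]:
  "a \<in> flags G \<Longrightarrow> tau0 G a \<noteq> a"
  "a \<in> flags G \<Longrightarrow> tau1 G a \<noteq> a"
  "a \<in> flags G \<Longrightarrow> tau2 G a \<noteq> a"
  using rg by (auto simp: ribbon_graph_def free_involution_on_def)

lemma tau2_tau0: "a \<in> flags G \<Longrightarrow> tau2 G (tau0 G a) = tau0 G (tau2 G a)"
  using rg by (simp add: ribbon_graph_def)

lemma free_tau:
  "free_involution_on (flags G) (tau0 G)"
  "free_involution_on (flags G) (tau1 G)"
  "free_involution_on (flags G) (tau2 G)"
  using rg by (auto simp: ribbon_graph_def)

sublocale V: involutions "flags G" "{tau1 G, tau2 G}"
  by unfold_locales (use free_tau in auto)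
sublocale E: involutions "flags G" "{tau0 G, tau2 G}"
  by unfold_locales (use free_tau in auto)
sublocale S: involutions "flags G" "{tau0 G, tau1 G, tau2 G}"
  by unfold_locales (use free_tau in auto)

lemma partition_vertices: "partition_on (flags G) (vertices G)"
  unfolding vertices_def by (rule V.partition_orbits)

lemma Union_vertices [simp]: "\<Union> (vertices G) = flags G"
  using partition_onD1[OF partition_vertices] by simp

lemma edge_orbit: "a \<in> flags G \<Longrightarrow> orbit_rel (flags G) {tau0 G, tau2 G} `` {a} = edge_at G a"
proof
  assume a: "a \<in> flags G"
  show "orbit_rel (flags G) {tau0 G, tau2 G} `` {a} \<subseteq> edge_at G a"
  proof
    fix b assume "b \<in> orbit_rel (flags G) {tau0 G, tau2 G} `` {a}"
    then have "(a, b) \<in> orbit_rel (flags G) {tau0 G, tau2 G}" by simp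
    then show "b \<in> edge_at G a"
      by (rule orbit_rel_closed) (use a in \<open>auto simp: edge_at_def tau2_tau0\<close>)
  qed
  have "(a, tau0 G a) \<in> orbit_rel (flags G) {tau0 G, tau2 G}"
    "(a, tau2 G a) \<in> orbit_rel (flags G) {tau0 G, tau2 G}"
    "(tau2 G a, tau0 G (tau2 G a)) \<in> orbit_rel (flags G) {tau0 G, tau2 G}"
    using a by (auto intro: orbit_rel_step)
  then show "edge_at G a \<subseteq> orbit_rel (flags G) {tau0 G, tau2 G} `` {a}"
    unfolding edge_at_def using orbit_rel_trans[of a "tau2 G a"] by auto
qed

lemma card_edge_at: "a \<in> flags G \<Longrightarrow> card (edge_at G a) = 4 \<longleftrightarrow> tau0 G a \<noteq> tau2 G a"
proof
  assume a: "a \<in> flags G" and "card (edge_at G a) = 4"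
  then show "tau0 G a \<noteq> tau2 G a"
    by (auto simp: edge_at_def card_insert_if split: if_splits)
next
  assume a: "a \<in> flags G" and ne: "tau0 G a \<noteq> tau2 G a"
  have "a \<noteq> tau0 G (tau2 G a)" using a ne by (metis tau_in(3) tau_tau(1))
  moreover have "tau0 G a \<noteq> tau0 G (tau2 G a)" using a by (metis tau_in(3) tau_tau(1) tau_neq(3))
  moreover have "tau2 G a \<noteq> tau0 G (tau2 G a)" using tau_neq(1)[OF tau_in(3)[OF a]] by metis
  moreover have "a \<noteq> tau0 G a" "a \<noteq> tau2 G a" using tau_neq[OF a] by metis+
  ultimately have "distinct [a, tau0 G a, tau2 G a, tau0 G (tau2 G a)]"
    using ne by simp
  then have "card (set [a, tau0 G a, tau2 G a, tau0 G (tau2 G a)]) = 4"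
    using distinct_card by fastforce
  then show "card (edge_at G a) = 4"
    by (simp add: edge_at_def)
qed

lemma edges_eq: "edges G = edge_at G ` {a \<in> flags G. tau0 G a \<noteq> tau2 G a}"
  unfolding edges_def orbits_eq using edge_orbit card_edge_at by auto

lemma edge_of: "e \<in> edges G \<Longrightarrow> a \<in> e \<Longrightarrow> a \<in> flags G \<and> tau0 G a \<noteq> tau2 G a \<and> e = edge_at G a"
proof -
  assume e: "e \<in> edges G" "a \<in> e"
  then have orb: "e \<in> orbits (flags G) {tau0 G, tau2 G}" "card e = 4" by (auto simp: edges_def)
  then have a: "a \<in> flags G" using E.partition_orbits e partition_onD1 by blast
  then have "e = edge_at G a" using E.orbit_of[OF orb(1) e(2)] edge_orbit by simp
  then show ?thesis using a orb(2) card_edge_at by auto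
qed

lemma edge_nonempty: "e \<in> edges G \<Longrightarrow> e \<noteq> {}"
  by (auto simp: edges_def)

lemma edge_subset: "e \<in> edges G \<Longrightarrow> e \<subseteq> flags G"
  using edge_of by blast

lemma edges_disjoint: "e \<in> edges G \<Longrightarrow> f \<in> edges G \<Longrightarrow> a \<in> e \<Longrightarrow> a \<in> f \<Longrightarrow> e = f"
  using edge_of by metis

lemma edge_disjoint_iff: "e \<in> edges G \<Longrightarrow> f \<in> edges G \<Longrightarrow> e \<inter> f = {} \<longleftrightarrow> e \<noteq> f"
  using edges_disjoint edge_nonempty by (metis disjoint_iff Int_absorb)

lemma finite_edges: "finite (edges G)"
  unfolding edges_eq using finite_flags by simp

lemma slot_closed_Union: "A \<subseteq> edges G \<Longrightarrow> slot_closed G (\<Union>A)"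
proof -
  assume A: "A \<subseteq> edges G"
  have 1: "tau0 G a \<in> \<Union>A" "tau2 G a \<in> \<Union>A" if "a \<in> \<Union>A" for a
  proof -
    from that obtain e where e: "e \<in> A" "a \<in> e" by auto
    then have "e = edge_at G a" using A edge_of by auto
    then have "tau0 G a \<in> e" "tau2 G a \<in> e" by (simp_all add: edge_at_def)
    then show "tau0 G a \<in> \<Union>A" "tau2 G a \<in> \<Union>A" using e(1) by blast+
  qed
  show ?thesis
    unfolding slot_closed_def
  proof (intro ballI conjI iffI)
    fix a assume a: "a \<in> flags G"
    show "a \<in> \<Union>A" if "tau0 G a \<in> \<Union>A" using 1(1)[OF that] a by simp
    show "a \<in> \<Union>A" if "tau2 G a \<in> \<Union>A" using 1(2)[OF that] a by simp
  qed (use 1 in auto)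
qed

lemma slot_closed_edge: "e \<in> edges G \<Longrightarrow> slot_closed G e"
  using slot_closed_Union[of "{e}"] by simp

lemma Union_edges_disjoint_iff: "A \<subseteq> edges G \<Longrightarrow> e \<in> edges G \<Longrightarrow> e \<inter> \<Union>A = {} \<longleftrightarrow> e \<notin> A"
  using edges_disjoint edge_nonempty by fastforce

context
  fixes U V
  assumes UV: "slot_closed G U" "slot_closed G V"
begin

lemma ribbon_graph_twist: "ribbon_graph (twist U V G)"
  unfolding ribbon_graph_def free_involution_on_def twist_def
  using UV finite_flags by (auto simp: slot_closed_def tau2_tau0)

lemma edge_at_twist: 
  assumes "a \<in> flags G"
  shows "tau0 (twist U V G) a \<noteq> tau2 (twist U V G) a \<longleftrightarrow> tau0 G a \<noteq> tau2 G a \<and> (a \<in> U \<longleftrightarrow> a \<in> V)"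
    and "a \<in> U \<longleftrightarrow> a \<in> V \<Longrightarrow> edge_at (twist U V G) a = edge_at G a"
  using assms UV by (auto simp: twist_def edge_at_def slot_closed_def tau2_tau0)

text \<open>Where only one of the two replacements applies, \<open>tau0\<close> and
  \<open>tau2\<close> coincide and the edge dissolves into empty slots. Where both apply they trade
  places, so the orbit is still an edge.\<close>

lemma edges_twist: "edges (twist U V G) = {e \<in> edges G. e \<inter> U = {} \<longleftrightarrow> e \<inter> V = {}}"
proof -
  interpret T: rgraph "twist U V G" by unfold_locales (rule ribbon_graph_twist)
  have fl: "flags (twist U V G) = flags G" by (simp add: twist_def)
  have *: "(edge_at G a \<inter> U = {} \<longleftrightarrow> edge_at G a \<inter> V = {}) \<longleftrightarrow> (a \<in> U \<longleftrightarrow> a \<in> V)" if "a \<in> flags G" for a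
    using that UV by (auto simp: edge_at_def slot_closed_def)
  have "edges (twist U V G) = edge_at (twist U V G) ` {a \<in> flags G. tau0 G a \<noteq> tau2 G a \<and> (a \<in> U \<longleftrightarrow> a \<in> V)}"
    unfolding T.edges_eq fl using edge_at_twist(1) by (intro image_cong) auto
  also have "\<dots> = edge_at G ` {a \<in> flags G. tau0 G a \<noteq> tau2 G a \<and> (a \<in> U \<longleftrightarrow> a \<in> V)}"
    using edge_at_twist(2) by (intro image_cong) auto
  also have "\<dots> = {e \<in> edges G. e \<inter> U = {} \<longleftrightarrow> e \<inter> V = {}}"
    unfolding edges_eq using * by auto
  finally show ?thesis .
qed

end

lemma slot_closed_empty [simp]: "slot_closed G {}"
  by (simp add: slot_closed_def)

lemma slot_closed_Compl: "slot_closed G U \<Longrightarrow> slot_closed G (- U)"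
  by (auto simp: slot_closed_def)

section \<open>Operations on ribbon graphs as twists\<close>

lemma delete_twist: "delete e G = twist e {} G"
  by (simp add: delete_def twist_def)

lemma contract_twist: "contract e G = twist {} e G"
  by (simp add: contract_def twist_def)

lemma partial_dual_twist: "partial_dual G A = twist (\<Union>A) (\<Union>A) G"
  by (simp add: partial_dual_def twist_def)

lemma spanning_subgraph_twist: "spanning_subgraph G A = twist (- \<Union>A) {} G"
  by (simp add: spanning_subgraph_def ribbon_subgraph_def twist_def fun_eq_iff)

lemma edges_spanning_subgraph [simp]: "A \<subseteq> edges G \<Longrightarrow> edges (spanning_subgraph G A) = A"
proof -
  assume A: "A \<subseteq> edges G"
  have "e \<inter> - \<Union>A = {} \<longleftrightarrow> e \<in> A" if "e \<in> edges G" for e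
  proof
    assume "e \<inter> - \<Union>A = {}"
    then show "e \<in> A" using Union_edges_disjoint_iff[OF A that] edge_nonempty[OF that] by blast
  qed auto
  then show ?thesis
    unfolding spanning_subgraph_twist
    using edges_twist[OF slot_closed_Compl[OF slot_closed_Union[OF A]] slot_closed_empty] A by auto
qed

lemma partial_dual:
  assumes "A \<subseteq> edges G"
  shows "ribbon_graph (partial_dual G A)" "edges (partial_dual G A) = edges G"
    "flags (partial_dual G A) = flags G" "tau1 (partial_dual G A) = tau1 G"
  unfolding partial_dual_twist
  using ribbon_graph_twist[OF slot_closed_Union slot_closed_Union, OF assms assms]
    edges_twist[OF slot_closed_Union slot_closed_Union, OF assms assms] by simp_all

lemma contract:
  assumes "e \<in> edges G"
  shows "ribbon_graph (contract e G)" "edges (contract e G) = edges G - {e}"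
    "flags (contract e G) = flags G" "tau1 (contract e G) = tau1 G" "tau0 (contract e G) = tau0 G"
  unfolding contract_twist
  using ribbon_graph_twist[OF slot_closed_empty slot_closed_edge, OF assms]
    edges_twist[OF slot_closed_empty slot_closed_edge, OF assms] edge_disjoint_iff[OF _ assms]
  by (auto simp: fun_eq_iff)

lemma delete:
  assumes "e \<in> edges G"
  shows "ribbon_graph (delete e G)" "edges (delete e G) = edges G - {e}"
    "flags (delete e G) = flags G" "tau1 (delete e G) = tau1 G" "tau2 (delete e G) = tau2 G"
  unfolding delete_twist
  using ribbon_graph_twist[OF slot_closed_edge slot_closed_empty, OF assms]
    edges_twist[OF slot_closed_edge slot_closed_empty, OF assms] edge_disjoint_iff[OF _ assms]
  by (auto simp: fun_eq_iff)

text \<open>Both sides run along \<open>tau0\<close> on \<open>A\<close> and along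
  \<open>tau2\<close> elsewhere, with \<open>tau1\<close> at the corners. This turns quasi-trees
  into one-vertex partial duals.\<close>

lemma boundaries_spanning_subgraph:
  assumes "A \<subseteq> edges G"
  shows "boundaries (spanning_subgraph G A) = vertices (partial_dual G A)"
  unfolding spanning_subgraph_twist partial_dual_twist boundaries_def vertices_def
  by (auto intro!: orbits_cong)

lemma Union_symdiff: 
  assumes "A \<subseteq> edges G" "X \<subseteq> edges G"
  shows "a \<in> \<Union>(A - X \<union> (X - A)) \<longleftrightarrow> (a \<in> \<Union>A) \<noteq> (a \<in> \<Union>X)"
proof -
  have "e = f" if "a \<in> e" "a \<in> f" "e \<in> A \<union> X" "f \<in> A \<union> X" for e f
    using edges_disjoint[of e f a] that assms by blast
  then show ?thesis by blast
qed

text \<open>Swapping \<open>tau0\<close> and \<open>tau2\<close> twice at an edge undoes the swap,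
  and since edges are disjoint each flag sees only its own edge.\<close>

lemma partial_dual_partial_dual:
  assumes "A \<subseteq> edges G" "X \<subseteq> edges G"
  shows "partial_dual (partial_dual G A) X = partial_dual G (A - X \<union> (X - A))"
  unfolding partial_dual_def Union_symdiff[OF assms] by (simp add: fun_eq_iff)

end

section \<open>Travelling around a vertex\<close>

text \<open>This is \<open>tau2\<close> of the partial dual by \<open>X\<close>, kept as a map on
  \<open>G\<close> so that the new circles can be traced along the old vertex circle.\<close>

definition swapped :: "'f ribbon \<Rightarrow> 'f set set \<Rightarrow> 'f \<Rightarrow> 'f" where
  "swapped G X a = (if a \<in> \<Union>X then tau0 G a else tau2 G a)"

context rgraph
begin

lemma turn_in: "a \<in> flags G \<Longrightarrow> turn G a \<in> flags G"
  by (simp add: turn_def)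

lemma turn_pow_in [simp]: "a \<in> flags G \<Longrightarrow> (turn G ^^ i) a \<in> flags G"
  by (induction i) (auto simp: turn_in)

lemma turn_inj: "a \<in> flags G \<Longrightarrow> b \<in> flags G \<Longrightarrow> turn G a = turn G b \<Longrightarrow> a = b"
  unfolding turn_def by (metis tau_in tau_tau)

lemma turn_cancel:
  assumes "a \<in> flags G" "(turn G ^^ i) a = (turn G ^^ (i + m)) a"
  shows "(turn G ^^ m) a = a"
  using assms(2)
proof (induction i)
  case (Suc i)
  then have "turn G ((turn G ^^ i) a) = turn G ((turn G ^^ (i + m)) a)" by simp
  then show ?case using Suc.IH turn_inj assms(1) turn_pow_in by metis
qed simp

lemma circuit:
  assumes a: "a \<in> flags G"
  shows "0 < circuit_length G a" "(turn G ^^ circuit_length G a) a = a"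
proof -
  have "\<not> inj (\<lambda>i. (turn G ^^ i) a)"
  proof
    assume "inj (\<lambda>i. (turn G ^^ i) a)"
    moreover have "range (\<lambda>i. (turn G ^^ i) a) \<subseteq> flags G" using a by auto
    then have "finite (range (\<lambda>i. (turn G ^^ i) a))" using finite_flags by (rule finite_subset)
    ultimately have "finite (UNIV :: nat set)" by (rule finite_imageD[rotated])
    then show False by simp
  qed
  then obtain i j where ij: "(turn G ^^ i) a = (turn G ^^ j) a" "i < j"
    unfolding inj_def by (metis linorder_neqE_nat)
  then have "(turn G ^^ (j - i)) a = a" using turn_cancel[OF a, of i "j - i"] by simp
  then have "0 < j - i \<and> (turn G ^^ (j - i)) a = a" using ij by simp
  then have "0 < circuit_length G a \<and> (turn G ^^ circuit_length G a) a = a"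
    unfolding circuit_length_def by (rule LeastI)
  then show "0 < circuit_length G a" "(turn G ^^ circuit_length G a) a = a" by auto
qed

lemma circuit_inj:
  assumes a: "a \<in> flags G" and "i < circuit_length G a" "j < circuit_length G a"
    and "(turn G ^^ i) a = (turn G ^^ j) a"
  shows "i = j"
proof -
  have le: "i = j" if "i \<le> j" "j < circuit_length G a" "(turn G ^^ i) a = (turn G ^^ j) a" for i j
  proof (rule ccontr)
    assume "i \<noteq> j"
    then have "0 < j - i \<and> (turn G ^^ (j - i)) a = a"
      using turn_cancel[OF a, of i "j - i"] that by simp
    moreover have "j - i < circuit_length G a" using that by simp
    ultimately show False unfolding circuit_length_def using not_less_Least by blast
  qed
  show ?thesis
    using le[of i j] le[of j i] assms by (cases "i \<le> j") simp_all
qed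

lemma tau1_tau2_turn: "tau1 G (tau2 G ((turn G ^^ i) a)) = (turn G ^^ Suc i) a"
  by (simp add: turn_def)

lemma tau1_turn: "a \<in> flags G \<Longrightarrow> tau1 G ((turn G ^^ Suc i) a) = tau2 G ((turn G ^^ i) a)"
  by (simp add: turn_def)

text \<open>An equality for \<open>m\<close> gives, after applying \<open>tau1\<close> and then
  \<open>tau2\<close>, the same equality for \<open>m - 2\<close> at \<open>turn G b\<close>; for 0
  and 1 it contradicts that \<open>tau2\<close> and \<open>tau1\<close> have no fixed points. Thus
  first and second ends of slots are never confused along a circle.\<close>

lemma turn_pow_neq_tau2: "b \<in> flags G \<Longrightarrow> (turn G ^^ m) b \<noteq> tau2 G b"
proof (induction m arbitrary: b rule: less_induct)
  case (less m)
  consider "m = 0" | "m = 1" | k where "m = Suc (Suc k)"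
    by (metis One_nat_def old.nat.exhaust)
  then show ?case
  proof cases
    case 1
    then show ?thesis using tau_neq(3)[OF less.prems] by (metis funpow_0)
  next
    case 2
    then show ?thesis using less.prems by (simp add: turn_def)
  next
    case 3
    show ?thesis
    proof
      assume "(turn G ^^ m) b = tau2 G b"
      then have "tau1 G ((turn G ^^ Suc k) (turn G b)) = tau1 G (tau2 G b)"
        unfolding 3 by (simp add: funpow_swap1)
      then have "tau2 G ((turn G ^^ k) (turn G b)) = turn G b"
        using less.prems turn_in tau1_turn by (simp add: turn_def del: funpow.simps)
      then have "(turn G ^^ k) (turn G b) = tau2 G (turn G b)"
        using less.prems turn_in tau_tau(3) turn_pow_in by metis
      then show False using less.IH[of k "turn G b"] less.prems turn_in 3 by simp
    qed
  qed
qed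

lemma turn_neq_tau2_turn:
  assumes a: "a \<in> flags G"
  shows "(turn G ^^ i) a \<noteq> tau2 G ((turn G ^^ j) a)"
proof -
  have le: "(turn G ^^ j) a \<noteq> tau2 G ((turn G ^^ i) a)" if "i \<le> j" for i j
  proof -
    have "(turn G ^^ j) a = (turn G ^^ (j - i)) ((turn G ^^ i) a)"
      using that by (metis comp_apply funpow_add le_add_diff_inverse2)
    then show ?thesis using turn_pow_neq_tau2[OF turn_pow_in[OF a]] by metis
  qed
  show ?thesis
  proof (cases "i \<le> j")
    case True
    have "(turn G ^^ j) a = tau2 G (tau2 G ((turn G ^^ j) a))" using a by simp
    then show ?thesis using le[OF True] by metis
  next
    case False
    then show ?thesis using le by simp
  qed
qed

text \<open>The listed flags are closed under both involutions: \<open>tau2\<close> changes the end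
  of a slot, \<open>tau1\<close> passes to the neighbouring slot, cyclically.\<close>

lemma vertex_position:
  assumes a: "a \<in> flags G" and "(a, d) \<in> orbit_rel (flags G) {tau1 G, tau2 G}"
  obtains i where "i < circuit_length G a" "d = (turn G ^^ i) a \<or> d = tau2 G ((turn G ^^ i) a)"
proof -
  let ?n = "circuit_length G a"
  let ?S = "{d. \<exists>i<?n. d = (turn G ^^ i) a \<or> d = tau2 G ((turn G ^^ i) a)}"
  have "d \<in> ?S"
  proof (rule orbit_rel_closed[OF assms(2)])
    show "a \<in> ?S" using circuit(1)[OF a] by (intro CollectI exI[of _ 0]) auto
    fix c t assume c: "c \<in> ?S" "c \<in> flags G" "t \<in> {tau1 G, tau2 G}"
    then obtain i where i: "i < ?n" "c = (turn G ^^ i) a \<or> c = tau2 G ((turn G ^^ i) a)" by auto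
    have 2: "tau2 G c \<in> ?S" using i a by auto
    have 1: "tau1 G c \<in> ?S"
    proof (cases "c = (turn G ^^ i) a")
      case True
      obtain k where k: "k < ?n" "c = (turn G ^^ Suc k) a"
      proof (cases i)
        \<comment> \<open>Slot 0 has the last slot as predecessor, since \<open>a\<close> is also
          the flag at position \<open>?n\<close>.\<close>
        case 0
        then have "c = (turn G ^^ Suc (?n - 1)) a" using True circuit[OF a] by simp
        then show ?thesis using that[of "?n - 1"] circuit(1)[OF a] by simp
      next
        case (Suc k)
        then show ?thesis using that[of k] True i by simp
      qed
      then have "tau1 G c = tau2 G ((turn G ^^ k) a)" using tau1_turn[OF a] by simp
      then show ?thesis using k(1) by blast
    next
      case False
      then have c': "tau1 G c = (turn G ^^ Suc i) a" using i by (simp only: tau1_tau2_turn simp_thms)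
      show ?thesis
      proof (cases "Suc i = ?n")
        case True
        then have "tau1 G c = (turn G ^^ 0) a" using c' circuit(2)[OF a] by simp
        then show ?thesis using circuit(1)[OF a] by blast
      next
        case False
        then have "Suc i < ?n" using i by simp
        then show ?thesis using c' by blast
      qed
    qed
    show "t c \<in> ?S" using c(3) 1 2 by auto
  qed
  then show ?thesis using that by blast
qed

text \<open>A walk by corners and inner slots along one arc of the circle. In the uses below
  \<open>s\<close> is a swapped slot map and the arc runs between slots of dualised edges, whose
  interior is left alone.\<close>

lemma arc_rel:
  assumes a: "a \<in> flags G" and "i < j"
    and "\<And>l. i < l \<Longrightarrow> l < j \<Longrightarrow> ((turn G ^^ l) a, tau2 G ((turn G ^^ l) a)) \<in> orbit_rel (flags G) {tau1 G, s}"
  shows "(tau2 G ((turn G ^^ i) a), (turn G ^^ j) a) \<in> orbit_rel (flags G) {tau1 G, s}"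
  using assms(2,3)
proof (induction j)
  case (Suc j)
  have step: "(tau2 G ((turn G ^^ l) a), (turn G ^^ Suc l) a) \<in> orbit_rel (flags G) {tau1 G, s}" for l
    using orbit_rel_step[of "tau2 G ((turn G ^^ l) a)" "flags G" "tau1 G" "{tau1 G, s}"] a
    by (simp add: tau1_tau2_turn del: funpow.simps)
  show ?case
  proof (cases "i = j")
    case True
    then show ?thesis using step by simp
  next
    case False
    then have "(tau2 G ((turn G ^^ i) a), (turn G ^^ j) a) \<in> orbit_rel (flags G) {tau1 G, s}"
      using Suc by simp
    moreover have "((turn G ^^ j) a, tau2 G ((turn G ^^ j) a)) \<in> orbit_rel (flags G) {tau1 G, s}"
      using Suc.prems False by simp
    ultimately show ?thesis using step orbit_rel_trans by metis
  qed
qed simp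

lemma arc_cover:
  assumes a: "a \<in> flags G" and x: "(x, tau2 G ((turn G ^^ i) a)) \<in> orbit_rel (flags G) {tau1 G, s}"
    and slots: "\<And>l. i < l \<Longrightarrow> l < j \<Longrightarrow> ((turn G ^^ l) a, tau2 G ((turn G ^^ l) a)) \<in> orbit_rel (flags G) {tau1 G, s}"
  shows "i < l \<Longrightarrow> l \<le> j \<Longrightarrow> (x, (turn G ^^ l) a) \<in> orbit_rel (flags G) {tau1 G, s}"
    and "i \<le> l \<Longrightarrow> l < j \<Longrightarrow> (x, tau2 G ((turn G ^^ l) a)) \<in> orbit_rel (flags G) {tau1 G, s}"
proof -
  have 1: "(x, (turn G ^^ l) a) \<in> orbit_rel (flags G) {tau1 G, s}" if "i < l" "l \<le> j" for l
    using orbit_rel_trans[OF x arc_rel[OF a that(1)]] slots that by simp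
  then show "i < l \<Longrightarrow> l \<le> j \<Longrightarrow> (x, (turn G ^^ l) a) \<in> orbit_rel (flags G) {tau1 G, s}" .
  assume l: "i \<le> l" "l < j"
  show "(x, tau2 G ((turn G ^^ l) a)) \<in> orbit_rel (flags G) {tau1 G, s}"
  proof (cases "i = l")
    case False
    then show ?thesis using orbit_rel_trans[OF 1[of l] slots[of l]] l by simp
  qed (use x in simp)
qed

lemma vertices_partial_dual:
  assumes "X \<subseteq> edges G"
  shows "vertices (partial_dual G X) =
    orbits (flags G) {tau1 G, swapped G X}"
  unfolding vertices_def partial_dual_twist by (auto simp: swapped_def intro!: orbits_cong)

lemma involutions_partial_dual:
  assumes "X \<subseteq> edges G"
  shows "involutions (flags G) {tau1 G, swapped G X}"
proof -
  interpret H: rgraph "partial_dual G X"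
    by unfold_locales (rule partial_dual(1)[OF assms])
  have "tau2 (partial_dual G X) = swapped G X"
    by (simp add: partial_dual_def swapped_def fun_eq_iff)
  then show ?thesis using H.V.involutions_axioms partial_dual[OF assms] by simp
qed

text \<open>An edge between two vertices has one slot on each. Dualising removes these slots, but
  the two ends of a removed slot stay connected the other way around the vertex, so no vertex is
  cut; the free sides now join the two vertices.\<close>

lemma partial_dual_joining_edge:
  assumes a: "a \<in> flags G" and apart: "(a, tau0 G a) \<notin> orbit_rel (flags G) {tau1 G, tau2 G}"
  shows "edge_at G a \<in> edges G"
    and "card (vertices (partial_dual G {edge_at G a})) < card (vertices G)"
proof -
  let ?R = "orbit_rel (flags G) {tau1 G, tau2 G}"
  have a2: "(a, tau2 G a) \<in> ?R" using a by (simp add: orbit_rel_step)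
  show e: "edge_at G a \<in> edges G" unfolding edges_eq using a a2 apart by auto
  let ?e = "edge_at G a"
  let ?s = "swapped G {?e}"
  let ?R' = "orbit_rel (flags G) {tau1 G, ?s}"
  have inv': "involutions (flags G) {tau1 G, ?s}"
    by (rule involutions_partial_dual) (use e in simp)
  interpret T': involutions "flags G" "{tau1 G, ?s}" by (rule inv')
  have e_eq: "?e = {a, tau0 G a, tau2 G a, tau0 G (tau2 G a)}" by (simp add: edge_at_def)
  have e_eq': "?e = {b, tau2 G b, tau0 G b, tau0 G (tau2 G b)}" if "b \<in> ?e" for b
    using edge_of[OF e that] by (auto simp: edge_at_def)
  have far: "(b, tau0 G b) \<notin> ?R" if b: "b \<in> ?e" for b
  proof
    assume R: "(b, tau0 G b) \<in> ?R"
    have a02: "(tau0 G a, tau0 G (tau2 G a)) \<in> ?R"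
      using orbit_rel_step[of "tau0 G a" "flags G" "tau2 G" "{tau1 G, tau2 G}"] a
      by (simp add: tau2_tau0)
    from b consider "b = a" | "b = tau0 G a" | "b = tau2 G a" | "b = tau0 G (tau2 G a)"
      unfolding e_eq by blast
    then have "(a, tau0 G a) \<in> ?R"
    proof cases
      case 1 then show ?thesis using R by simp
    next
      case 2 then show ?thesis using R a V.rel_sym by simp
    next
      case 3 then show ?thesis using R a2 a02 V.rel_sym orbit_rel_trans by metis
    next
      case 4
      then have "(tau0 G (tau2 G a), tau2 G a) \<in> ?R" using R a by simp
      then show ?thesis using a2 a02 V.rel_sym orbit_rel_trans by metis
    qed
    then show False using apart by simp
  qed
  have slot: "(b, tau2 G b) \<in> ?R'" if b: "b \<in> flags G" for b
  proof (cases "b \<in> ?e")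
    case False
    then show ?thesis using orbit_rel_step[OF b, of ?s "{tau1 G, ?s}"] by (simp add: swapped_def)
  next
    case True
    let ?n = "circuit_length G b"
    \<comment> \<open>The removed slot at \<open>b\<close> is bypassed by the full circuit from its
      second end back to \<open>b\<close>, which meets no other flag of the edge.\<close>
    have "(tau2 G ((turn G ^^ 0) b), (turn G ^^ ?n) b) \<in> ?R'"
    proof (rule arc_rel[OF b circuit(1)[OF b]])
      fix l assume l: "0 < l" "l < ?n"
      have Rl: "(b, (turn G ^^ l) b) \<in> ?R"
      proof (induction l)
        case (Suc l)
        then have "(b, tau2 G ((turn G ^^ l) b)) \<in> ?R"
          using orbit_rel_step[of "(turn G ^^ l) b" "flags G" "tau2 G" "{tau1 G, tau2 G}"] b
          by (auto dest: orbit_rel_trans)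
        then show ?case
          using orbit_rel_step[of "tau2 G ((turn G ^^ l) b)" "flags G" "tau1 G" "{tau1 G, tau2 G}"] b
          by (auto simp: tau1_tau2_turn simp del: funpow.simps dest: orbit_rel_trans)
      qed simp
      have "(turn G ^^ l) b \<noteq> b"
        using circuit_inj[OF b l(2) circuit(1)[OF b]] l by auto
      moreover have "(turn G ^^ l) b \<noteq> tau2 G b" by (rule turn_pow_neq_tau2[OF b])
      moreover have "(turn G ^^ l) b \<noteq> tau0 G b" using Rl far[OF True] by metis
      moreover have "(turn G ^^ l) b \<noteq> tau0 G (tau2 G b)"
      proof
        assume "(turn G ^^ l) b = tau0 G (tau2 G b)"
        moreover have "tau2 G b \<in> ?e" using e_eq'[OF True] by auto
        moreover have "(tau2 G b, b) \<in> ?R"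
          using orbit_rel_step[of "tau2 G b" "flags G" "tau2 G" "{tau1 G, tau2 G}"] b by simp
        ultimately show False using far[of "tau2 G b"] Rl orbit_rel_trans by metis
      qed
      ultimately have "(turn G ^^ l) b \<notin> ?e" using e_eq'[OF True] by auto
      then show "((turn G ^^ l) b, tau2 G ((turn G ^^ l) b)) \<in> ?R'"
        using orbit_rel_step[of "(turn G ^^ l) b" "flags G" ?s "{tau1 G, ?s}"] b
        by (simp add: swapped_def)
    qed
    then show ?thesis using circuit(2)[OF b] T'.rel_sym by simp
  qed
  have sub: "?R \<subseteq> ?R'"
    by (rule orbit_rel_subset) (use slot in \<open>auto intro: orbit_rel_step\<close>)
  have "(a, tau0 G a) \<in> ?R'"
    using orbit_rel_step[OF a, of ?s "{tau1 G, ?s}"] by (simp add: edge_at_def swapped_def)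
  then have "card (orbits (flags G) {tau1 G, ?s}) < card (orbits (flags G) {tau1 G, tau2 G})"
    using card_orbits_less[OF finite_flags V.involutions_axioms inv' sub a _ _ apart] a by simp
  then show "card (vertices (partial_dual G {?e})) < card (vertices G)"
    using vertices_partial_dual[of "{?e}"] e by (simp add: vertices_def)
qed

lemma finite_vertices: "finite (vertices G)"
  unfolding vertices_def orbits_eq using finite_flags by simp

end

text \<open>Take a partial dual with fewest vertices. If a free side of some edge left its vertex,
  dualising that edge would lower the count; so each vertex is closed under all three involutions,
  and connectedness leaves just one.\<close>

lemma ex_one_vertex_partial_dual:
  assumes "ribbon_graph G" "connected_ribbon G"
  shows "\<exists>A \<subseteq> edges G. card (vertices (partial_dual G A)) = 1"
proof -
  interpret rgraph G by unfold_locales fact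
  obtain A where A: "A \<subseteq> edges G"
    and min: "\<And>B. B \<subseteq> edges G \<Longrightarrow> card (vertices (partial_dual G A)) \<le> card (vertices (partial_dual G B))"
    using ex_has_least_nat[of "\<lambda>A. A \<subseteq> edges G" "{}" "\<lambda>A. card (vertices (partial_dual G A))"]
    by blast
  interpret H: rgraph "partial_dual G A" by unfold_locales (rule partial_dual[OF A])
  note pd = partial_dual[OF A]
  let ?H = "partial_dual G A"
  let ?R = "orbit_rel (flags G) {tau1 ?H, tau2 ?H}"
  have t0: "(a, tau0 ?H a) \<in> ?R" if a: "a \<in> flags G" for a
  proof (rule ccontr)
    assume "(a, tau0 ?H a) \<notin> ?R"
    then have "edge_at ?H a \<in> edges G"
      "card (vertices (partial_dual ?H {edge_at ?H a})) < card (vertices ?H)"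
      using H.partial_dual_joining_edge[of a] a pd by simp_all
    then show False
      using min[of "A - {edge_at ?H a} \<union> ({edge_at ?H a} - A)"]
        partial_dual_partial_dual[OF A, of "{edge_at ?H a}"] A by auto
  qed
  have conn: "flags G \<noteq> {}" "\<And>a b. a \<in> flags G \<Longrightarrow> b \<in> flags G \<Longrightarrow>
      (a, b) \<in> orbit_rel (flags G) {tau0 G, tau1 G, tau2 G}"
    using assms(2) S.card_orbits_1_iff by (auto simp: connected_ribbon_def surface_components_def)
  have "orbit_rel (flags G) {tau0 G, tau1 G, tau2 G} \<subseteq> ?R"
  proof (rule orbit_rel_subset)
    fix a t assume at: "a \<in> flags G" "t \<in> {tau0 G, tau1 G, tau2 G}"
    then have "t a = tau0 ?H a \<or> t a = tau1 ?H a \<or> t a = tau2 ?H a"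
      by (auto simp: partial_dual_def)
    then show "(a, t a) \<in> ?R"
      using t0[OF at(1)] orbit_rel_step[OF at(1), of "tau1 ?H" "{tau1 ?H, tau2 ?H}"]
        orbit_rel_step[OF at(1), of "tau2 ?H" "{tau1 ?H, tau2 ?H}"] by (elim disjE) simp_all
  qed
  then have "card (vertices ?H) = 1"
    unfolding vertices_def H.V.card_orbits_1_iff unfolding pd(3) using conn by blast
  then show ?thesis using A by blast
qed

section \<open>Ribbon graphs with one vertex\<close>

locale one_vertex = rgraph +
  assumes one: "card (vertices G) = 1"
begin

lemma all_related: "a \<in> flags G \<Longrightarrow> b \<in> flags G \<Longrightarrow> (a, b) \<in> orbit_rel (flags G) {tau1 G, tau2 G}"
  using one V.card_orbits_1_iff by (auto simp: vertices_def)

lemma vertices_one: "vertices G = {flags G}"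
proof -
  obtain v where "vertices G = {v}" using one by (auto simp: card_1_singleton_iff)
  then show ?thesis using Union_vertices by auto
qed

lemma position:
  assumes "a \<in> flags G" "d \<in> flags G"
  obtains i where "i < circuit_length G a" "d = (turn G ^^ i) a \<or> d = tau2 G ((turn G ^^ i) a)"
  using vertex_position[OF assms(1) all_related[OF assms]] .

text \<open>The final alternative records the twist of the loop: free sides join first ends with
  first ends, or first ends with second ends. By \<open>nonorientable_loop_iff\<close> the former is
  the Moebius case.\<close>

lemma edge_positions:
  assumes a: "a \<in> flags G" and f: "f \<in> edges G" "(turn G ^^ i) a \<in> f"
  obtains j where "j < circuit_length G a" "(turn G ^^ j) a \<noteq> (turn G ^^ i) a"
    "f = {(turn G ^^ i) a, tau2 G ((turn G ^^ i) a), (turn G ^^ j) a, tau2 G ((turn G ^^ j) a)}"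
    "tau0 G ((turn G ^^ i) a) = (turn G ^^ j) a \<and> tau0 G (tau2 G ((turn G ^^ i) a)) = tau2 G ((turn G ^^ j) a)
      \<or> tau0 G ((turn G ^^ i) a) = tau2 G ((turn G ^^ j) a) \<and> tau0 G (tau2 G ((turn G ^^ i) a)) = (turn G ^^ j) a"
proof -
  define b where "b = (turn G ^^ i) a"
  have b: "b \<in> flags G" "tau0 G b \<noteq> tau2 G b" "f = {b, tau2 G b, tau0 G b, tau0 G (tau2 G b)}"
    using edge_of[OF f] by (auto simp: b_def edge_at_def)
  obtain j where j: "j < circuit_length G a" "tau0 G b = (turn G ^^ j) a \<or> tau0 G b = tau2 G ((turn G ^^ j) a)"
    using position[OF a tau_in(1)[OF b(1)]] .
  define c where "c = (turn G ^^ j) a"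
  have c: "c \<in> flags G" using a by (simp add: c_def)
  from j(2) consider "tau0 G b = c" | "tau0 G b = tau2 G c" unfolding c_def by blast
  then show ?thesis
  proof cases
    case 1
    then have 2: "tau0 G (tau2 G b) = tau2 G c" using tau2_tau0[OF b(1)] by simp
    have "c \<noteq> b" using 1 tau_neq(1)[OF b(1)] by metis
    moreover have "f = {b, tau2 G b, c, tau2 G c}" using b(3) 1 2 by simp
    ultimately show ?thesis using that[OF j(1)] 1 2 unfolding b_def c_def by metis
  next
    case 2
    then have 3: "tau0 G (tau2 G b) = c" using tau2_tau0[OF b(1)] c by simp
    have "c \<noteq> b" using 2 b(2) by metis
    moreover have "f = {b, tau2 G b, c, tau2 G c}" using b(3) 2 3 by auto
    ultimately show ?thesis using that[OF j(1)] 2 3 unfolding b_def c_def by metis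
  qed
qed

lemma position_in_edge:
  assumes a: "a \<in> flags G" and "i < circuit_length G a" "j < circuit_length G a" "l < circuit_length G a"
    and "(turn G ^^ l) a \<in> {(turn G ^^ i) a, tau2 G ((turn G ^^ i) a), (turn G ^^ j) a, tau2 G ((turn G ^^ j) a)}"
  shows "l = i \<or> l = j"
  using assms turn_neq_tau2_turn[OF a] circuit_inj[OF a] by blast

text \<open>An orientation colouring is constant along \<open>turn\<close> and flips along
  \<open>tau0\<close>, so a free side between two first ends excludes it. If there is none, the
  first ends met when travelling from \<open>a\<close> form a colour class.\<close>

lemma nonorientable_loop_iff:
  assumes e: "e \<in> edges G" "a \<in> e"
  shows "nonorientable_loop G e \<longleftrightarrow> (\<exists>i. tau0 G a = (turn G ^^ i) a)"
proof -
  have a: "a \<in> flags G" using edge_of[OF e] by simp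
  let ?G = "ribbon_subgraph G {flags G} {e}"
  have fl: "flags ?G = flags G" "tau1 ?G = tau1 G" "tau2 ?G = tau2 G"
    and t0: "\<And>d. tau0 ?G d = (if d \<in> e then tau0 G d else tau2 G d)"
    by (simp_all add: ribbon_subgraph_def)
  have "end_vertices G e = {flags G}"
    using edge_subset[OF e(1)] edge_nonempty[OF e(1)] by (auto simp: end_vertices_def vertices_one)
  then have *: "nonorientable_loop G e \<longleftrightarrow> \<not> orientable ?G"
    by (auto simp: nonorientable_loop_def)
  have "orientable ?G \<longleftrightarrow> \<not> (\<exists>i. tau0 G a = (turn G ^^ i) a)"
  proof
    assume "orientable ?G"
    then obtain c :: "'a \<Rightarrow> bool" where c: "\<And>d. d \<in> flags G \<Longrightarrow>
        c (tau0 ?G d) \<noteq> c d \<and> c (tau1 G d) \<noteq> c d \<and> c (tau2 G d) \<noteq> c d"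
      unfolding orientable_def fl by blast
    have "c ((turn G ^^ i) a) = c a" for i
    proof (induction i)
      case (Suc i)
      have "c ((turn G ^^ Suc i) a) = c ((turn G ^^ i) a)"
        unfolding tau1_tau2_turn[symmetric]
        using c[of "(turn G ^^ i) a"] c[of "tau2 G ((turn G ^^ i) a)"] a by simp
      then show ?case using Suc by simp
    qed simp
    moreover have "c (tau0 G a) \<noteq> c a" using c[OF a] e(2) t0[of a] by simp
    ultimately show "\<not> (\<exists>i. tau0 G a = (turn G ^^ i) a)" by metis
  next
    assume no: "\<not> (\<exists>i. tau0 G a = (turn G ^^ i) a)"
    define W where "W = range (\<lambda>i. (turn G ^^ i) a)"
    have W2: "tau2 G d \<in> W \<longleftrightarrow> d \<notin> W" if d: "d \<in> flags G" for d
    proof -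
      obtain i where "d = (turn G ^^ i) a \<or> d = tau2 G ((turn G ^^ i) a)" using position[OF a d] .
      then show ?thesis using turn_neq_tau2_turn[OF a] a unfolding W_def image_iff
        by (metis UNIV_I tau_tau(3) turn_pow_in)
    qed
    have turnW: "turn G d \<in> W" if "d \<in> W" for d
    proof -
      from that obtain i where "d = (turn G ^^ i) a" unfolding W_def by auto
      then have "turn G d = (turn G ^^ Suc i) a" by simp
      then show ?thesis unfolding W_def by blast
    qed
    have W1: "tau1 G d \<in> W" if d: "d \<in> flags G" "d \<notin> W" for d
    proof -
      have "turn G (tau2 G d) \<in> W" using turnW W2[OF d(1)] d(2) by blast
      then show ?thesis using d(1) by (simp add: turn_def)
    qed
    have W1': "tau1 G d \<notin> W" if d: "d \<in> flags G" "d \<in> W" for d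
    proof -
      \<comment> \<open>Adding one full circuit makes the exponent positive, so that a preceding
        slot exists.\<close>
      obtain k where k: "d = (turn G ^^ Suc k) a"
      proof -
        obtain i where "d = (turn G ^^ i) a" using d unfolding W_def by auto
        then have "d = (turn G ^^ (i + circuit_length G a)) a"
          using circuit(2)[OF a] by (simp add: funpow_add)
        moreover have "i + circuit_length G a = Suc (i + (circuit_length G a - 1))"
          using circuit(1)[OF a] by simp
        ultimately show ?thesis using that by metis
      qed
      have *: "tau1 G d = tau2 G ((turn G ^^ k) a)" unfolding k by (rule tau1_turn[OF a])
      show ?thesis
      proof
        assume "tau1 G d \<in> W"
        then obtain i where "tau1 G d = (turn G ^^ i) a" unfolding W_def by blast
        then show False using * turn_neq_tau2_turn[OF a, of i k] by simp
      qed
    qed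
    have aW: "a \<in> W" unfolding W_def by (metis funpow_0 rangeI)
    have a0W: "tau0 G a \<notin> W" using no unfolding W_def by blast
    have W0: "tau0 G d \<in> W \<longleftrightarrow> d \<notin> W" if d: "d \<in> e" for d
    proof -
      have "e = edge_at G a" using edge_of[OF e] by simp
      then consider "d = a" | "d = tau0 G a" | "d = tau2 G a" | "d = tau0 G (tau2 G a)"
        using d unfolding edge_at_def by blast
      then show ?thesis
      proof cases
        case 1 then show ?thesis using aW a0W by simp
      next
        case 2 then show ?thesis using aW a0W a by simp
      next
        case 3
        have "tau0 G (tau2 G a) \<in> W" using W2[of "tau0 G a"] a0W a tau2_tau0 by simp
        then show ?thesis using 3 W2[OF a] aW by simp
      next
        case 4
        have "tau0 G (tau2 G a) \<in> W" using W2[of "tau0 G a"] a0W a tau2_tau0 by simp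
        then show ?thesis using 4 W2[OF a] aW a by simp
      qed
    qed
    show "orientable ?G"
      unfolding orientable_def fl
    proof (intro exI[of _ "\<lambda>d. d \<in> W"] ballI conjI)
      fix d assume d: "d \<in> flags G"
      show "(tau1 G d \<in> W) \<noteq> (d \<in> W)" using W1 W1' d by blast
      show "(tau2 G d \<in> W) \<noteq> (d \<in> W)" using W2 d by blast
      show "(tau0 ?G d \<in> W) \<noteq> (d \<in> W)" using W2[OF d] W0 t0[of d] by simp
    qed
  qed
  then show ?thesis using * by simp
qed

section \<open>Partial duals of a one-vertex ribbon graph\<close>

context
  fixes X
  assumes X: "X \<subseteq> edges G"
begin

lemma swapped_slot:
  "a \<in> flags G \<Longrightarrow> a \<notin> \<Union>X \<Longrightarrow> (a, tau2 G a) \<in> orbit_rel (flags G) {tau1 G, swapped G X}"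
  using orbit_rel_step[of a "flags G" "swapped G X" "{tau1 G, swapped G X}"] by (simp add: swapped_def)

lemma swapped_side:
  "a \<in> flags G \<Longrightarrow> a \<in> \<Union>X \<Longrightarrow> (a, tau0 G a) \<in> orbit_rel (flags G) {tau1 G, swapped G X}"
  using orbit_rel_step[of a "flags G" "swapped G X" "{tau1 G, swapped G X}"] by (simp add: swapped_def)

text \<open>First ends are indexed from 1 up to the circuit length, because arcs run from a second
  end to a first end and the last arc ends at \<open>a\<close>, seen as position
  \<open>circuit_length G a\<close>.\<close>

lemma partial_dual_one_vertexI:
  assumes a: "a \<in> flags G"
    and F: "\<And>l. 0 < l \<Longrightarrow> l \<le> circuit_length G a \<Longrightarrow>
      (x, (turn G ^^ l) a) \<in> orbit_rel (flags G) {tau1 G, swapped G X}"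
    and S: "\<And>l. l < circuit_length G a \<Longrightarrow>
      (x, tau2 G ((turn G ^^ l) a)) \<in> orbit_rel (flags G) {tau1 G, swapped G X}"
  shows "card (vertices (partial_dual G X)) = 1"
proof -
  interpret I: involutions "flags G" "{tau1 G, swapped G X}" by (rule involutions_partial_dual[OF X])
  have "(x, d) \<in> orbit_rel (flags G) {tau1 G, swapped G X}" if d: "d \<in> flags G" for d
  proof -
    obtain l where l: "l < circuit_length G a" "d = (turn G ^^ l) a \<or> d = tau2 G ((turn G ^^ l) a)"
      using position[OF a d] .
    have "(x, (turn G ^^ l) a) \<in> orbit_rel (flags G) {tau1 G, swapped G X}"
    proof (cases "l = 0")
      case True
      then show ?thesis using F[OF circuit(1)[OF a] order_refl] circuit(2)[OF a] by simp
    next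
      case False
      then show ?thesis using F[of l] l(1) by simp
    qed
    then show ?thesis using l S by metis
  qed
  then have "(c, d) \<in> orbit_rel (flags G) {tau1 G, swapped G X}" if "c \<in> flags G" "d \<in> flags G" for c d
    using that I.rel_sym orbit_rel_trans by metis
  then show ?thesis
    unfolding vertices_partial_dual[OF X] I.card_orbits_1_iff using a by blast
qed

end

text \<open>The slots of \<open>e\<close> cut the circle into an arc from \<open>tau2 G a\<close> to
  the other first end and an arc from the other second end back to \<open>a\<close>. A side of the
  Moebius loop connects the starting points of the two arcs.\<close>

lemma nonorientable_feasible:
  assumes e: "e \<in> edges G" and "nonorientable_loop G e"
  shows "card (vertices (partial_dual G {e})) = 1"
proof -
  obtain a where ae: "a \<in> e" using edge_nonempty[OF e] by blast
  then have a: "a \<in> flags G" using edge_of[OF e] by simp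
  have X: "{e} \<subseteq> edges G" using e by simp
  let ?s = "swapped G {e}"
  let ?R = "orbit_rel (flags G) {tau1 G, ?s}"
  let ?F = "\<lambda>i. (turn G ^^ i) a" and ?n = "circuit_length G a"
  have F0: "?F 0 = a" by simp
  obtain j where j: "j < ?n" "?F j \<noteq> a" "e = {a, tau2 G a, ?F j, tau2 G (?F j)}"
    "tau0 G a = ?F j \<and> tau0 G (tau2 G a) = tau2 G (?F j)
      \<or> tau0 G a = tau2 G (?F j) \<and> tau0 G (tau2 G a) = ?F j"
    using edge_positions[OF a e, of 0] ae by auto
  have jo: "tau0 G (tau2 G a) = tau2 G (?F j)"
    using j(4) assms(2) nonorientable_loop_iff[OF e ae] turn_neq_tau2_turn[OF a] by metis
  have j0: "0 < j" using j(2) by (cases j) auto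
  have slots: "(?F l, tau2 G (?F l)) \<in> ?R" if "0 < l" "l < ?n" "l \<noteq> j" for l
  proof (rule swapped_slot[OF X])
    show "?F l \<notin> \<Union>{e}"
      using position_in_edge[OF a circuit(1)[OF a] j(1) that(2)] that j(3) by auto
  qed (use a in simp)
  have SS: "(tau2 G a, tau2 G (?F j)) \<in> ?R"
    using swapped_side[OF X, of "tau2 G a"] a j(3) jo by simp
  have r0: "(tau2 G a, tau2 G (?F 0)) \<in> ?R" by simp
  note arc1 = arc_cover[OF a r0, of j]
  note arc2 = arc_cover[OF a SS, of ?n]
  show ?thesis
  proof (rule partial_dual_one_vertexI[OF X a, of "tau2 G a"])
    fix l
    show "(tau2 G a, ?F l) \<in> ?R" if "0 < l" "l \<le> ?n"
      using arc1(1)[of l] arc2(1)[of l] slots that j0 j(1) by (cases "l \<le> j") simp_all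
    show "(tau2 G a, tau2 G (?F l)) \<in> ?R" if "l < ?n"
      using arc1(2)[of l] arc2(2)[of l] slots that j0 j(1) by (cases "l < j") simp_all
  qed
qed

text \<open>The four slots cut the circle into arcs 1 to 4 in cyclic order. The sides of the
  orientable \<open>e\<close> join arc 1 to arc 2 and arc 3 to arc 4. A side of \<open>f\<close>
  joins arc 4 to arc 2 if \<open>f\<close> is twisted and to arc 1 if not, so either kind of
  \<open>f\<close> connects everything.\<close>

lemma interlaced_feasible:
  assumes e: "e \<in> edges G" and f: "f \<in> edges G" and ef: "e \<noteq> f"
    and or: "\<not> nonorientable_loop G e" and il: "interlaced G e f"
  shows "card (vertices (partial_dual G {e, f})) = 1"
proof -
  obtain a i j k where ijk: "0 < i" "i < j" "j < k" "k < circuit_length G a"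
    and ae: "a \<in> e" and fi: "(turn G ^^ i) a \<in> f" and ej: "(turn G ^^ j) a \<in> e" and fk: "(turn G ^^ k) a \<in> f"
    using il unfolding interlaced_def by blast
  have a: "a \<in> flags G" using edge_of[OF e ae] by simp
  have X: "{e, f} \<subseteq> edges G" using e f by simp
  let ?s = "swapped G {e, f}"
  let ?R = "orbit_rel (flags G) {tau1 G, ?s}"
  let ?F = "\<lambda>i. (turn G ^^ i) a" and ?n = "circuit_length G a"
  interpret I: involutions "flags G" "{tau1 G, ?s}" by (rule involutions_partial_dual[OF X])
  obtain j' where j': "j' < ?n" "?F j' \<noteq> a" "e = {a, tau2 G a, ?F j', tau2 G (?F j')}"
    "tau0 G a = ?F j' \<and> tau0 G (tau2 G a) = tau2 G (?F j')
      \<or> tau0 G a = tau2 G (?F j') \<and> tau0 G (tau2 G a) = ?F j'"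
    using edge_positions[OF a e, of 0] ae by auto
  \<comment> \<open>\<open>interlaced\<close> only names some flag of \<open>e\<close> at position
    \<open>j\<close>; being a first end other than \<open>a\<close>, it belongs to the other slot of
    \<open>e\<close>.\<close>
  have "j = 0 \<or> j = j'"
    using position_in_edge[OF a circuit(1)[OF a] j'(1), of j] ej ijk j'(3) by simp
  then have jj: "j' = j" using ijk by simp
  note j = j'[unfolded jj]
  obtain k' where k': "k' < ?n" "?F k' \<noteq> ?F i" "f = {?F i, tau2 G (?F i), ?F k', tau2 G (?F k')}"
    "tau0 G (?F i) = ?F k' \<and> tau0 G (tau2 G (?F i)) = tau2 G (?F k')
      \<or> tau0 G (?F i) = tau2 G (?F k') \<and> tau0 G (tau2 G (?F i)) = ?F k'"
    using edge_positions[OF a f fi] by auto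
  have "k = i \<or> k = k'"
    using position_in_edge[OF a _ k'(1), of i k] fk ijk k'(3) by simp
  then have kk: "k' = k" using ijk by simp
  note k = k'[unfolded kk]
  have jo: "tau0 G (tau2 G a) = ?F j" "tau0 G a = tau2 G (?F j)"
    using j(4) or nonorientable_loop_iff[OF e ae] by metis+
  have slots: "(?F l, tau2 G (?F l)) \<in> ?R" if "0 < l" "l < ?n" "l \<noteq> i" "l \<noteq> j" "l \<noteq> k" for l
  proof (rule swapped_slot[OF X])
    have "?F l \<notin> e"
      using position_in_edge[OF a circuit(1)[OF a] j(1) that(2)] that j(3) by auto
    moreover have "?F l \<notin> f"
      using position_in_edge[OF a _ k(1) that(2), of i] that ijk k(3) by auto
    ultimately show "?F l \<notin> \<Union>{e, f}" by simp
  qed (use a in simp)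
  have r0: "(tau2 G a, tau2 G (?F 0)) \<in> ?R" by simp
  have slots1: "(?F l, tau2 G (?F l)) \<in> ?R" if "0 < l" "l < i" for l using slots that ijk by simp
  have slots2: "(?F l, tau2 G (?F l)) \<in> ?R" if "i < l" "l < j" for l using slots that ijk by simp
  have slots3: "(?F l, tau2 G (?F l)) \<in> ?R" if "j < l" "l < k" for l using slots that ijk by simp
  have slots4: "(?F l, tau2 G (?F l)) \<in> ?R" if "k < l" "l < ?n" for l using slots that ijk by simp
  have "(tau2 G a, ?F j) \<in> ?R"
    using swapped_side[OF X, of "tau2 G a"] a j(3) jo by simp
  moreover have "(tau2 G (?F i), ?F j) \<in> ?R"
    by (rule arc_rel[OF a ijk(2) slots2])
  ultimately have Si: "(tau2 G a, tau2 G (?F i)) \<in> ?R"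
    using I.rel_sym orbit_rel_trans by metis
  have Sk: "(tau2 G a, tau2 G (?F k)) \<in> ?R"
    using k(4)
  proof
    assume *: "tau0 G (?F i) = ?F k \<and> tau0 G (tau2 G (?F i)) = tau2 G (?F k)"
    have "(tau2 G (?F i), tau2 G (?F k)) \<in> ?R"
      using swapped_side[OF X, of "tau2 G (?F i)"] a k(3) * by simp
    then show ?thesis using Si by (rule orbit_rel_trans[rotated])
  next
    assume *: "tau0 G (?F i) = tau2 G (?F k) \<and> tau0 G (tau2 G (?F i)) = ?F k"
    have "(?F i, tau2 G (?F k)) \<in> ?R"
      using swapped_side[OF X, of "?F i"] a k(3) * by simp
    moreover have "(tau2 G (?F 0), ?F i) \<in> ?R"
      by (rule arc_rel[OF a ijk(1) slots1])
    ultimately show ?thesis using orbit_rel_trans by (metis funpow_0)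
  qed
  \<comment> \<open>Arc 4 ends at \<open>a\<close>, from where the other side of \<open>e\<close>
    enters arc 3.\<close>
  have Sj: "(tau2 G a, tau2 G (?F j)) \<in> ?R"
  proof -
    have "(tau2 G (?F k), ?F ?n) \<in> ?R"
      by (rule arc_rel[OF a ijk(4) slots4])
    moreover have "(a, tau2 G (?F j)) \<in> ?R"
      using swapped_side[OF X, of a] a j(3) jo by simp
    ultimately show ?thesis using Sk circuit(2)[OF a] orbit_rel_trans by metis
  qed
  show ?thesis
  proof (rule partial_dual_one_vertexI[OF X a, of "tau2 G a"])
    fix l
    show "(tau2 G a, ?F l) \<in> ?R" if l: "0 < l" "l \<le> ?n"
    proof -
      consider "l \<le> i" | "i < l" "l \<le> j" | "j < l" "l \<le> k" | "k < l" by linarith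
      then show ?thesis
      proof cases
        case 1 show ?thesis by (rule arc_cover(1)[OF a r0 slots1 l(1) 1])
      next
        case 2 show ?thesis by (rule arc_cover(1)[OF a Si slots2 2])
      next
        case 3 show ?thesis by (rule arc_cover(1)[OF a Sj slots3 3])
      next
        case 4 show ?thesis by (rule arc_cover(1)[OF a Sk slots4 4 l(2)])
      qed
    qed
    show "(tau2 G a, tau2 G (?F l)) \<in> ?R" if l: "l < ?n"
    proof -
      consider "l < i" | "i \<le> l" "l < j" | "j \<le> l" "l < k" | "k \<le> l" by linarith
      then show ?thesis
      proof cases
        case 1 show ?thesis by (rule arc_cover(2)[OF a r0 slots1 le0 1])
      next
        case 2 show ?thesis by (rule arc_cover(2)[OF a Si slots2 2])
      next
        case 3 show ?thesis by (rule arc_cover(2)[OF a Sj slots3 3])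
      next
        case 4 show ?thesis by (rule arc_cover(2)[OF a Sk slots4 4 l])
      qed
    qed
  qed
qed

text \<open>The side of the orientable \<open>e\<close> at \<open>tau2 G a\<close> leads to the far
  end of the arc that starts there, and an edge of \<open>X\<close> leaving this arc would be
  interlaced with \<open>e\<close>. So the arc is closed off and never connected to
  \<open>a\<close>.\<close>

lemma not_feasible:
  assumes X: "X \<subseteq> edges G" and e: "e \<in> X" and or: "\<not> nonorientable_loop G e"
    and il: "\<And>f. f \<in> X \<Longrightarrow> f \<noteq> e \<Longrightarrow> \<not> interlaced G e f"
  shows "card (vertices (partial_dual G X)) \<noteq> 1"
proof
  assume one': "card (vertices (partial_dual G X)) = 1"
  have eE: "e \<in> edges G" using e X by auto
  obtain a where ae: "a \<in> e" using edge_nonempty[OF eE] by blast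
  then have a: "a \<in> flags G" using edge_of[OF eE] by simp
  let ?s = "swapped G X"
  let ?R = "orbit_rel (flags G) {tau1 G, ?s}"
  let ?F = "\<lambda>i. (turn G ^^ i) a" and ?n = "circuit_length G a"
  interpret I: involutions "flags G" "{tau1 G, ?s}" by (rule involutions_partial_dual[OF X])
  obtain j where j: "j < ?n" "?F j \<noteq> a" "e = {a, tau2 G a, ?F j, tau2 G (?F j)}"
    "tau0 G a = ?F j \<and> tau0 G (tau2 G a) = tau2 G (?F j)
      \<or> tau0 G a = tau2 G (?F j) \<and> tau0 G (tau2 G a) = ?F j"
    using edge_positions[OF a eE, of 0] ae by auto
  have j0: "0 < j" using j(2) by (cases j) auto
  have jo: "tau0 G (tau2 G a) = ?F j" "tau0 G a = tau2 G (?F j)"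
    using j(4) or nonorientable_loop_iff[OF eE ae] by metis+
  \<comment> \<open>One of the two arcs into which \<open>e\<close> cuts the vertex circle: no edge of \<open>X\<close> leaves it.\<close>
  define W where "W = {d. \<exists>l. (l < j \<and> d = tau2 G (?F l)) \<or> (0 < l \<and> l \<le> j \<and> d = ?F l)}"
  have "(tau2 G a, a) \<in> ?R"
    using one' a unfolding vertices_partial_dual[OF X] I.card_orbits_1_iff by simp
  then have "a \<in> W"
  proof (rule orbit_rel_closed)
    show "tau2 G a \<in> W" unfolding W_def using j0 by (intro CollectI exI[of _ 0]) simp
    fix c t assume c: "c \<in> W" "c \<in> flags G" "t \<in> {tau1 G, ?s}"
    from c(1) obtain l where "(l < j \<and> c = tau2 G (?F l)) \<or> (0 < l \<and> l \<le> j \<and> c = ?F l)"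
      unfolding W_def by blast
    then have "tau1 G c \<in> W"
    proof
      assume "l < j \<and> c = tau2 G (?F l)"
      then have "0 < Suc l \<and> Suc l \<le> j \<and> tau1 G c = ?F (Suc l)" by (simp only: tau1_tau2_turn simp_thms) simp
      then show ?thesis unfolding W_def by blast
    next
      assume l: "0 < l \<and> l \<le> j \<and> c = ?F l"
      then obtain m where m: "l = Suc m" by (cases l) auto
      then have "c = ?F (Suc m)" using l by simp
      then have "tau1 G c = tau2 G (?F m)" using tau1_turn[OF a, of m] by metis
      then show ?thesis unfolding W_def using l m by (intro CollectI exI[of _ m]) simp
    qed
    moreover have "?s c \<in> W"
    proof -
      from c(1) obtain l where l: "c = tau2 G (?F l) \<and> l < j \<or> c = ?F l \<and> 0 < l \<and> l \<le> j"
        unfolding W_def by blast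
      have inside: "tau2 G (?F m) \<in> W" "?F m \<in> W" if "0 < m" "m < j" for m
        using that unfolding W_def by (auto intro!: exI[of _ m])
      \<comment> \<open>A flag outside \<open>e\<close> is not at either end of the arc, so both
        ends of its slot lie in the arc.\<close>
      have off: "l \<noteq> 0 \<and> l \<noteq> j" if "c \<notin> e"
      proof -
        have "tau2 G a \<in> e" "?F j \<in> e" using j(3) by simp_all
        then have "c \<noteq> tau2 G a" "c \<noteq> ?F j" using that by blast+
        then show ?thesis using l by (cases "l = 0") auto
      qed
      consider "c \<notin> \<Union>X" | "c \<in> e" | f where "f \<in> X" "f \<noteq> e" "c \<in> f" "c \<notin> e" by blast
      then show ?thesis
      proof cases
        case 1
        then have "c \<notin> e" using e by blast
        then have "l \<noteq> 0" "l \<noteq> j" using off by blast+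
        then have "0 < l" "l < j" using l by auto
        then show ?thesis using 1 l inside[of l] a by (auto simp: swapped_def)
      next
        case 2
        then have s: "?s c = tau0 G c" using e by (auto simp: swapped_def)
        have "c = tau2 G a \<or> c = ?F j"
        proof (cases "l = 0 \<or> l = j")
          case True
          then show ?thesis using l j0 by auto
        next
          case False
          then have "?F l \<notin> e"
            using position_in_edge[OF a circuit(1)[OF a] j(1), of l] l j by auto
          moreover have "?F l \<in> e \<longleftrightarrow> tau2 G (?F l) \<in> e"
            using slot_closed_edge[OF eE] a by (simp add: slot_closed_def)
          ultimately show ?thesis using l 2 by auto
        qed
        moreover have "tau0 G (?F j) = tau2 G a" using jo(1) a by (metis tau_in(3) tau_tau(1))
        moreover have "?F j \<in> W" "tau2 G (?F 0) \<in> W"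
          unfolding W_def using j0 by blast+
        ultimately show ?thesis using s jo by auto
      next
        case 3
        then have fE: "f \<in> edges G" using X by auto
        have s: "?s c = tau0 G c" using 3 by (auto simp: swapped_def)
        have lj: "l \<noteq> 0" "l \<noteq> j" using off 3(4) by blast+
        then have l': "0 < l" "l < j" using l by auto
        have Flf: "?F l \<in> f"
          using slot_closed_edge[OF fE] a l 3(3) by (auto simp: slot_closed_def)
        obtain m where m: "m < ?n" "f = {?F l, tau2 G (?F l), ?F m, tau2 G (?F m)}"
          using edge_positions[OF a fE Flf] by metis
        have Fmf: "?F m \<in> f" using m by simp
        have "?F m \<notin> e" using edges_disjoint[OF fE eE Fmf] 3(2) by blast
        then have "m \<noteq> 0" "m \<noteq> j" using ae j(3) by (metis funpow_0, blast)
        \<comment> \<open>Positions 0, \<open>l\<close>, \<open>j\<close>, \<open>m\<close> would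
          carry \<open>e\<close>, \<open>f\<close>, \<open>e\<close>, \<open>f\<close>.\<close>
        moreover have "\<not> j < m"
        proof
          assume "j < m"
          then have "interlaced G e f"
            unfolding interlaced_def using l' m(1) ae Flf Fmf j(3)
            by (intro exI[of _ a] exI[of _ l] exI[of _ j] exI[of _ m]) auto
          then show False using il 3 by blast
        qed
        ultimately have m': "0 < m" "m < j" by auto
        have "tau0 G c \<in> f"
          using slot_closed_edge[OF fE] c(2) 3(3) by (simp add: slot_closed_def)
        then show ?thesis unfolding s using m(2) inside l' m' by auto
      qed
    qed
    ultimately show "t c \<in> W" using c(3) by auto
  qed
  then obtain l where "(l < j \<and> a = tau2 G (?F l)) \<or> (0 < l \<and> l \<le> j \<and> a = ?F l)"
    unfolding W_def by blast
  then show False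
    using turn_neq_tau2_turn[OF a, of 0 l] circuit_inj[OF a circuit(1)[OF a], of l] j(1) by auto
qed

end

section \<open>Quasi-trees and intervals of edge sets\<close>

definition feasible :: "'f ribbon \<Rightarrow> 'f set set \<Rightarrow> bool" where
  "feasible G A \<longleftrightarrow> A \<subseteq> edges G \<and> card (vertices (partial_dual G A)) = 1"

text \<open>The live orientable edges, phrased for an edge set. They remain in the minor; all others
  are deleted or contracted.\<close>

definition flexible :: "'f ribbon \<Rightarrow> 'f set rel \<Rightarrow> 'f set set \<Rightarrow> 'f set \<Rightarrow> bool" where
  "flexible G r A e \<longleftrightarrow> \<not> nonorientable_loop (partial_dual G A) e \<and>
     \<not> (\<exists>f\<in>edges G. (f, e) \<in> r \<and> interlaced (partial_dual G A) e f)"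

text \<open>Turns the order into numbers, which gives access to maxima of finite sets and to binary
  weights.\<close>

definition edge_rank :: "'f ribbon \<Rightarrow> 'f set rel \<Rightarrow> 'f set \<Rightarrow> nat" where
  "edge_rank G r e = card {f \<in> edges G. (f, e) \<in> r}"

context rgraph
begin

lemma feasible_one_vertex: "feasible G A \<Longrightarrow> one_vertex (partial_dual G A)"
  using partial_dual(1)
  by (auto simp: feasible_def one_vertex_def one_vertex_axioms_def rgraph_def)

lemma feasible_symdiff_iff:
  assumes "A \<subseteq> edges G" "X \<subseteq> edges G"
  shows "feasible G (A - X \<union> (X - A)) \<longleftrightarrow> card (vertices (partial_dual (partial_dual G A) X)) = 1"
  using assms partial_dual_partial_dual[OF assms] by (auto simp: feasible_def)

text \<open>Otherwise every other edge of the difference is smaller than \<open>e\<close>. A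
  flexible \<open>e\<close> is orientable and links none of these, so \<open>not_feasible\<close>
  forbids the switch from \<open>A\<close> to \<open>B\<close>.\<close>

lemma flexible_agree:
  assumes A: "feasible G A" and B: "feasible G B" and e: "e \<in> A - B \<union> (B - A)"
    and flex: "flexible G r A e"
  shows "\<exists>f \<in> A - B \<union> (B - A). f \<noteq> e \<and> (f, e) \<notin> r"
proof (rule ccontr)
  assume *: "\<not> ?thesis"
  let ?X = "A - B \<union> (B - A)"
  interpret H: one_vertex "partial_dual G A" by (rule feasible_one_vertex[OF A])
  have A': "A \<subseteq> edges G" and X: "?X \<subseteq> edges G" using A B by (auto simp: feasible_def)
  have XE: "?X \<subseteq> edges (partial_dual G A)" using X partial_dual(2)[OF A'] by simp
  have "card (vertices (partial_dual (partial_dual G A) ?X)) \<noteq> 1"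
    by (rule H.not_feasible[OF XE e]) (use * flex X in \<open>auto simp: flexible_def\<close>)
  moreover have "A - ?X \<union> (?X - A) = B" by auto
  ultimately show False using feasible_symdiff_iff[OF A' X] B by simp
qed

text \<open>A non-orientable \<open>e\<close> is switched alone. An orientable one that is not
  flexible must be dead and is switched together with a smaller edge that it links.\<close>

lemma not_flexible_differ:
  assumes A: "feasible G A" and e: "e \<in> edges G" and flex: "\<not> flexible G r A e" and r: "irrefl r"
  shows "\<exists>B. feasible G B \<and> e \<in> A - B \<union> (B - A) \<and> (\<forall>f \<in> A - B \<union> (B - A). f = e \<or> (f, e) \<in> r)"
proof -
  interpret H: one_vertex "partial_dual G A" by (rule feasible_one_vertex[OF A])
  have A': "A \<subseteq> edges G" using A by (simp add: feasible_def)
  note E = partial_dual(2)[OF A']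
  have "\<exists>X \<subseteq> edges G. e \<in> X \<and> (\<forall>f\<in>X. f = e \<or> (f, e) \<in> r) \<and>
      card (vertices (partial_dual (partial_dual G A) X)) = 1"
  proof (cases "nonorientable_loop (partial_dual G A) e")
    case True
    then show ?thesis
      using H.nonorientable_feasible[of e] e E by (intro exI[of _ "{e}"]) simp
  next
    case False
    then obtain f where f: "f \<in> edges G" "(f, e) \<in> r" "interlaced (partial_dual G A) e f"
      using flex by (auto simp: flexible_def)
    then have "e \<noteq> f" using r by (auto simp: irrefl_def)
    then show ?thesis
      using H.interlaced_feasible[of e f] e f E False by (intro exI[of _ "{e, f}"]) simp
  qed
  then obtain X where X: "X \<subseteq> edges G" "e \<in> X" "\<forall>f\<in>X. f = e \<or> (f, e) \<in> r"
    "card (vertices (partial_dual (partial_dual G A) X)) = 1" by blast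
  define B where "B = A - X \<union> (X - A)"
  have "feasible G B" unfolding B_def using feasible_symdiff_iff[OF A' X(1)] X(4) by simp
  moreover have "A - B \<union> (B - A) = X" unfolding B_def by auto
  ultimately show ?thesis using X(2,3) by blast
qed

lemma edge_rank_less:
  assumes "strict_linear_order_on (edges G) r" "(f, e) \<in> r" "f \<in> edges G"
  shows "edge_rank G r f < edge_rank G r e"
  unfolding edge_rank_def
proof (rule psubset_card_mono)
  have r: "trans r" "irrefl r" using assms(1) by (auto simp: strict_linear_order_on_def)
  show "finite {g \<in> edges G. (g, e) \<in> r}" using finite_edges by simp
  have "{g \<in> edges G. (g, f) \<in> r} \<subseteq> {g \<in> edges G. (g, e) \<in> r}"
    using assms(2) transD[OF r(1)] by blast
  moreover have "f \<in> {g \<in> edges G. (g, e) \<in> r}" "f \<notin> {g \<in> edges G. (g, f) \<in> r}"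
    using assms(2,3) r(2) by (simp_all add: irrefl_def)
  ultimately show "{g \<in> edges G. (g, f) \<in> r} \<subset> {g \<in> edges G. (g, e) \<in> r}" by blast
qed

text \<open>By \<open>flexible_agree\<close> the largest edge of the difference is flexible for
  neither \<open>B\<close> nor \<open>C\<close>, so \<open>A\<close> would have to agree with both
  there.\<close>

lemma interval_unique:
  assumes r: "strict_linear_order_on (edges G) r"
    and B: "feasible G B" "\<And>e. e \<in> edges G \<Longrightarrow> \<not> flexible G r B e \<Longrightarrow> e \<in> A \<longleftrightarrow> e \<in> B"
    and C: "feasible G C" "\<And>e. e \<in> edges G \<Longrightarrow> \<not> flexible G r C e \<Longrightarrow> e \<in> A \<longleftrightarrow> e \<in> C"
  shows "B = C"
proof (rule ccontr)
  assume "B \<noteq> C"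
  let ?X = "B - C \<union> (C - B)"
  have X: "?X \<noteq> {}" "?X \<subseteq> edges G" "finite ?X"
    using \<open>B \<noteq> C\<close> B(1) C(1) finite_edges by (auto simp: feasible_def intro: finite_subset)
  have r': "trans r" "irrefl r" "total_on (edges G) r"
    using r by (auto simp: strict_linear_order_on_def)
  define R where "R = edge_rank G r"
  have "Max (R ` ?X) \<in> R ` ?X" using X by (intro Max_in) auto
  then obtain e where e: "e \<in> ?X" "R e = Max (R ` ?X)" by (metis imageE)
  have max: "(e, f) \<notin> r" if f: "f \<in> ?X" for f
  proof
    assume "(e, f) \<in> r"
    then have "R e < R f" unfolding R_def using edge_rank_less[OF r] e(1) X(2) by blast
    moreover have "R f \<le> R e" unfolding e(2) using X(3) f by (intro Max_ge) auto
    ultimately show False by simp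
  qed
  have below: "(f, e) \<in> r" if "f \<in> ?X" "f \<noteq> e" for f
    using r'(3) max[OF that(1)] that e(1) X(2) unfolding total_on_def by blast
  have "\<not> flexible G r B e" using flexible_agree[OF B(1) C(1) e(1)] below by blast
  moreover have "\<not> flexible G r C e"
    using flexible_agree[OF C(1) B(1), of e r] e(1) below by blast
  ultimately show False using B(2) C(2) e(1) X(2) by blast
qed

text \<open>\<open>B\<close> minimises the number whose binary digits, at positions
  \<open>rank e\<close>, mark where it differs from \<open>A\<close>. A fixed edge in the difference
  could be switched together with smaller edges only, and its digit outweighs all of theirs.\<close>

lemma interval_exists:
  assumes r: "strict_linear_order_on (edges G) r" and "connected_ribbon G" and A: "A \<subseteq> edges G"
  shows "\<exists>B. feasible G B \<and> (\<forall>e\<in>edges G. \<not> flexible G r B e \<longrightarrow> (e \<in> A \<longleftrightarrow> e \<in> B))"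
proof -
  have r': "trans r" "irrefl r" "total_on (edges G) r"
    using r by (auto simp: strict_linear_order_on_def)
  define rank where "rank = edge_rank G r"
  define wt :: "'f set set \<Rightarrow> nat" where "wt X = (\<Sum>e\<in>X. 2 ^ rank e)" for X
  have rank_less: "rank f < rank e" if "(f, e) \<in> r" "f \<in> edges G" for e f
    unfolding rank_def by (rule edge_rank_less[OF r that])
  have rank_inj: "inj_on rank (edges G)"
  proof (rule inj_onI)
    fix e f assume "e \<in> edges G" "f \<in> edges G" "rank e = rank f"
    then show "e = f" using rank_less r'(3) unfolding total_on_def by (metis less_irrefl)
  qed
  \<comment> \<open>Ranks are distinct, so \<open>wt X\<close> is part of a geometric sum that stays
    below the next power of two.\<close>
  have wt_below: "wt X < 2 ^ rank e" if X: "X \<subseteq> edges G" "\<And>f. f \<in> X \<Longrightarrow> (f, e) \<in> r" for X e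
  proof -
    have "wt X = (\<Sum>i\<in>rank ` X. 2 ^ i)"
      unfolding wt_def using sum.reindex[OF inj_on_subset[OF rank_inj X(1)], of "(^) (2::nat)"]
      by (simp add: comp_def)
    also have "\<dots> \<le> (\<Sum>i<rank e. 2 ^ i)"
      by (rule sum_mono2) (use X rank_less in auto)
    also have "(\<Sum>i<n. 2 ^ i) < (2 ^ n :: nat)" for n
      by (induction n) simp_all
    finally show ?thesis .
  qed
  obtain B0 where "feasible G B0"
    using ex_one_vertex_partial_dual[OF rg assms(2)] by (auto simp: feasible_def)
  then obtain B where B: "feasible G B"
    and min: "\<And>C. feasible G C \<Longrightarrow> wt (A - B \<union> (B - A)) \<le> wt (A - C \<union> (C - A))"
    using ex_has_least_nat[of "feasible G" B0 "\<lambda>B. wt (A - B \<union> (B - A))"] by blast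
  have "e \<in> A \<longleftrightarrow> e \<in> B" if e: "e \<in> edges G" "\<not> flexible G r B e" for e
  proof (rule ccontr)
    assume *: "\<not> ?thesis"
    obtain C where C: "feasible G C" "e \<in> B - C \<union> (C - B)" "\<forall>f \<in> B - C \<union> (C - B). f = e \<or> (f, e) \<in> r"
      using not_flexible_differ[OF B e r'(2)] by blast
    let ?S = "A - B \<union> (B - A)" and ?S' = "A - C \<union> (C - A)"
    have sub: "?S \<subseteq> edges G" "?S' \<subseteq> edges G" using A B C(1) by (auto simp: feasible_def)
    have fin: "finite ?S" "finite ?S'" using sub finite_edges finite_subset by auto
    \<comment> \<open>Among edges, \<open>U\<close> is what lies above \<open>e\<close>; the switch
      changes nothing there.\<close>
    define U where "U = {f. f \<noteq> e \<and> (f, e) \<notin> r}"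
    have U: "?S \<inter> U = ?S' \<inter> U" using C(3) unfolding U_def by blast
    have eS: "e \<in> ?S" "e \<notin> ?S'" using * C(2) by blast+
    have "wt ?S' = wt (?S' \<inter> U) + wt (?S' - U)"
      unfolding wt_def by (rule sum.Int_Diff[OF fin(2)])
    also have "wt (?S' - U) < 2 ^ rank e"
      by (rule wt_below) (use sub(2) eS(2) in \<open>auto simp: U_def\<close>)
    also have "2 ^ rank e \<le> wt (?S - U)"
      unfolding wt_def by (rule member_le_sum) (use eS fin(1) in \<open>auto simp: U_def\<close>)
    also have "wt (?S' \<inter> U) + wt (?S - U) = wt ?S"
      unfolding U[symmetric] wt_def by (rule sum.Int_Diff[OF fin(1), symmetric])
    finally show False using min[OF C(1)] by simp
  qed
  then show ?thesis using B by blast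
qed

section \<open>From feasible sets to quasi-trees and intervals\<close>

lemma quasi_trees_eq: "quasi_trees G = spanning_subgraph G ` Collect (feasible G)"
  unfolding quasi_trees_def quasi_tree_def feasible_def
  using boundaries_spanning_subgraph by auto

lemma inj_spanning_subgraph: "inj_on (spanning_subgraph G) (Collect (feasible G))"
  by (rule inj_on_inverseI[of _ edges]) (simp add: feasible_def)

lemma feasible_finite: "finite (Collect (feasible G))"
  by (rule finite_subset[of _ "Pow (edges G)"]) (auto simp: feasible_def finite_edges)

lemma int_fixed_eq:
  assumes "A \<subseteq> edges G"
  shows "int_dead G r (spanning_subgraph G A) \<union> int_live_nonor G r (spanning_subgraph G A) =
    {e \<in> A. \<not> flexible G r A e}"
  using assms by (auto simp: int_dead_def int_live_nonor_def live_def nonorientable_edge_def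
      links_def flexible_def)

lemma ext_fixed_eq:
  assumes "A \<subseteq> edges G"
  shows "ext_dead G r (spanning_subgraph G A) \<union> ext_live_nonor G r (spanning_subgraph G A) =
    {e \<in> edges G - A. \<not> flexible G r A e}"
  using assms by (auto simp: ext_dead_def ext_live_nonor_def live_def nonorientable_edge_def
      links_def flexible_def)

text \<open>Every edge set lies in the interval of exactly one feasible \<open>B\<close>. There the
  edges that are not flexible follow \<open>B\<close> and the flexible ones are free, which gives
  the inner sum.\<close>

lemma sum_intervals:
  fixes t :: "'f set set \<Rightarrow> 'b::comm_monoid_add"
  assumes r: "strict_linear_order_on (edges G) r" and "connected_ribbon G"
  shows "(\<Sum>A\<in>Pow (edges G). t A) =
    (\<Sum>B | feasible G B. \<Sum>X\<in>Pow {e \<in> edges G. flexible G r B e}.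
       t ({e \<in> B. \<not> flexible G r B e} \<union> X))"
proof -
  let ?I = "\<lambda>B. {A. A \<subseteq> edges G \<and> (\<forall>e\<in>edges G. \<not> flexible G r B e \<longrightarrow> (e \<in> A \<longleftrightarrow> e \<in> B))}"
  have U: "Pow (edges G) = (\<Union>B\<in>Collect (feasible G). ?I B)"
    using interval_exists[OF assms] by blast
  have "(\<Sum>A\<in>Pow (edges G). t A) = (\<Sum>B | feasible G B. \<Sum>A\<in>?I B. t A)"
    unfolding U
  proof (rule sum.UNION_disjoint[OF feasible_finite])
    show "\<forall>B\<in>Collect (feasible G). finite (?I B)"
      using finite_edges by (auto intro: finite_subset[of _ "Pow (edges G)"])
    show "\<forall>B\<in>Collect (feasible G). \<forall>C\<in>Collect (feasible G). B \<noteq> C \<longrightarrow> ?I B \<inter> ?I C = {}"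
    proof (intro ballI impI equals0I)
      fix B C A assume "B \<in> Collect (feasible G)" "C \<in> Collect (feasible G)" "B \<noteq> C" "A \<in> ?I B \<inter> ?I C"
      then show False using interval_unique[OF r, of B A C] by simp
    qed
  qed
  have *: "(\<Sum>A\<in>?I B. t A) = (\<Sum>X\<in>Pow {e \<in> edges G. flexible G r B e}.
       t ({e \<in> B. \<not> flexible G r B e} \<union> X))" if B: "feasible G B" for B
  proof (rule sum.reindex_bij_witness[of _ "\<lambda>X. {e \<in> B. \<not> flexible G r B e} \<union> X"
          "\<lambda>A. {e \<in> A. flexible G r B e}"])
    have BE: "B \<subseteq> edges G" using B by (simp add: feasible_def)
    show inv: "{e \<in> B. \<not> flexible G r B e} \<union> {e \<in> A. flexible G r B e} = A" if "A \<in> ?I B" for A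
      using that BE by blast
    show "t ({e \<in> B. \<not> flexible G r B e} \<union> {e \<in> A. flexible G r B e}) = t A" if "A \<in> ?I B" for A
      by (simp only: inv[OF that])
  qed (use B in \<open>auto simp: feasible_def\<close>)
  note \<open>(\<Sum>A\<in>Pow (edges G). t A) = (\<Sum>B | feasible G B. \<Sum>A\<in>?I B. t A)\<close>
  also have "(\<Sum>B | feasible G B. \<Sum>A\<in>?I B. t A) = (\<Sum>B | feasible G B. \<Sum>X\<in>Pow {e \<in> edges G. flexible G r B e}.
       t ({e \<in> B. \<not> flexible G r B e} \<union> X))"
    by (intro sum.cong refl *) simp
  finally show ?thesis .
qed

end

section \<open>Contraction of multigraphs\<close>

definition greach :: "('e \<Rightarrow> 'v set) \<Rightarrow> 'e set \<Rightarrow> 'v rel" where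
  "greach ends A = {(u, v). \<exists>e\<in>A. u \<in> ends e \<and> v \<in> ends e}\<^sup>*"

definition gcomps :: "'v set \<Rightarrow> ('e \<Rightarrow> 'v set) \<Rightarrow> 'e set \<Rightarrow> 'v set set" where
  "gcomps V ends A = (\<lambda>u. greach ends A `` {u}) ` V"

lemma greach_refl [simp]: "(u, u) \<in> greach ends A"
  by (simp add: greach_def)

lemma greach_trans: "(u, v) \<in> greach ends A \<Longrightarrow> (v, w) \<in> greach ends A \<Longrightarrow> (u, w) \<in> greach ends A"
  unfolding greach_def by (rule rtrancl_trans)

lemma greach_edge: "e \<in> A \<Longrightarrow> u \<in> ends e \<Longrightarrow> v \<in> ends e \<Longrightarrow> (u, v) \<in> greach ends A"
  unfolding greach_def by (rule r_into_rtrancl) blast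

lemma greach_sym: "(u, v) \<in> greach ends A \<Longrightarrow> (v, u) \<in> greach ends A"
proof -
  have "sym (greach ends A)"
    unfolding greach_def by (intro sym_rtrancl symI) blast
  then show "(u, v) \<in> greach ends A \<Longrightarrow> (v, u) \<in> greach ends A" by (rule symD)
qed

lemma greach_closed:
  assumes "(u, v) \<in> greach ends A" "u \<in> S"
    and "\<And>e x y. e \<in> A \<Longrightarrow> x \<in> S \<Longrightarrow> x \<in> ends e \<Longrightarrow> y \<in> ends e \<Longrightarrow> y \<in> S"
  shows "v \<in> S"
  using assms(1) unfolding greach_def
  by (induction rule: rtrancl_induct) (use assms in auto)

lemma gcomps_of:
  assumes "C \<in> gcomps V ends A" "u \<in> C"
  shows "C = greach ends A `` {u}"
proof -
  obtain w where w: "C = greach ends A `` {w}" "(w, u) \<in> greach ends A"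
    using assms by (auto simp: gcomps_def)
  then show ?thesis
    using greach_trans[OF w(2)] greach_trans[OF greach_sym[OF w(2)]] by blast
qed

lemma gcomps_edge:
  assumes "C \<in> gcomps V ends A" "u \<in> C" "e \<in> A" "u \<in> ends e"
  shows "ends e \<subseteq> C"
  using gcomps_of[OF assms(1,2)] greach_edge[OF assms(3), of u ends] assms(4) by blast

lemma gcomps_empty: "gcomps V ends {} = (\<lambda>u. {u}) ` V"
  by (auto simp: gcomps_def greach_def)

text \<open>Contraction as a quotient map: \<open>\<phi>\<close> glues the ends of \<open>e\<close>
  and nothing else. A loop is the case of a single end, where \<open>\<phi>\<close> is injective on
  \<open>V\<close> and only the edge disappears.\<close>

locale graph_contraction =
  fixes V :: "'v set" and ends ends' :: "'e \<Rightarrow> 'v set" and A :: "'e set" and e :: 'e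
    and \<phi> :: "'v \<Rightarrow> 'v"
  assumes finV: "finite V" and ends_sub: "\<And>f. f \<in> A \<Longrightarrow> ends f \<subseteq> V"
    and eA: "e \<in> A" and ends_ne: "ends e \<noteq> {}"
    and \<phi>_eq: "\<And>u v. u \<in> V \<Longrightarrow> v \<in> V \<Longrightarrow> \<phi> u = \<phi> v \<longleftrightarrow> u = v \<or> u \<in> ends e \<and> v \<in> ends e"
    and ends': "\<And>f. f \<in> A - {e} \<Longrightarrow> ends' f = \<phi> ` ends f"
begin

lemma reach_in: "(u, v) \<in> greach ends A \<Longrightarrow> u \<in> V \<Longrightarrow> v \<in> V"
  by (erule greach_closed) (use ends_sub in auto)

lemma comp_sub: "C \<in> gcomps V ends A \<Longrightarrow> C \<subseteq> V"
  unfolding gcomps_def using reach_in by blast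

lemma \<phi>_reach: "u \<in> V \<Longrightarrow> v \<in> V \<Longrightarrow> \<phi> u = \<phi> v \<Longrightarrow> (u, v) \<in> greach ends A"
  using \<phi>_eq eA by (metis greach_edge greach_refl)

lemma reach_iff:
  assumes "u \<in> V" "v \<in> V"
  shows "(\<phi> u, \<phi> v) \<in> greach ends' (A - {e}) \<longleftrightarrow> (u, v) \<in> greach ends A"
proof
  assume "(u, v) \<in> greach ends A"
  then have "v \<in> {v \<in> V. (\<phi> u, \<phi> v) \<in> greach ends' (A - {e})}"
  proof (rule greach_closed)
    show "u \<in> {v \<in> V. (\<phi> u, \<phi> v) \<in> greach ends' (A - {e})}" using assms by simp
    fix f x y
    assume f: "f \<in> A" "x \<in> {v \<in> V. (\<phi> u, \<phi> v) \<in> greach ends' (A - {e})}" "x \<in> ends f" "y \<in> ends f"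
    then have yV: "y \<in> V" using ends_sub by blast
    show "y \<in> {v \<in> V. (\<phi> u, \<phi> v) \<in> greach ends' (A - {e})}"
    proof (cases "f = e")
      case True
      then have "\<phi> x = \<phi> y" using \<phi>_eq f yV by simp
      then show ?thesis using f(2) yV by simp
    next
      case False
      then have fA: "f \<in> A - {e}" using f(1) by simp
      have "(\<phi> x, \<phi> y) \<in> greach ends' (A - {e})"
        by (rule greach_edge[OF fA]) (use ends'[OF fA] f in auto)
      then show ?thesis using f(2) yV greach_trans by (metis (no_types, lifting) mem_Collect_eq)
    qed
  qed
  then show "(\<phi> u, \<phi> v) \<in> greach ends' (A - {e})" by simp
next
  assume "(\<phi> u, \<phi> v) \<in> greach ends' (A - {e})"
  then have "\<phi> v \<in> {b. \<forall>x\<in>V. \<phi> x = b \<longrightarrow> (u, x) \<in> greach ends A}"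
  proof (rule greach_closed)
    show "\<phi> u \<in> {b. \<forall>x\<in>V. \<phi> x = b \<longrightarrow> (u, x) \<in> greach ends A}"
      using \<phi>_reach assms by auto
    fix f b c
    assume f: "f \<in> A - {e}" "b \<in> {b. \<forall>x\<in>V. \<phi> x = b \<longrightarrow> (u, x) \<in> greach ends A}"
      "b \<in> ends' f" "c \<in> ends' f"
    then obtain x y where xy: "x \<in> ends f" "y \<in> ends f" "b = \<phi> x" "c = \<phi> y" using ends'[OF f(1)] by auto
    have V: "x \<in> V" "y \<in> V" using ends_sub f(1) xy by auto
    have "(u, x) \<in> greach ends A" using f(2) xy V by simp
    moreover have "(x, y) \<in> greach ends A" by (rule greach_edge) (use f xy in auto)
    ultimately have uy: "(u, y) \<in> greach ends A" by (rule greach_trans)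
    have "(u, z) \<in> greach ends A" if "z \<in> V" "\<phi> z = c" for z
      using greach_trans[OF uy \<phi>_reach[OF V(2) that(1)]] that xy by simp
    then show "c \<in> {b. \<forall>x\<in>V. \<phi> x = b \<longrightarrow> (u, x) \<in> greach ends A}" by simp
  qed
  then show "(u, v) \<in> greach ends A" using assms by simp
qed

lemma reach_image:
  assumes u: "u \<in> V"
  shows "greach ends' (A - {e}) `` {\<phi> u} = \<phi> ` (greach ends A `` {u})"
proof
  show "greach ends' (A - {e}) `` {\<phi> u} \<subseteq> \<phi> ` (greach ends A `` {u})"
  proof
    fix b assume "b \<in> greach ends' (A - {e}) `` {\<phi> u}"
    then have ub: "(\<phi> u, b) \<in> greach ends' (A - {e})" by simp
    have "ends' f \<subseteq> \<phi> ` V" if "f \<in> A - {e}" for f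
      using ends'[OF that] ends_sub that by blast
    then have "b \<in> \<phi> ` V"
      by (intro greach_closed[OF ub]) (use u in auto)
    then obtain v where "v \<in> V" "b = \<phi> v" by blast
    then show "b \<in> \<phi> ` (greach ends A `` {u})" using ub reach_iff u by auto
  qed
  show "\<phi> ` (greach ends A `` {u}) \<subseteq> greach ends' (A - {e}) `` {\<phi> u}"
    using reach_iff[OF u] reach_in u by auto
qed

lemma comps_contraction: "gcomps (\<phi> ` V) ends' (A - {e}) = (`) \<phi> ` gcomps V ends A"
  unfolding gcomps_def image_image using reach_image by (intro image_cong) auto

text \<open>Points glued by \<open>\<phi>\<close> already lie in one component, so components are
  never merged.\<close>

lemma comps_inj: "inj_on ((`) \<phi>) (gcomps V ends A)"
proof (rule inj_onI)
  fix C C' assume C: "C \<in> gcomps V ends A" "C' \<in> gcomps V ends A" "\<phi> ` C = \<phi> ` C'"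
  then obtain u where u: "u \<in> V" "C = greach ends A `` {u}" by (auto simp: gcomps_def)
  then have "\<phi> u \<in> \<phi> ` C'" using C(3) by (metis Image_singleton_iff greach_refl image_eqI)
  then obtain v where v: "v \<in> C'" "\<phi> u = \<phi> v" by blast
  then have "(u, v) \<in> greach ends A" using \<phi>_reach u comp_sub[OF C(2)] by blast
  then have "v \<in> C" using u by simp
  then show "C = C'" using gcomps_of C(1,2) v(1) by metis
qed

lemma comp_cases:
  assumes "C \<in> gcomps V ends A"
  obtains "ends e \<subseteq> C" | "ends e \<inter> C = {}"
  using gcomps_edge[OF assms _ eA] by blast

text \<open>A component contains all ends of \<open>e\<close> or none, so \<open>\<phi>\<close>
  glues no outside vertex to it.\<close>

lemma comp_edges:
  assumes C: "C \<in> gcomps V ends A"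
  shows "{f \<in> A - {e}. ends' f \<subseteq> \<phi> ` C} = {f \<in> A. ends f \<subseteq> C} - {e}"
proof -
  have "ends' f \<subseteq> \<phi> ` C \<longleftrightarrow> ends f \<subseteq> C" if f: "f \<in> A - {e}" for f
  proof
    assume *: "ends' f \<subseteq> \<phi> ` C"
    show "ends f \<subseteq> C"
    proof
      fix u assume u: "u \<in> ends f"
      then obtain c where c: "c \<in> C" "\<phi> u = \<phi> c" using * ends'[OF f] by auto
      have "u \<in> V" "c \<in> V" using u f ends_sub comp_sub[OF C] c by auto
      then have "u = c \<or> u \<in> ends e \<and> c \<in> ends e" using \<phi>_eq c(2) by blast
      then show "u \<in> C" using c(1) gcomps_edge[OF C c(1) eA] by auto
    qed
  qed (use ends'[OF f] in auto)
  then show ?thesis by auto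
qed

lemma inj_off: "S \<subseteq> V \<Longrightarrow> S \<inter> ends e = {} \<Longrightarrow> inj_on \<phi> S"
  using \<phi>_eq by (intro inj_onI) blast

lemma image_split:
  assumes "S \<subseteq> V" "ends e \<subseteq> S" "u \<in> ends e"
  shows "\<phi> ` S = insert (\<phi> u) (\<phi> ` (S - ends e))" "\<phi> u \<notin> \<phi> ` (S - ends e)"
proof -
  have V: "x \<in> V" if "x \<in> S" for x using that assms by blast
  have "\<phi> x = \<phi> u" if "x \<in> ends e" for x using \<phi>_eq[of x u] V assms that by blast
  then show "\<phi> ` S = insert (\<phi> u) (\<phi> ` (S - ends e))" using assms(2,3) by blast
  show "\<phi> u \<notin> \<phi> ` (S - ends e)" using \<phi>_eq V assms by blast
qed

text \<open>The ends of \<open>e\<close> become one point and the rest stays apart. The additive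
  form avoids subtraction of naturals.\<close>

lemma card_image_sub:
  assumes "S \<subseteq> V" "ends e \<subseteq> S"
  shows "card (\<phi> ` S) + card (ends e) = card S + 1"
proof -
  obtain u where u: "u \<in> ends e" using ends_ne by blast
  have fin: "finite S" using assms finV finite_subset by blast
  have "card (\<phi> ` S) = card (\<phi> ` (S - ends e)) + 1"
    using image_split[OF assms u] fin by simp
  also have "card (\<phi> ` (S - ends e)) = card (S - ends e)"
    by (rule card_image, rule inj_off) (use assms in auto)
  also have "card (S - ends e) = card S - card (ends e)"
    using assms fin by (meson card_Diff_subset finite_subset)
  finally show ?thesis using card_mono[OF fin assms(2)] by simp
qed

end

section \<open>Packaged ribbon graphs under contraction\<close>

definition comp_graph :: "'f packaged \<Rightarrow> 'f set set \<Rightarrow> 'f set set set \<Rightarrow> ('f set set, 'f set) wgraph" where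
  "comp_graph P A C =
     \<lparr>wverts = C, wedges = {f \<in> A. touched_blocks f (vpart P) \<subseteq> C},
      wends = (\<lambda>f. touched_blocks f (vpart P)), wweight = vweight P\<rparr>"

definition pcomps :: "'f packaged \<Rightarrow> 'f set set \<Rightarrow> 'f set set set set" where
  "pcomps P A = gcomps (vpart P) (\<lambda>f. touched_blocks f (vpart P)) A"

text \<open>The part of \<open>gamma\<close> without component and boundary counts. Contracting an
  edge of \<open>A\<close> preserves it, and plus one it is the weight of the block to which
  \<open>C\<close> shrinks.\<close>

definition excess :: "'f packaged \<Rightarrow> 'f set set \<Rightarrow> 'f set set set \<Rightarrow> int" where
  "excess P A C = int (card {f \<in> A. touched_blocks f (vpart P) \<subseteq> C}) - int (card C)
     + int (\<Sum>X\<in>C. vweight P X)"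

definition side_term :: "'f packaged \<Rightarrow> 'a::comm_semiring_1 \<Rightarrow> (int \<Rightarrow> 'a) \<Rightarrow> 'f set set \<Rightarrow> 'a" where
  "side_term P z zs A = z ^ nullity (vpackaging P A) *
     (\<Prod>K\<in>wcomponents (vpackaging P A). zs (gamma (ribbon P) K))"

locale pkg =
  fixes P :: "'f packaged"
  assumes pkg: "packaged_ribbon_graph P"
begin

abbreviation G where "G \<equiv> ribbon P"
abbreviation p where "p \<equiv> vpart P"

sublocale rgraph G
  by unfold_locales (use pkg in \<open>simp add: packaged_ribbon_graph_def\<close>)

lemma part: "partition_on (vertices G) p"
  using pkg by (simp add: packaged_ribbon_graph_def)

lemma finite_p: "finite p"
  using finite_elements[OF finite_vertices part] .

lemma block_sub: "X \<in> p \<Longrightarrow> X \<subseteq> vertices G"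
  using part by (auto simp: partition_on_def)

lemma vertices_disj: "s \<in> vertices G \<Longrightarrow> s' \<in> vertices G \<Longrightarrow> a \<in> s \<Longrightarrow> a \<in> s' \<Longrightarrow> s = s'"
  unfolding vertices_def using V.orbit_of by metis

lemma blocks_disj: "X \<in> p \<Longrightarrow> Y \<in> p \<Longrightarrow> a \<in> \<Union>X \<Longrightarrow> a \<in> \<Union>Y \<Longrightarrow> X = Y"
proof -
  assume *: "X \<in> p" "Y \<in> p" "a \<in> \<Union>X" "a \<in> \<Union>Y"
  then obtain s s' where s: "s \<in> X" "s' \<in> Y" "a \<in> s" "a \<in> s'" by blast
  then have "s = s'" using vertices_disj block_sub * by blast
  then show "X = Y" using * s partition_onD2[OF part] unfolding disjoint_def by blast
qed

lemma block_of: "a \<in> flags G \<Longrightarrow> \<exists>X\<in>p. a \<in> \<Union>X"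
proof -
  assume "a \<in> flags G"
  then have "a \<in> \<Union>(\<Union>p)" using partition_onD1[OF part] Union_vertices by simp
  then show ?thesis by blast
qed

lemma touched_iff: "X \<in> touched_blocks f q \<longleftrightarrow> X \<in> q \<and> \<Union>X \<inter> f \<noteq> {}"
  by (auto simp: touched_blocks_def)

lemma touched_ne: "f \<in> edges G \<Longrightarrow> touched_blocks f p \<noteq> {}"
proof -
  assume f: "f \<in> edges G"
  then obtain a where a: "a \<in> f" "a \<in> flags G" using edge_nonempty edge_subset by blast
  then show ?thesis using block_of[OF a(2)] touched_iff[of _ f p] by blast
qed

text \<open>\<open>tau2\<close> stays inside a vertex, so the four flags of an edge lie in the
  blocks of \<open>a\<close> and \<open>tau0 G a\<close>, which may coincide.\<close>

lemma touched_card: "f \<in> edges G \<Longrightarrow> card (touched_blocks f p) = 1 \<or> card (touched_blocks f p) = 2"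
proof -
  assume f: "f \<in> edges G"
  then obtain a where a: "a \<in> f" using edge_nonempty by blast
  have a': "a \<in> flags G" "f = {a, tau0 G a, tau2 G a, tau0 G (tau2 G a)}"
    using edge_of[OF f a] by (auto simp: edge_at_def)
  have same: "tau2 G b \<in> \<Union>X" if "X \<in> p" "b \<in> \<Union>X" for X b
    using V.orbits_closed[of _ b "tau2 G"] block_sub[OF that(1)] that(2) unfolding vertices_def by blast
  obtain X Y where XY: "X \<in> p" "a \<in> \<Union>X" "Y \<in> p" "tau0 G a \<in> \<Union>Y"
    using block_of[OF a'(1)] block_of[OF tau_in(1)[OF a'(1)]] by blast
  have 2: "tau2 G a \<in> \<Union>X" "tau0 G (tau2 G a) \<in> \<Union>Y"
    using same[OF XY(1,2)] same[OF XY(3,4)] unfolding tau2_tau0[OF a'(1)] .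
  have "touched_blocks f p = {X, Y}"
  proof
    show "touched_blocks f p \<subseteq> {X, Y}"
    proof
      fix Z assume "Z \<in> touched_blocks f p"
      then obtain b where b: "Z \<in> p" "b \<in> \<Union>Z" "b \<in> f"
        unfolding touched_iff[of Z f p] by blast
      have "b = a \<or> b = tau0 G a \<or> b = tau2 G a \<or> b = tau0 G (tau2 G a)"
        using b(3) unfolding a'(2) by simp
      then have "b \<in> \<Union>X \<or> b \<in> \<Union>Y" using XY(2,4) 2 by metis
      then show "Z \<in> {X, Y}" using blocks_disj[OF b(1) _ b(2)] XY by blast
    qed
    have "a \<in> f" "tau0 G a \<in> f" unfolding a'(2) by simp_all
    then have "X \<in> touched_blocks f p" "Y \<in> touched_blocks f p"
      using XY unfolding touched_iff by blast+
    then show "{X, Y} \<subseteq> touched_blocks f p" by simp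
  qed
  then show ?thesis by (simp add: card_insert_if)
qed

lemma vertices_spanning_subgraph: "vertices (spanning_subgraph G A) = vertices G"
proof -
  have "tau2 (spanning_subgraph G A) = tau2 G" "tau1 (spanning_subgraph G A) = tau1 G"
    "flags (spanning_subgraph G A) = flags G"
    unfolding spanning_subgraph_twist by (simp_all add: fun_eq_iff)
  then show ?thesis by (simp add: vertices_def)
qed

lemma vpackaging_eq:
  assumes "A \<subseteq> edges G"
  shows "vpackaging P A =
    \<lparr>wverts = p, wedges = A, wends = (\<lambda>f. touched_blocks f p), wweight = vweight P\<rparr>"
proof -
  have "{X \<in> p. \<exists>v\<in>X. v \<in> end_vertices (spanning_subgraph G A) f} = touched_blocks f p" for f
    unfolding end_vertices_def touched_blocks_def vertices_spanning_subgraph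
    using block_sub by blast
  then show ?thesis
    using assms by (simp add: vpackaging_def packaging_def fun_eq_iff)
qed

lemma wcomponents_eq:
  assumes "A \<subseteq> edges G"
  shows "wcomponents (vpackaging P A) = comp_graph P A ` pcomps P A"
proof -
  have "wreach (vpackaging P A) = greach (\<lambda>f. touched_blocks f p) A"
    unfolding vpackaging_eq[OF assms] wreach_def greach_def by simp
  then show ?thesis
    unfolding wcomponents_def pcomps_def gcomps_def image_image Let_def comp_graph_def
    by (simp add: vpackaging_eq[OF assms])
qed

lemma comp_graph_inj: "inj_on (comp_graph P A) S"
  by (rule inj_onI) (simp add: comp_graph_def)

lemma nullity_eq:
  assumes "A \<subseteq> edges G"
  shows "nullity (vpackaging P A) = card A + card (pcomps P A) - card p"
  unfolding nullity_def wcomponents_eq[OF assms] card_image[OF comp_graph_inj]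
  by (simp add: vpackaging_eq[OF assms])

lemma pcomps_sub: "C \<in> pcomps P A \<Longrightarrow> C \<subseteq> p"
proof
  fix X assume C: "C \<in> pcomps P A" "X \<in> C"
  then obtain u where u: "u \<in> p" "(u, X) \<in> greach (\<lambda>f. touched_blocks f p) A"
    by (auto simp: pcomps_def gcomps_def)
  show "X \<in> p" by (rule greach_closed[OF u(2,1)]) (auto simp: touched_blocks_def)
qed

text \<open>Edges at a vertex of \<open>C\<close> stay inside \<open>C\<close>, so paths of the
  packaging are paths of the component. Being a single component yields the constant 2 in
  \<open>gamma_comp_graph\<close>.\<close>

lemma wcomponents_comp_graph:
  assumes C: "C \<in> pcomps P A"
  shows "wcomponents (comp_graph P A C) = {comp_graph P A C}"
proof -
  let ?t = "\<lambda>f. touched_blocks f p" and ?A = "{f \<in> A. touched_blocks f p \<subseteq> C}"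
  have wr: "wreach (comp_graph P A C) = greach ?t ?A"
    by (simp add: wreach_def greach_def comp_graph_def)
  have reach: "greach ?t ?A `` {u} = C" if u: "u \<in> C" for u
  proof
    show "greach ?t ?A `` {u} \<subseteq> C"
    proof
      fix v assume "v \<in> greach ?t ?A `` {u}"
      then have "(u, v) \<in> greach ?t ?A" by simp
      then show "v \<in> C" by (rule greach_closed) (use u in auto)
    qed
    show "C \<subseteq> greach ?t ?A `` {u}"
    proof
      fix v assume "v \<in> C"
      then have "(u, v) \<in> greach ?t A" using gcomps_of[OF C[unfolded pcomps_def] u] by blast
      then have "v \<in> C \<inter> greach ?t ?A `` {u}"
      proof (rule greach_closed)
        show "u \<in> C \<inter> greach ?t ?A `` {u}" using u by simp
        fix f x y assume f: "f \<in> A" "x \<in> C \<inter> greach ?t ?A `` {u}" "x \<in> ?t f" "y \<in> ?t f"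
        then have "?t f \<subseteq> C" using gcomps_edge[OF C[unfolded pcomps_def]] by blast
        then have "f \<in> ?A" using f(1) by simp
        then have "(x, y) \<in> greach ?t ?A" using f(3,4) by (rule greach_edge)
        then show "y \<in> C \<inter> greach ?t ?A `` {u}"
          using f(2,4) \<open>?t f \<subseteq> C\<close> by (auto dest: greach_trans)
      qed
      then show "v \<in> greach ?t ?A `` {u}" by simp
    qed
  qed
  have ne: "C \<noteq> {}" using C by (auto simp: pcomps_def gcomps_def intro: greach_refl)
  have verts: "wverts (comp_graph P A C) = C" by (simp add: comp_graph_def)
  have "comp_graph P A C\<lparr>wverts := C, wedges := {f \<in> wedges (comp_graph P A C). wends (comp_graph P A C) f \<subseteq> C}\<rparr>
      = comp_graph P A C"
    by (auto simp: comp_graph_def)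
  then show ?thesis
    unfolding wcomponents_def Let_def wr verts using reach ne by auto
qed

lemma gamma_comp_graph:
  assumes "C \<in> pcomps P A"
  shows "gamma G (comp_graph P A C) =
    2 + excess P A C - int (card (boundaries (unpackage G (comp_graph P A C))))"
  unfolding gamma_def wcomponents_comp_graph[OF assms] excess_def by (simp add: comp_graph_def)

lemma side_term_eq:
  assumes "A \<subseteq> edges G"
  shows "side_term P z zs A = z ^ nullity (vpackaging P A) *
    (\<Prod>C\<in>pcomps P A. zs (2 + excess P A C - int (card (boundaries (unpackage G (comp_graph P A C))))))"
  unfolding side_term_def wcomponents_eq[OF assms] prod.reindex[OF comp_graph_inj]
  using gamma_comp_graph by (simp cong: prod.cong)

end

section \<open>Contraction of one edge of a packaged ribbon graph\<close>

lemma pcontract_simps [simp]: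
  "ribbon (pcontract e P) = contract e (ribbon P)"
  "vpart (pcontract e P) = update_part e (vertices (contract e (ribbon P))) (vpart P)"
  "vweight (pcontract e P) = update_weight e (vertices (contract e (ribbon P))) (vpart P) (vweight P)"
  "bpart (pcontract e P) = bpart P"
  "bweight (pcontract e P) = bweight P"
  by (simp_all add: pcontract_def Let_def)

locale pkg_edge = pkg +
  fixes e
  assumes e: "e \<in> edges (ribbon P)"
begin

abbreviation G' where "G' \<equiv> contract e G"
abbreviation T where "T \<equiv> touched_blocks e p"
abbreviation N where "N \<equiv> new_block e (vertices G') p"

definition merge :: "'a set set \<Rightarrow> 'a set set" where
  "merge X = (if X \<in> T then N else X)"

sublocale C: rgraph G'
  by unfold_locales (rule contract(1)[OF e])

lemma avoiding_vertices: "{s \<in> vertices G. s \<inter> e = {}} = {s \<in> vertices G'. s \<inter> e = {}}"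
  unfolding vertices_def contract(3)[OF e]
proof (rule orbits_avoiding_eq)
  show "involutions (flags G) {tau1 G', tau2 G'}"
    using C.V.involutions_axioms unfolding contract(3)[OF e] .
  show "(\<lambda>t. t a) ` {tau1 G, tau2 G} = (\<lambda>t. t a) ` {tau1 G', tau2 G'}" if "a \<in> flags G - e" for a
    using that by (simp add: contract_def)
qed (rule V.involutions_axioms)

text \<open>Vertices away from \<open>e\<close> are the same before and after, and both families
  partition the flags, so the complements agree.\<close>

lemma touching_flags:
  "\<Union>{s \<in> vertices G. s \<inter> e \<noteq> {}} = \<Union>{s \<in> vertices G'. s \<inter> e \<noteq> {}}"
proof -
  have *: "\<Union>{s \<in> S. s \<inter> e \<noteq> {}} = flags G - \<Union>{s \<in> S. s \<inter> e = {}}" if S: "partition_on (flags G) S" for S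
  proof -
    have uniq: "s = s'" if "s \<in> S" "s' \<in> S" "a \<in> s" "a \<in> s'" for s s' a
      using partition_onD2[OF S] that unfolding disjoint_def by blast
    have dis: "(\<Union>{s \<in> S. s \<inter> e \<noteq> {}}) \<inter> \<Union>{s \<in> S. s \<inter> e = {}} = {}"
    proof (rule equals0I)
      fix a assume "a \<in> (\<Union>{s \<in> S. s \<inter> e \<noteq> {}}) \<inter> \<Union>{s \<in> S. s \<inter> e = {}}"
      then obtain s s' where "s \<in> S" "s' \<in> S" "a \<in> s" "a \<in> s'" "s \<inter> e \<noteq> {}" "s' \<inter> e = {}" by blast
      then show False using uniq by metis
    qed
    have un: "(\<Union>{s \<in> S. s \<inter> e \<noteq> {}}) \<union> \<Union>{s \<in> S. s \<inter> e = {}} = flags G"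
      unfolding partition_onD1[OF S] Union_Un_distrib[symmetric]
      by (rule arg_cong[where f = Union]) blast
    have "X = Z - Y" if "X \<inter> Y = {}" "X \<union> Y = Z" for X Y Z :: "'a set"
      using that by blast
    from this[OF dis un] show ?thesis .
  qed
  have "partition_on (flags G) (vertices G')"
    using C.partition_vertices contract(3)[OF e] by simp
  then show ?thesis
    using *[OF partition_vertices] *[of "vertices G'"] avoiding_vertices by simp
qed

lemma Union_touching: "\<Union>{s \<in> \<Union>T. s \<inter> e \<noteq> {}} = \<Union>{s \<in> vertices G. s \<inter> e \<noteq> {}}"
proof -
  have "s \<in> \<Union>T" if "s \<in> vertices G" "s \<inter> e \<noteq> {}" for s
  proof -
    have "s \<in> \<Union>p" using partition_onD1[OF part] that by simp
    then show ?thesis using that(2) by (auto simp: touched_blocks_def)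
  qed
  moreover have "s \<in> vertices G" if "s \<in> \<Union>T" for s
    using that block_sub by (auto simp: touched_blocks_def)
  ultimately show ?thesis by blast
qed

text \<open>Vertices may merge, split or turn along \<open>e\<close>, but the flags covered by the
  touched blocks do not change. Blocks are therefore compared through their flags.\<close>

lemma Union_N: "\<Union>N = \<Union>(\<Union>T)"
proof -
  have "\<Union>N = \<Union>{s \<in> \<Union>T. s \<inter> e = {}} \<union> \<Union>{s \<in> vertices G'. s \<inter> e \<noteq> {}}"
    by (auto simp: new_block_def)
  also have "\<dots> = \<Union>{s \<in> \<Union>T. s \<inter> e = {}} \<union> \<Union>{s \<in> \<Union>T. s \<inter> e \<noteq> {}}"
    unfolding Union_touching touching_flags ..
  also have "\<dots> = \<Union>(\<Union>T)" by blast
  finally show ?thesis .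
qed

lemma T_ne: "T \<noteq> {}"
  by (rule touched_ne[OF e])

text \<open>The new block still meets \<open>e\<close>, an untouched block does not. Hence the new
  weight never overwrites an old one.\<close>

lemma N_notin: "N \<notin> p - T"
proof
  assume N: "N \<in> p - T"
  obtain X where X: "X \<in> T" using T_ne by blast
  then have "\<Union>X \<inter> e \<noteq> {}" by (simp add: touched_iff)
  then have "\<Union>N \<inter> e \<noteq> {}" using X unfolding Union_N by blast
  then show False using N by (simp add: touched_iff)
qed

lemma vpart_merge: "vpart (pcontract e P) = merge ` p"
proof -
  have "T \<subseteq> p" by (auto simp: touched_blocks_def)
  then have "merge ` p = insert N (p - T)" using T_ne by (auto simp: merge_def)
  then show ?thesis by (simp add: update_part_def)
qed

lemma merge_eq: "X \<in> p \<Longrightarrow> Y \<in> p \<Longrightarrow> merge X = merge Y \<longleftrightarrow> X = Y \<or> X \<in> T \<and> Y \<in> T"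
  using N_notin by (auto simp: merge_def)

lemma Union_merge:
  assumes "T \<subseteq> S \<or> T \<inter> S = {}"
  shows "\<Union>(\<Union>(merge ` S)) = \<Union>(\<Union>S)"
proof (cases "T \<subseteq> S")
  case True
  then have "merge ` S = insert N (S - T)" using T_ne by (auto simp: merge_def)
  then have "\<Union>(\<Union>(merge ` S)) = \<Union>N \<union> \<Union>(\<Union>(S - T))" by simp
  then show ?thesis using True unfolding Union_N by blast
next
  case False
  then have "merge ` S = S" using assms by (auto simp: merge_def)
  then show ?thesis by simp
qed

lemma touched_merge: "touched_blocks f (merge ` p) = merge ` touched_blocks f p"
proof
  show "touched_blocks f (merge ` p) \<subseteq> merge ` touched_blocks f p"
  proof
    fix Y assume "Y \<in> touched_blocks f (merge ` p)"
    then obtain X where X: "X \<in> p" "Y = merge X" "\<Union>(merge X) \<inter> f \<noteq> {}" by (auto simp: touched_iff)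
    show "Y \<in> merge ` touched_blocks f p"
    proof (cases "X \<in> T")
      case True
      then have "\<Union>(\<Union>T) \<inter> f \<noteq> {}" using X(3) by (simp add: merge_def Union_N del: Union_iff)
      then obtain Z where Z: "Z \<in> T" "\<Union>Z \<inter> f \<noteq> {}" by blast
      then have "Z \<in> touched_blocks f p" "merge Z = Y"
        using True X(2) by (auto simp: touched_iff merge_def)
      then show ?thesis by blast
    next
      case False
      then have "X \<in> touched_blocks f p" using X by (simp add: touched_iff merge_def)
      then show ?thesis using X(2) by blast
    qed
  qed
  show "merge ` touched_blocks f p \<subseteq> touched_blocks f (merge ` p)"
  proof
    fix Y assume "Y \<in> merge ` touched_blocks f p"
    then obtain X where "X \<in> touched_blocks f p" and Y: "Y = merge X" by blast
    then have X: "X \<in> p" "Y = merge X" "\<Union>X \<inter> f \<noteq> {}" unfolding touched_iff by blast+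
    have "\<Union>X \<subseteq> \<Union>(merge X)"
    proof (cases "X \<in> T")
      case True
      then have "\<Union>(merge X) = \<Union>(\<Union>T)" by (simp add: merge_def Union_N)
      then show ?thesis using True by blast
    qed (simp add: merge_def)
    then have "\<Union>Y \<inter> f \<noteq> {}" using X(2,3) by blast
    then show "Y \<in> touched_blocks f (merge ` p)" using X(1,2) by (simp add: touched_iff)
  qed
qed

text \<open>With one touched block the sum is its own weight, so both cases of
  \<open>update_weight\<close> differ only by the increment for a loop of the packaging.\<close>

lemma vweight_merge:
  assumes "X \<in> p"
  shows "vweight (pcontract e P) (merge X) =
    (if X \<in> T then (\<Sum>Y\<in>T. vweight P Y) + (if card T = 1 then 1 else 0) else vweight P X)"
proof (cases "X \<in> T")
  case True
  show ?thesis
  proof (cases "card T = 1")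
    case t1: True
    then obtain Y where "T = {Y}" by (auto simp: card_1_singleton_iff)
    then show ?thesis using True by (simp add: merge_def update_weight_def)
  qed (use True in \<open>simp add: merge_def update_weight_def\<close>)
next
  case False
  then have "X \<noteq> N" using N_notin assms by auto
  then show ?thesis using False assms by (simp add: merge_def update_weight_def)
qed

lemma pcontract_packaged: "packaged_ribbon_graph (pcontract e P)"
  unfolding packaged_ribbon_graph_def
proof (intro conjI)
  show "ribbon_graph (ribbon (pcontract e P))" by (simp add: C.rg)
  have "boundaries G' = boundaries G"
    using contract[OF e] by (simp add: boundaries_def)
  then show "partition_on (boundaries (ribbon (pcontract e P))) (bpart (pcontract e P))"
    using pkg by (simp add: packaged_ribbon_graph_def)
  have Tp: "T \<subseteq> p" by (auto simp: touched_blocks_def)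
  have av: "s \<in> vertices G \<longleftrightarrow> s \<in> vertices G'" if "s \<inter> e = {}" for s
    using avoiding_vertices that by blast
  have av': "s \<inter> e = {}" if "s \<in> X" "X \<in> p - T" for s X
    using that by (auto simp: touched_blocks_def)
  have "partition_on (vertices G') (insert N (p - T))"
  proof (rule partition_onI)
    show "\<Union>(insert N (p - T)) = vertices G'"
    proof
      show "\<Union>(insert N (p - T)) \<subseteq> vertices G'"
      proof
        fix s assume "s \<in> \<Union>(insert N (p - T))"
        then consider "s \<in> N" | X where "X \<in> p - T" "s \<in> X" by blast
        then show "s \<in> vertices G'"
        proof cases
          case 1
          then consider "s \<in> \<Union>T" "s \<inter> e = {}" | "s \<in> vertices G'" by (auto simp: new_block_def)
          then show ?thesis using av block_sub Tp by cases blast+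
        next
          case 2
          then show ?thesis using av[OF av'[OF 2(2,1)]] block_sub by blast
        qed
      qed
      show "vertices G' \<subseteq> \<Union>(insert N (p - T))"
      proof
        fix s assume s: "s \<in> vertices G'"
        show "s \<in> \<Union>(insert N (p - T))"
        proof (cases "s \<inter> e = {}")
          case True
          then have "s \<in> \<Union>p" using av s partition_onD1[OF part] by blast
          then obtain X where "X \<in> p" "s \<in> X" by blast
          then show ?thesis using True by (cases "X \<in> T") (auto simp: new_block_def)
        next
          case False
          then show ?thesis using s by (auto simp: new_block_def)
        qed
      qed
    qed
    have N_disj: "disjnt N X" if X: "X \<in> p - T" for X
    proof -
      have False if s: "s \<in> N" "s \<in> X" for s
      proof -
        have "s \<inter> e = {}" using av' s X by blast
        then obtain Y where Y: "Y \<in> T" "s \<in> Y" using s(1) by (auto simp: new_block_def)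
        then have "Y = X" using partition_onD2[OF part] X s(2) Tp unfolding disjoint_def by blast
        then show False using X Y by blast
      qed
      then show ?thesis unfolding disjnt_iff by blast
    qed
    fix X Y assume XY: "X \<in> insert N (p - T)" "Y \<in> insert N (p - T)" "X \<noteq> Y"
    then show "disjnt X Y"
    proof (cases "X = N \<or> Y = N")
      case True
      then show ?thesis using N_disj XY by (metis disjnt_sym insertE)
    next
      case False
      then have "X \<in> p" "Y \<in> p" using XY by auto
      then show ?thesis using partition_onD2[OF part] XY(3) unfolding disjoint_def disjnt_def by blast
    qed
  next
    obtain X where "X \<in> T" using T_ne by blast
    then have "\<Union>N \<noteq> {}" unfolding Union_N using touched_iff[of X e p] by blast
    then show "{} \<notin> insert N (p - T)" using partition_onD3[OF part] by auto
  qed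
  then show "partition_on (vertices (ribbon (pcontract e P))) (vpart (pcontract e P))"
    by (simp add: update_part_def)
qed

sublocale P': pkg "pcontract e P"
  by unfold_locales (rule pcontract_packaged)

context
  fixes A
  assumes A: "A \<subseteq> edges G" and eA: "e \<in> A"
begin

interpretation M: graph_contraction p "\<lambda>f. touched_blocks f p"
  "\<lambda>f. touched_blocks f (vpart (pcontract e P))" A e merge
proof
  show "finite p" by (rule finite_p)
  show "touched_blocks f p \<subseteq> p" for f by (auto simp: touched_blocks_def)
  show "T \<noteq> {}" by (rule T_ne)
  show "merge u = merge v \<longleftrightarrow> u = v \<or> u \<in> T \<and> v \<in> T" if "u \<in> p" "v \<in> p" for u v
    using merge_eq that .
  show "touched_blocks f (vpart (pcontract e P)) = merge ` touched_blocks f p" for f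
    unfolding vpart_merge by (rule touched_merge)
qed (rule eA)

lemma pcomps_contract: "pcomps (pcontract e P) (A - {e}) = (`) merge ` pcomps P A"
  unfolding pcomps_def using M.comps_contraction unfolding vpart_merge .

lemma pcomps_inj: "inj_on ((`) merge) (pcomps P A)"
  unfolding pcomps_def by (rule M.comps_inj)

lemma pcomp_cases: "C \<in> pcomps P A \<Longrightarrow> T \<subseteq> C \<or> T \<inter> C = {}"
  unfolding pcomps_def using M.comp_cases by metis

lemma flags_comp_contract: "C \<in> pcomps P A \<Longrightarrow> \<Union>(\<Union>(merge ` C)) = \<Union>(\<Union>C)"
  by (rule Union_merge, rule pcomp_cases)

lemma edges_comp_contract:
  assumes "C \<in> pcomps P A"
  shows "{f \<in> A - {e}. touched_blocks f (vpart (pcontract e P)) \<subseteq> merge ` C} =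
    {f \<in> A. touched_blocks f p \<subseteq> C} - {e}"
  by (rule M.comp_edges[OF assms[unfolded pcomps_def]])

text \<open>If \<open>C\<close> contains the ends of \<open>e\<close>, the edge count drops by one.
  With two ends the vertex count drops as well; with one end the weight grows by one
  instead.\<close>

lemma excess_contract:
  assumes C: "C \<in> pcomps P A"
  shows "excess (pcontract e P) (A - {e}) (merge ` C) = excess P A C"
proof -
  let ?E = "{f \<in> A. touched_blocks f p \<subseteq> C}"
  let ?w' = "vweight (pcontract e P)"
  have Cp: "C \<subseteq> p" by (rule pcomps_sub[OF C])
  have finC: "finite C" using Cp finite_p finite_subset by blast
  have finE: "finite ?E" using A finite_edges finite_subset by fastforce
  have sum_off: "(\<Sum>Y\<in>merge ` S. ?w' Y) = (\<Sum>X\<in>S. vweight P X)" if "S \<subseteq> p" "S \<inter> T = {}" for S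
  proof -
    have "(\<Sum>Y\<in>merge ` S. ?w' Y) = (\<Sum>X\<in>S. ?w' (merge X))"
      using sum.reindex[OF M.inj_off[OF that]] by simp
    also have "\<dots> = (\<Sum>X\<in>S. vweight P X)"
    proof (rule sum.cong[OF refl])
      fix X assume "X \<in> S"
      then have "X \<in> p" "X \<notin> T" using that by auto
      then show "?w' (merge X) = vweight P X" using vweight_merge by simp
    qed
    finally show ?thesis .
  qed
  show ?thesis
  proof (cases "T \<subseteq> C")
    case True
    obtain X where X: "X \<in> T" using T_ne by blast
    have Xp: "X \<in> p" using X by (auto simp: touched_blocks_def)
    note split = M.image_split[OF Cp True X]
    have finM: "finite (merge ` (C - T))" using finC by simp
    have "(\<Sum>Y\<in>merge ` C. ?w' Y) = ?w' (merge X) + (\<Sum>Y\<in>merge ` (C - T). ?w' Y)"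
      unfolding split(1) using split(2) finM by (rule sum.insert[rotated])
    also have "(\<Sum>Y\<in>merge ` (C - T). ?w' Y) = (\<Sum>Y\<in>C - T. vweight P Y)"
      by (rule sum_off) (use Cp in auto)
    also have "?w' (merge X) = (\<Sum>Y\<in>T. vweight P Y) + (if card T = 1 then 1 else 0)"
      using vweight_merge[OF Xp] X by simp
    also have "\<dots> + (\<Sum>Y\<in>C - T. vweight P Y) = (\<Sum>Y\<in>C. vweight P Y) + (if card T = 1 then 1 else 0)"
      using sum.subset_diff[OF True finC, of "vweight P"] by simp
    finally have w: "(\<Sum>Y\<in>merge ` C. ?w' Y) = (\<Sum>Y\<in>C. vweight P Y) + (if card T = 1 then 1 else 0)" .
    have eE: "e \<in> ?E" using eA True by simp
    have "card ?E = Suc (card (?E - {e}))" by (rule card_Suc_Diff1[OF finE eE, symmetric])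
    moreover have "card (merge ` C) + card T = card C + 1" by (rule M.card_image_sub[OF Cp True])
    ultimately show ?thesis
      unfolding excess_def edges_comp_contract[OF C] w using touched_card[OF e] by auto
  next
    case False
    then have dis: "C \<inter> T = {}" using pcomp_cases[OF C] by blast
    have "?E - {e} = ?E" using False by auto
    moreover have "card (merge ` C) = card C" by (rule card_image[OF M.inj_off[OF Cp dis]])
    ultimately show ?thesis
      unfolding excess_def edges_comp_contract[OF C] sum_off[OF Cp dis] by simp
  qed
qed

text \<open>A boundary of the subgraph follows \<open>tau0\<close> on its edges and
  \<open>tau2\<close> elsewhere. After contraction \<open>e\<close> is no longer an edge, but there
  the new \<open>tau2\<close> is the old \<open>tau0\<close>, so the walk is unchanged.\<close>

lemma boundaries_contract:
  assumes C: "C \<in> pcomps P A"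
  shows "boundaries (unpackage G' (comp_graph (pcontract e P) (A - {e}) (merge ` C))) =
    boundaries (unpackage G (comp_graph P A C))"
proof -
  let ?E = "{f \<in> A. touched_blocks f p \<subseteq> C}"
  let ?D = "\<Union>(\<Union>C)"
  have E': "{f \<in> A - {e}. touched_blocks f (vpart (pcontract e P)) \<subseteq> merge ` C} = ?E - {e}"
    by (rule edges_comp_contract[OF C])
  let ?t = "\<lambda>a. if a \<in> \<Union>?E then tau0 G a else tau2 G a"
  let ?t' = "\<lambda>a. if a \<in> \<Union>(?E - {e}) then tau0 G' a else tau2 G' a"
  have eq: "?t' a = ?t a" if a: "a \<in> ?D" for a
  proof (cases "T \<subseteq> C")
    case True
    then have "e \<in> ?E" using eA by simp
    then have "a \<in> \<Union>?E \<longleftrightarrow> a \<in> \<Union>(?E - {e}) \<or> a \<in> e" by blast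
    then show ?thesis by (simp add: contract_def)
  next
    case False
    then have dis: "T \<inter> C = {}" using pcomp_cases[OF C] by blast
    have "a \<notin> e"
    proof
      assume "a \<in> e"
      then obtain X where X: "X \<in> C" "\<Union>X \<inter> e \<noteq> {}" using a by blast
      then have "X \<in> T" using pcomps_sub[OF C] touched_iff by blast
      then show False using X dis by blast
    qed
    then have "tau0 G' a = tau0 G a" "tau2 G' a = tau2 G a" by (simp_all add: contract_def)
    moreover have "?E - {e} = ?E" using False by auto
    ultimately show ?thesis by (simp only:)
  qed
  have L: "boundaries (unpackage G' (comp_graph (pcontract e P) (A - {e}) (merge ` C))) = orbits ?D {?t', tau1 G}"
    unfolding boundaries_def unpackage_def ribbon_subgraph_def comp_graph_def
    using E' flags_comp_contract[OF C] by (simp add: contract(4)[OF e])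
  have R: "boundaries (unpackage G (comp_graph P A C)) = orbits ?D {?t, tau1 G}"
    unfolding boundaries_def unpackage_def ribbon_subgraph_def comp_graph_def by simp
  show ?thesis
    unfolding L R by (rule orbits_cong) (simp only: image_insert image_empty eq)
qed

lemma card_pcomps_contract: "card (pcomps (pcontract e P) (A - {e})) = card (pcomps P A)"
  unfolding pcomps_contract by (rule card_image[OF pcomps_inj])

lemma card_vpart_contract: "card (vpart (pcontract e P)) + card T = card p + 1"
  unfolding vpart_merge by (rule M.card_image_sub) (auto simp: touched_blocks_def)

end

end

text \<open>Contracting an edge keeps the number of components and removes one edge and at most one
  block. The bound ensures that the subtraction in \<open>nullity\<close> is not truncated.\<close>

lemma card_vpart_le:
  assumes "packaged_ribbon_graph P" "A \<subseteq> edges (ribbon P)"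
  shows "card (vpart P) \<le> card A + card (pcomps P A)"
  using assms
proof (induction "card A" arbitrary: P A)
  case 0
  interpret pkg P by unfold_locales fact
  have "finite A" using 0 finite_edges finite_subset by blast
  then have "A = {}" using 0 by simp
  then have "card (pcomps P A) = card p"
    by (simp add: pcomps_def gcomps_empty card_image)
  then show ?case by simp
next
  case (Suc n)
  interpret pkg P by unfold_locales fact
  obtain e where eA: "e \<in> A" using Suc.hyps(2) by fastforce
  interpret pkg_edge P e by unfold_locales (use eA Suc.prems in auto)
  have fin: "finite A" using Suc.prems finite_edges finite_subset by blast
  have cA: "card (A - {e}) = n" using Suc.hyps(2) eA fin by simp
  have "A - {e} \<subseteq> edges (ribbon (pcontract e P))"
    using Suc.prems(2) contract(2)[OF e] by auto
  then have "card (vpart (pcontract e P)) \<le> card (A - {e}) + card (pcomps (pcontract e P) (A - {e}))"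
    using Suc.hyps(1)[OF cA[symmetric] pcontract_packaged] by simp
  moreover have "card T \<le> 2" using touched_card[OF e] by auto
  ultimately show ?case
    using card_pcomps_contract[OF Suc.prems(2) eA] card_vpart_contract[OF Suc.prems(2) eA]
      cA Suc.hyps(2) by linarith
qed

section \<open>Nullity and side term under contraction\<close>

context pkg_edge
begin

lemma nullity_contract:
  assumes A: "A \<subseteq> edges G" and eA: "e \<in> A"
  shows "nullity (vpackaging P A) =
    (if card T = 1 then 1 else 0) + nullity (vpackaging (pcontract e P) (A - {e}))"
proof -
  have A': "A - {e} \<subseteq> edges (ribbon (pcontract e P))"
    using A contract(2)[OF e] by auto
  have "finite A" using A finite_edges finite_subset by blast
  then have "card A = Suc (card (A - {e}))" using eA by (metis card_Suc_Diff1)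
  then show ?thesis
    unfolding nullity_eq[OF A] P'.nullity_eq[OF A']
    using card_pcomps_contract[OF A eA] card_vpart_contract[OF A eA] touched_card[OF e]
      card_vpart_le[OF pcontract_packaged A'] by auto
qed

lemma side_term_contract:
  assumes A: "A \<subseteq> edges G" and eA: "e \<in> A"
  shows "side_term P z zs A =
    z ^ (if card T = 1 then 1 else 0) * side_term (pcontract e P) z zs (A - {e})"
proof -
  have A': "A - {e} \<subseteq> edges (ribbon (pcontract e P))"
    using A contract(2)[OF e] by auto
  let ?g = "\<lambda>C. zs (2 + excess P A C - int (card (boundaries (unpackage G (comp_graph P A C)))))"
  let ?g' = "\<lambda>C. zs (2 + excess (pcontract e P) (A - {e}) C -
    int (card (boundaries (unpackage G' (comp_graph (pcontract e P) (A - {e}) C)))))"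
  have "(\<Prod>C\<in>pcomps (pcontract e P) (A - {e}). ?g' C) = (\<Prod>C\<in>pcomps P A. ?g' (merge ` C))"
    unfolding pcomps_contract[OF A eA] using prod.reindex[OF pcomps_inj[OF A eA], of ?g'] by simp
  also have "\<dots> = (\<Prod>C\<in>pcomps P A. ?g C)"
    by (rule prod.cong[OF refl]) (simp only: excess_contract[OF A eA] boundaries_contract[OF A eA])
  finally show ?thesis
    unfolding side_term_eq[OF A] P'.side_term_eq[OF A'] nullity_contract[OF A eA]
    by (simp add: power_add mult.assoc)
qed

end

section \<open>Contracting sets of edges\<close>

lemma fold_graph_foldr: "distinct L \<Longrightarrow> fold_graph f z (set L) (foldr f L z)"
  by (induction L) (auto intro: fold_graph.intros)

lemma fold_graph_obtain_list:
  "fold_graph f z A y \<Longrightarrow> \<exists>L. distinct L \<and> set L = A \<and> y = foldr f L z"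
proof (induction rule: fold_graph.induct)
  case emptyI
  then show ?case by (intro exI[of _ "[]"]) simp
next
  case (insertI x A y)
  then obtain L where "distinct L" "set L = A" "y = foldr f L z" by blast
  then show ?case using insertI by (intro exI[of _ "x # L"]) simp
qed

text \<open>\<open>Finite_Set.fold\<close> is a definite description over all enumerations of the
  set, so agreement of the enumerations of this one set pins it down.\<close>

lemma fold_eq_foldr:
  assumes "distinct L" "\<And>L'. distinct L' \<Longrightarrow> set L' = set L \<Longrightarrow> foldr f L' z = foldr f L z"
  shows "Finite_Set.fold f z (set L) = foldr f L z"
proof -
  have "(THE y. fold_graph f z (set L) y) = foldr f L z"
  proof (rule the_equality)
    show "fold_graph f z (set L) (foldr f L z)" by (rule fold_graph_foldr[OF assms(1)])
    fix y assume "fold_graph f z (set L) y"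
    then obtain L' where "distinct L'" "set L' = set L" "y = foldr f L' z"
      using fold_graph_obtain_list by metis
    then show "y = foldr f L z" using assms(2) by simp
  qed
  then show ?thesis by (simp add: Finite_Set.fold_def)
qed

text \<open>
  The blocks and weights after contracting the edges of \<open>A\<close> are read off the components of the
  packaging spanned by \<open>A\<close>, hence do not depend on the order of the contractions.
\<close>

definition contracted :: "'f packaged \<Rightarrow> 'f set set \<Rightarrow> 'f packaged \<Rightarrow> bool" where
  "contracted P A R \<longleftrightarrow>
     packaged_ribbon_graph R \<and> edges (ribbon R) = edges (ribbon P) - A \<and>
     ribbon R = (ribbon P)\<lparr>tau2 := (\<lambda>a. if a \<in> \<Union>A then tau0 (ribbon P) a else tau2 (ribbon P) a)\<rparr> \<and>
     bpart R = bpart P \<and> bweight R = bweight P \<and>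
     vpart R = (\<lambda>C. {s \<in> vertices (ribbon R). s \<subseteq> \<Union>(\<Union>C)}) ` pcomps P A \<and>
     (\<forall>C\<in>pcomps P A. int (vweight R {s \<in> vertices (ribbon R). s \<subseteq> \<Union>(\<Union>C)}) = excess P A C + 1)"

lemma contracted_vpart:
  "contracted P A R \<Longrightarrow> vpart R = (\<lambda>C. {s \<in> vertices (ribbon R). s \<subseteq> \<Union>(\<Union>C)}) ` pcomps P A"
  unfolding contracted_def by (elim conjE)

lemma contracted_vweight:
  "contracted P A R \<Longrightarrow> C \<in> pcomps P A \<Longrightarrow>
     int (vweight R {s \<in> vertices (ribbon R). s \<subseteq> \<Union>(\<Union>C)}) = excess P A C + 1"
  unfolding contracted_def by (elim conjE) (erule bspec)

text \<open>A vertex inside the flags of \<open>X\<close> shares a flag with a member of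
  \<open>X\<close> and hence equals it. So a block is recovered from its flags alone.\<close>

lemma (in pkg) block_eq:
  assumes X: "X \<in> p"
  shows "{s \<in> vertices G. s \<subseteq> \<Union>X} = X"
proof
  show "X \<subseteq> {s \<in> vertices G. s \<subseteq> \<Union>X}" using block_sub[OF X] by auto
  show "{s \<in> vertices G. s \<subseteq> \<Union>X} \<subseteq> X"
  proof
    fix s assume "s \<in> {s \<in> vertices G. s \<subseteq> \<Union>X}"
    then have s: "s \<in> vertices G" "s \<subseteq> \<Union>X" by auto
    then obtain a where a: "a \<in> s" using partition_onD3[OF partition_vertices] by (metis equals0I)
    then obtain s' where "s' \<in> X" "a \<in> s'" using s by blast
    then show "s \<in> X" using vertices_disj[OF s(1) _ a] block_sub[OF X] by blast
  qed
qed

text \<open>A block on its own, without edges, has excess one less than its weight; this fixes the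
  summand 1 in \<open>contracted\<close>.\<close>

lemma contracted_empty:
  assumes "packaged_ribbon_graph P"
  shows "contracted P {} P"
proof -
  interpret pkg P by unfold_locales fact
  have "(\<lambda>C. {s \<in> vertices G. s \<subseteq> \<Union>(\<Union>C)}) ` pcomps P {} = (\<lambda>X. X) ` p"
    unfolding pcomps_def gcomps_empty image_image
    by (rule image_cong[OF refl]) (simp add: block_eq)
  moreover have "int (vweight P {s \<in> vertices G. s \<subseteq> \<Union>(\<Union>C)}) = excess P {} C + 1" if "C \<in> pcomps P {}" for C
  proof -
    from that obtain X where "X \<in> p" "C = {X}" by (auto simp: pcomps_def gcomps_empty)
    then show ?thesis by (simp add: block_eq excess_def)
  qed
  ultimately show ?thesis using pkg by (simp add: contracted_def)
qed

text \<open>Contracting \<open>e\<close> first changes neither the flags nor the excess of a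
  component, so a description relative to the contraction is one relative to
  \<open>P\<close>.\<close>

lemma (in pkg_edge) contracted_insert:
  assumes A: "A \<subseteq> edges G" "e \<notin> A" and R: "contracted (pcontract e P) A R"
  shows "contracted P (insert e A) R"
proof -
  have B: "insert e A \<subseteq> edges G" "e \<in> insert e A" "insert e A - {e} = A" using A e by auto
  note comps = pcomps_contract[OF B(1,2), unfolded B(3)]
  note U = flags_comp_contract[OF B(1,2)]
  note ex = excess_contract[OF B(1,2), unfolded B(3)]
  let ?V = "vertices (ribbon R)"
  have "vpart R = (\<lambda>C. {s \<in> ?V. s \<subseteq> \<Union>(\<Union>C)}) ` pcomps (pcontract e P) A"
    by (rule contracted_vpart[OF R])
  also have "\<dots> = (\<lambda>C. {s \<in> ?V. s \<subseteq> \<Union>(\<Union>C)}) ` pcomps P (insert e A)"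
    unfolding comps image_image by (rule image_cong[OF refl]) (simp only: U)
  finally have v: "vpart R = (\<lambda>C. {s \<in> ?V. s \<subseteq> \<Union>(\<Union>C)}) ` pcomps P (insert e A)" .
  have w: "int (vweight R {s \<in> ?V. s \<subseteq> \<Union>(\<Union>C)}) = excess P (insert e A) C + 1"
    if C: "C \<in> pcomps P (insert e A)" for C
  proof -
    have "merge ` C \<in> pcomps (pcontract e P) A" unfolding comps using C by blast
    then have "int (vweight R {s \<in> ?V. s \<subseteq> \<Union>(\<Union>(merge ` C))}) = excess (pcontract e P) A (merge ` C) + 1"
      by (rule contracted_vweight[OF R])
    then show ?thesis unfolding U[OF C] ex[OF C] .
  qed
  have "edges (ribbon R) = edges G - insert e A"
    using R contract(2)[OF e] by (auto simp: contracted_def)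
  moreover have "ribbon R = G\<lparr>tau2 := (\<lambda>a. if a \<in> \<Union>(insert e A) then tau0 G a else tau2 G a)\<rparr>"
  proof -
    have "ribbon R = G'\<lparr>tau2 := (\<lambda>a. if a \<in> \<Union>A then tau0 G' a else tau2 G' a)\<rparr>"
      using R unfolding contracted_def pcontract_simps(1) by blast
    also have "\<dots> = G\<lparr>tau2 := (\<lambda>a. if a \<in> \<Union>(insert e A) then tau0 G a else tau2 G a)\<rparr>"
      by (auto simp: contract_def fun_eq_iff intro!: ribbon.equality)
    finally show ?thesis .
  qed
  ultimately show ?thesis
    using R v w unfolding contracted_def by simp
qed

lemma contracted_foldr:
  assumes "packaged_ribbon_graph P" "distinct L" "set L \<subseteq> edges (ribbon P)"
  shows "contracted P (set L) (foldr pcontract L P)"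
  using assms
\<comment> \<open>\<open>foldr\<close> applies the last list element first, so peeling from the
  right contracts \<open>e\<close> in \<open>P\<close> itself.\<close>
proof (induction L arbitrary: P rule: rev_induct)
  case Nil
  then show ?case by (simp add: contracted_empty)
next
  case (snoc e L)
  interpret pkg_edge P e by unfold_locales (use snoc.prems in auto)
  have L: "set L \<subseteq> edges (ribbon (pcontract e P))"
    using snoc.prems contract(2)[OF e] by auto
  have "contracted (pcontract e P) (set L) (foldr pcontract L (pcontract e P))"
    by (rule snoc.IH[OF pcontract_packaged _ L]) (use snoc.prems in simp)
  then have "contracted P (insert e (set L)) (foldr pcontract L (pcontract e P))"
    by (rule contracted_insert[rotated 2]) (use snoc.prems in auto)
  then show ?case by simp
qed

lemma foldr_pcontract_unique:
  assumes "packaged_ribbon_graph P" "distinct L" "distinct L'" "set L' = set L"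
    and "set L \<subseteq> edges (ribbon P)"
  shows "foldr pcontract L P = foldr pcontract L' P"
\<comment> \<open>Off its blocks \<open>P\<close> may carry arbitrary weights; they are reset to 0
  only by an actual contraction, so the empty list is treated apart.\<close>
proof (cases "L = []")
  case False
  let ?R = "foldr pcontract L P" and ?R' = "foldr pcontract L' P"
  have c: "contracted P (set L) ?R" "contracted P (set L) ?R'"
    using contracted_foldr[of P L] contracted_foldr[of P L'] assms by simp_all
  then have r: "ribbon ?R = ribbon ?R'" "bpart ?R = bpart ?R'" "bweight ?R = bweight ?R'"
    by (simp_all add: contracted_def)
  then have v: "vpart ?R = vpart ?R'" using c by (simp add: contracted_def)
  have off: "vweight (foldr pcontract M P) X = 0" if "M \<noteq> []" "X \<notin> vpart (foldr pcontract M P)" for M X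
    using that by (cases M) (auto simp: update_part_def update_weight_def)
  have "vweight ?R X = vweight ?R' X" for X
  proof (cases "X \<in> vpart ?R")
    case True
    then obtain C where C: "C \<in> pcomps P (set L)" "X = {s \<in> vertices (ribbon ?R). s \<subseteq> \<Union>(\<Union>C)}"
      unfolding contracted_vpart[OF c(1)] by (rule imageE)
    then have "int (vweight ?R X) = excess P (set L) C + 1" "int (vweight ?R' X) = excess P (set L) C + 1"
      using contracted_vweight[OF c(1) C(1)] contracted_vweight[OF c(2) C(1)] r(1) by simp_all
    then show ?thesis by simp
  next
    case outside: False
    have "L' \<noteq> []" using False assms(4) by auto
    then show ?thesis using off[OF False outside] off[of L' X] outside v by simp
  qed
  then show ?thesis using r v by (intro packaged.equality) (simp_all add: fun_eq_iff)
qed (use assms in auto)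

lemma pcontract_set_eq:
  assumes "packaged_ribbon_graph P" "distinct L" "set L \<subseteq> edges (ribbon P)"
  shows "pcontract_set (set L) P = foldr pcontract L P"
  unfolding pcontract_set_def
proof (rule fold_eq_foldr[OF assms(2)])
  fix L' assume "distinct L'" "set L' = set L"
  then show "foldr pcontract L' P = foldr pcontract L P"
    by (intro foldr_pcontract_unique) (use assms in auto)
qed

lemma nullity_empty:
  assumes "packaged_ribbon_graph P"
  shows "nullity (vpackaging P {}) = 0"
proof -
  interpret pkg P by unfold_locales fact
  show ?thesis
    using nullity_eq[of "{}"] by (simp add: pcomps_def gcomps_empty card_image)
qed

lemma side_term_foldr_pcontract:
  assumes "packaged_ribbon_graph P" "distinct L" "set L \<subseteq> A" "A \<subseteq> edges (ribbon P)"
  shows "side_term P z zs A =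
    z ^ nullity (vpackaging P (set L)) * side_term (foldr pcontract L P) z zs (A - set L)"
  using assms
proof (induction L arbitrary: P A rule: rev_induct)
  case Nil
  then show ?case by (simp add: nullity_empty)
next
  case (snoc e L)
  have eA: "e \<in> A" using snoc.prems by simp
  interpret pkg_edge P e by unfold_locales (use snoc.prems in auto)
  have A: "A \<subseteq> edges G" by fact
  have A': "A - {e} \<subseteq> edges (ribbon (pcontract e P))"
    using A contract(2)[OF e] by auto
  \<comment> \<open>The nullity of the contracted set is split at \<open>e\<close> too; its loop
    exponent depends only on \<open>e\<close> and so matches the one from \<open>A\<close>.\<close>
  have L: "set (L @ [e]) \<subseteq> edges G" "e \<in> set (L @ [e])" "set (L @ [e]) - {e} = set L"
    using snoc.prems by auto
  have IH: "side_term (pcontract e P) z zs (A - {e}) = z ^ nullity (vpackaging (pcontract e P) (set L)) *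
      side_term (foldr pcontract L (pcontract e P)) z zs (A - {e} - set L)"
    by (rule snoc.IH[OF pcontract_packaged _ _ A']) (use snoc.prems in auto)
  have "A - {e} - set L = A - set (L @ [e])" by auto
  then show ?case
    unfolding side_term_contract[OF A eA] IH nullity_contract[OF L(1,2)] L(3)
    by (simp add: power_add mult.assoc)
qed


section \<open>Duality and deletion\<close>

definition pdual :: "'f packaged \<Rightarrow> 'f packaged" where
  "pdual P = \<lparr>ribbon = dual (ribbon P), vpart = bpart P, vweight = bweight P,
     bpart = vpart P, bweight = vweight P\<rparr>"

lemma pdual_simps [simp]:
  "ribbon (pdual P) = dual (ribbon P)" "vpart (pdual P) = bpart P" "vweight (pdual P) = bweight P"
  "bpart (pdual P) = vpart P" "bweight (pdual P) = vweight P"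
  by (simp_all add: pdual_def)

lemma bpackaging_pdual: "bpackaging P A = vpackaging (pdual P) A"
  by (simp add: bpackaging_def vpackaging_def)

context rgraph
begin

text \<open>Dualising by all edges therefore swaps \<open>tau0\<close> and \<open>tau2\<close> on
  every flag.\<close>

lemma off_edges: "a \<in> flags G \<Longrightarrow> a \<notin> \<Union>(edges G) \<Longrightarrow> tau0 G a = tau2 G a"
  unfolding edges_eq by (auto simp: edge_at_def)

lemma edges_dual [simp]: "edges (dual G) = edges G"
  unfolding dual_def by (rule partial_dual) simp

lemma ribbon_graph_dual: "ribbon_graph (dual G)"
  unfolding dual_def by (rule partial_dual) simp

lemma vertices_dual: "vertices (dual G) = boundaries G"
  unfolding vertices_def boundaries_def dual_def partial_dual_def
  using off_edges by (auto intro!: orbits_cong)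

lemma boundaries_dual: "boundaries (dual G) = vertices G"
  unfolding vertices_def boundaries_def dual_def partial_dual_def
  using off_edges by (auto intro!: orbits_cong)

lemma dual_dual: "dual (dual G) = G"
proof -
  have "dual (dual G) = partial_dual (partial_dual G (edges G)) (edges G)"
    using edges_dual by (simp add: dual_def)
  then show ?thesis
    using partial_dual_partial_dual[of "edges G" "edges G"] by (simp add: partial_dual_def)
qed

lemma Union_edges_remove:
  assumes "e \<in> edges G"
  shows "a \<in> \<Union>(edges G) \<longleftrightarrow> a \<in> \<Union>(edges G - {e}) \<or> a \<in> e"
    and "a \<in> e \<Longrightarrow> a \<notin> \<Union>(edges G - {e})"
  using assms edges_disjoint by blast+

text \<open>On \<open>e\<close> all maps become the old \<open>tau2\<close>: deletion copies it to
  \<open>tau0\<close> and the dual no longer swaps there; conversely the dual moves it to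
  \<open>tau0\<close> and contraction copies it back.\<close>

lemma dual_delete: "e \<in> edges G \<Longrightarrow> dual (delete e G) = contract e (dual G)"
  unfolding dual_def delete(2) partial_dual_def
  using Union_edges_remove[of e]
  by (intro ribbon.equality) (auto simp: delete_def contract_def fun_eq_iff simp del: Union_iff)

lemma dual_contract: "e \<in> edges G \<Longrightarrow> dual (contract e G) = delete e (dual G)"
  unfolding dual_def contract(2) partial_dual_def
  using Union_edges_remove[of e]
  by (intro ribbon.equality) (auto simp: delete_def contract_def fun_eq_iff simp del: Union_iff)

end

section \<open>Packaged duality and deletion\<close>

lemma pdelete_simps [simp]:
  "ribbon (pdelete e P) = delete e (ribbon P)"
  "vpart (pdelete e P) = vpart P" "vweight (pdelete e P) = vweight P"
  "bpart (pdelete e P) = update_part e (boundaries (delete e (ribbon P))) (bpart P)"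
  "bweight (pdelete e P) = update_weight e (boundaries (delete e (ribbon P))) (bpart P) (bweight P)"
  by (simp_all add: pdelete_def Let_def)

context pkg
begin

lemma pdual_packaged: "packaged_ribbon_graph (pdual P)"
  using pkg ribbon_graph_dual vertices_dual boundaries_dual
  by (simp add: packaged_ribbon_graph_def)

lemma pdual_pdual: "pdual (pdual P) = P"
  by (rule packaged.equality) (simp_all add: dual_dual)

lemma pdual_pdelete:
  assumes e: "e \<in> edges G"
  shows "pdual (pdelete e P) = pcontract e (pdual P)"
proof -
  interpret D: rgraph "delete e G" by unfold_locales (rule delete(1)[OF e])
  have "vertices (contract e (dual G)) = boundaries (delete e G)"
    using D.vertices_dual dual_delete[OF e] by simp
  then show ?thesis
    by (intro packaged.equality) (simp_all add: dual_delete[OF e])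
qed

lemma pdual_pcontract:
  assumes e: "e \<in> edges G"
  shows "pdual (pcontract e P) = pdelete e (pdual P)"
proof -
  interpret C: rgraph "contract e G" by unfold_locales (rule contract(1)[OF e])
  have "boundaries (delete e (dual G)) = vertices (contract e G)"
    using C.boundaries_dual dual_contract[OF e] by simp
  then show ?thesis
    by (intro packaged.equality) (simp_all add: dual_contract[OF e])
qed

lemma spanning_subgraph_delete:
  assumes "e \<in> edges G" "A \<subseteq> edges G" "e \<notin> A"
  shows "spanning_subgraph (delete e G) A = spanning_subgraph G A"
proof -
  have "vertices (delete e G) = vertices G" using delete[OF assms(1)] by (simp add: vertices_def)
  moreover have "e \<inter> \<Union>A = {}" using Union_edges_disjoint_iff assms by simp
  ultimately show ?thesis
    unfolding spanning_subgraph_def ribbon_subgraph_def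
    by (intro ribbon.equality) (auto simp: delete_def fun_eq_iff)
qed

text \<open>The subgraph spanned by \<open>A\<close> already treats the slots of \<open>e\<close> as
  empty, and deletion alters no vertex block or vertex weight.\<close>

lemma side_term_pdelete:
  assumes "e \<in> edges G" "A \<subseteq> edges G" "e \<notin> A"
  shows "vpackaging (pdelete e P) A = vpackaging P A"
    and "side_term (pdelete e P) z zs A = side_term P z zs A"
proof -
  show v: "vpackaging (pdelete e P) A = vpackaging P A"
    unfolding vpackaging_def by (simp add: spanning_subgraph_delete[OF assms])
  have "gamma (delete e G) K = gamma G K" if "K \<in> wcomponents (vpackaging P A)" for K
  proof -
    have "wedges K \<subseteq> A" using that unfolding wcomponents_eq[OF assms(2)] by (auto simp: comp_graph_def)
    then have "e \<inter> \<Union>(wedges K) = {}"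
      using Union_edges_disjoint_iff[of "wedges K" e] assms by blast
    then have "unpackage (delete e G) K = unpackage G K"
      unfolding unpackage_def ribbon_subgraph_def
      by (intro ribbon.equality) (auto simp: delete_def fun_eq_iff)
    then show ?thesis by (simp add: gamma_def)
  qed
  then show "side_term (pdelete e P) z zs A = side_term P z zs A"
    unfolding side_term_def v by simp
qed

end

text \<open>Deletion is contraction conjugated by \<open>pdual\<close>, so validity of the resulting
  packaged graph is inherited from the dual.\<close>

lemma foldr_pdelete:
  assumes "packaged_ribbon_graph P" "distinct L" "set L \<subseteq> edges (ribbon P)"
  shows "packaged_ribbon_graph (foldr pdelete L P) \<and>
    edges (ribbon (foldr pdelete L P)) = edges (ribbon P) - set L \<and>
    pdual (foldr pdelete L P) = foldr pcontract L (pdual P)"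
  using assms(2,3)
proof (induction L)
  case Nil
  then show ?case using assms(1) by simp
next
  case (Cons e L)
  then have IH: "packaged_ribbon_graph (foldr pdelete L P)"
    "edges (ribbon (foldr pdelete L P)) = edges (ribbon P) - set L"
    "pdual (foldr pdelete L P) = foldr pcontract L (pdual P)" by auto
  interpret R: pkg "foldr pdelete L P" by unfold_locales (rule IH)
  have e: "e \<in> edges R.G" using IH(2) Cons.prems by simp
  have eq: "pdual (pdelete e (foldr pdelete L P)) = pcontract e (foldr pcontract L (pdual P))"
    using R.pdual_pdelete[OF e] IH(3) by simp
  interpret D: pkg_edge "pdual (foldr pdelete L P)" e
    by unfold_locales (use R.pdual_packaged e R.edges_dual in simp_all)
  have "pdelete e (foldr pdelete L P) = pdual (pcontract e (pdual (foldr pdelete L P)))"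
    using D.pdual_pcontract[OF D.e] R.pdual_pdual by simp
  then have "packaged_ribbon_graph (pdelete e (foldr pdelete L P))"
    using pkg.pdual_packaged[unfolded pkg_def, OF D.pcontract_packaged] by simp
  moreover have "edges (ribbon (pdelete e (foldr pdelete L P))) = edges (ribbon P) - set (e # L)"
    using R.delete(2)[OF e] IH(2) by auto
  ultimately show ?case using eq by simp
qed

lemma side_term_foldr_pdelete:
  assumes "packaged_ribbon_graph P" "distinct L" "set L \<subseteq> edges (ribbon P)"
    and "A \<subseteq> edges (ribbon P) - set L"
  shows "vpackaging (foldr pdelete L P) A = vpackaging P A \<and>
    side_term (foldr pdelete L P) z zs A = side_term P z zs A"
  using assms(2-)
proof (induction L)
  case (Cons e L)
  then have IH: "vpackaging (foldr pdelete L P) A = vpackaging P A"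
    "side_term (foldr pdelete L P) z zs A = side_term P z zs A" by auto
  have L: "packaged_ribbon_graph (foldr pdelete L P)"
    "edges (ribbon (foldr pdelete L P)) = edges (ribbon P) - set L"
    using foldr_pdelete[OF assms(1)] Cons.prems by auto
  interpret R: pkg "foldr pdelete L P" by unfold_locales (rule L)
  have "e \<in> edges R.G" "A \<subseteq> edges R.G" "e \<notin> A" using L(2) Cons.prems by auto
  then show ?case using R.side_term_pdelete(1)[of e A] R.side_term_pdelete(2)[of e A z zs] IH by simp
qed simp

lemma pdual_foldr_pcontract:
  assumes "packaged_ribbon_graph P" "distinct L" "set L \<subseteq> edges (ribbon P)"
  shows "pdual (foldr pcontract L P) = foldr pdelete L (pdual P)"
  using assms(2,3)
proof (induction L)
  case (Cons e L)
  have c: "contracted P (set L) (foldr pcontract L P)"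
    using contracted_foldr[OF assms(1)] Cons.prems by simp
  interpret R: pkg "foldr pcontract L P" by unfold_locales (use c in \<open>simp add: contracted_def\<close>)
  have "e \<in> edges R.G" using c Cons.prems by (auto simp: contracted_def)
  then show ?case using R.pdual_pcontract Cons by simp
qed simp

text \<open>Independence of the order transfers from contraction because \<open>pdual\<close> is an
  involution on packaged ribbon graphs, hence injective there.\<close>

lemma pdelete_set_eq:
  assumes P: "packaged_ribbon_graph P" and L: "distinct L" "set L \<subseteq> edges (ribbon P)"
  shows "pdelete_set (set L) P = foldr pdelete L P"
  unfolding pdelete_set_def
proof (rule fold_eq_foldr[OF L(1)])
  fix L' assume L': "distinct L'" "set L' = set L"
  interpret pkg P by unfold_locales fact
  have "set L' \<subseteq> edges (ribbon P)" using L' L by simp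
  then have d: "pdual (foldr pdelete M P) = foldr pcontract M (pdual P) \<and> packaged_ribbon_graph (foldr pdelete M P)"
    if "M \<in> {L, L'}" for M
    using foldr_pdelete[OF P, of M] that L L' by auto
  have "foldr pcontract L' (pdual P) = foldr pcontract L (pdual P)"
    by (rule foldr_pcontract_unique[OF pdual_packaged L'(1) L(1)]) (use L L' in auto)
  then have "pdual (foldr pdelete L' P) = pdual (foldr pdelete L P)" using d by simp
  then show "foldr pdelete L' P = foldr pdelete L P"
    using d pkg.pdual_pdual[unfolded pkg_def, of "foldr pdelete L' P"]
      pkg.pdual_pdual[unfolded pkg_def, of "foldr pdelete L P"] by simp
qed

section \<open>Summands of the polynomial in minors\<close>

lemma tutte_side_terms:
  "tutte P x xs y ys = (\<Sum>A\<in>Pow (edges (ribbon P)).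
     side_term (pdual P) x xs (edges (ribbon P) - A) * side_term P y ys A)"
  unfolding tutte_def side_term_def bpackaging_pdual by (simp add: mult_ac)

text \<open>The \<open>y\<close> half of \<open>C \<union> X\<close> does not see the deletion of
  \<open>D\<close> and gains the power of \<open>y\<close> by contracting \<open>C\<close>. The
  complement contains \<open>D\<close>, so in the dual \<open>D\<close> is contracted and the
  deletion of \<open>C\<close> goes unnoticed.\<close>

lemma side_terms_minor:
  assumes P: "packaged_ribbon_graph P"
    and C: "C \<subseteq> edges (ribbon P)" and D: "D \<subseteq> edges (ribbon P) - C"
  defines "R \<equiv> pcontract_set C (pdelete_set D P)"
  shows "edges (ribbon R) = edges (ribbon P) - C - D"
    and "X \<subseteq> edges (ribbon P) - C - D \<Longrightarrow>
      side_term (pdual P) x xs (edges (ribbon P) - (C \<union> X)) * side_term P y ys (C \<union> X) =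
      x ^ nullity (bpackaging P D) * y ^ nullity (vpackaging P C) *
      (side_term (pdual R) x xs (edges (ribbon R) - X) * side_term R y ys X)"
proof -
  interpret pkg P by unfold_locales fact
  have "finite C" "finite D" using C D finite_edges finite_subset by blast+
  then obtain K L where K: "distinct K" "set K = C" and L: "distinct L" "set L = D"
    using finite_distinct_list by metis
  define Q where "Q = foldr pdelete L P"
  have Q: "packaged_ribbon_graph Q" "edges (ribbon Q) = edges G - D" "pdual Q = foldr pcontract L (pdual P)"
    using foldr_pdelete[OF P L(1)] L D by (auto simp: Q_def)
  have KQ: "set K \<subseteq> edges (ribbon Q)" using Q(2) K C D by auto
  interpret Q: pkg Q by unfold_locales (rule Q)
  have LE: "set L \<subseteq> edges G" using L D by auto
  then have "pdelete_set D P = Q" using pdelete_set_eq[OF P L(1)] L(2) by (simp add: Q_def)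
  then have R: "R = foldr pcontract K Q"
    unfolding R_def using pcontract_set_eq[OF Q(1) K(1) KQ] K(2) by simp
  have "contracted Q C R" unfolding R using contracted_foldr[OF Q(1) K(1) KQ] K by simp
  then show eR: "edges (ribbon R) = edges G - C - D"
    using Q(2) by (auto simp: contracted_def)
  assume X: "X \<subseteq> edges G - C - D"
  have s1: "C \<union> X \<subseteq> edges G - set L" "C \<subseteq> edges G - set L"
    "set K \<subseteq> C \<union> X" "C \<union> X \<subseteq> edges (ribbon Q)"
    using L(2) K(2) C D X Q(2) by auto
  have s2: "set L \<subseteq> edges G - (C \<union> X)" "edges G - (C \<union> X) \<subseteq> edges (ribbon (pdual P))"
    "set K \<subseteq> edges (ribbon (pdual Q))" "edges G - (C \<union> X) - D \<subseteq> edges (ribbon (pdual Q)) - set K"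
    using L(2) K(2) KQ C D X Q(2) edges_dual Q.edges_dual by auto
  have "side_term P y ys (C \<union> X) = side_term Q y ys (C \<union> X)"
    unfolding Q_def using side_term_foldr_pdelete[OF P L(1) LE s1(1), of y ys] by simp
  also have "\<dots> = y ^ nullity (vpackaging Q C) * side_term R y ys (C \<union> X - C)"
    unfolding R using side_term_foldr_pcontract[OF Q(1) K(1) s1(3,4), of y ys] K(2) by simp
  also have "vpackaging Q C = vpackaging P C"
    unfolding Q_def using side_term_foldr_pdelete[OF P L(1) LE s1(2), of y ys] by simp
  also have "C \<union> X - C = X" using X by blast
  finally have Y: "side_term P y ys (C \<union> X) = y ^ nullity (vpackaging P C) * side_term R y ys X" .
  have "side_term (pdual P) x xs (edges G - (C \<union> X)) =
      x ^ nullity (vpackaging (pdual P) D) * side_term (pdual Q) x xs (edges G - (C \<union> X) - D)"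
    unfolding Q(3) using side_term_foldr_pcontract[OF pdual_packaged L(1) s2(1,2), of x xs] L(2) by simp
  also have "side_term (pdual Q) x xs (edges G - (C \<union> X) - D) =
      side_term (foldr pdelete K (pdual Q)) x xs (edges G - (C \<union> X) - D)"
    using side_term_foldr_pdelete[OF Q.pdual_packaged K(1) s2(3,4), of x xs] by simp
  also have "foldr pdelete K (pdual Q) = pdual R"
    unfolding R by (rule pdual_foldr_pcontract[OF Q(1) K(1) KQ, symmetric])
  also have "edges G - (C \<union> X) - D = edges (ribbon R) - X" using eR by auto
  finally show "side_term (pdual P) x xs (edges G - (C \<union> X)) * side_term P y ys (C \<union> X) =
      x ^ nullity (bpackaging P D) * y ^ nullity (vpackaging P C) *
      (side_term (pdual R) x xs (edges (ribbon R) - X) * side_term R y ys X)"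
    unfolding Y bpackaging_pdual by (simp add: mult_ac)
qed

theorem theorem3p2:
  fixes P :: "'f packaged" and r :: "'f set rel"
    and x y :: "'a::comm_semiring_1" and xs ys :: "int \<Rightarrow> 'a"
  assumes "packaged_ribbon_graph P"
    and "connected_ribbon (ribbon P)"
    and "strict_linear_order_on (edges (ribbon P)) r"
  shows "tutte P x xs y ys =
    (\<Sum>Q\<in>quasi_trees (ribbon P).
       x ^ nullity (bpackaging P (ext_dead (ribbon P) r Q \<union> ext_live_nonor (ribbon P) r Q)) *
       y ^ nullity (vpackaging P (int_dead (ribbon P) r Q \<union> int_live_nonor (ribbon P) r Q)) *
       tutte
         (pcontract_set (int_dead (ribbon P) r Q \<union> int_live_nonor (ribbon P) r Q)
           (pdelete_set (ext_dead (ribbon P) r Q \<union> ext_live_nonor (ribbon P) r Q) P))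
         x xs y ys)"
proof -
  interpret pkg P by unfold_locales fact
  let ?t = "\<lambda>A. side_term (pdual P) x xs (edges G - A) * side_term P y ys A"
  let ?C = "\<lambda>B. {e \<in> B. \<not> flexible G r B e}"
  let ?D = "\<lambda>B. {e \<in> edges G - B. \<not> flexible G r B e}"
  let ?R = "\<lambda>B. pcontract_set (?C B) (pdelete_set (?D B) P)"
  \<comment> \<open>The free edges of the interval of \<open>B\<close> are the edges left in its
    minor, so the interval sums to the polynomial of that minor.\<close>
  have inner: "(\<Sum>X\<in>Pow {e \<in> edges G. flexible G r B e}. ?t (?C B \<union> X)) =
      x ^ nullity (bpackaging P (?D B)) * y ^ nullity (vpackaging P (?C B)) * tutte (?R B) x xs y ys"
    if B: "feasible G B" for B
  proof -
    have BE: "B \<subseteq> edges G" using B by (simp add: feasible_def)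
    have C: "?C B \<subseteq> edges G" and D: "?D B \<subseteq> edges G - ?C B" using BE by auto
    have E: "edges G - ?C B - ?D B = {e \<in> edges G. flexible G r B e}" using BE by auto
    note minor = side_terms_minor[OF assms(1) C D, unfolded E]
    have "(\<Sum>X\<in>Pow {e \<in> edges G. flexible G r B e}. ?t (?C B \<union> X)) =
        (\<Sum>X\<in>Pow (edges (ribbon (?R B))). x ^ nullity (bpackaging P (?D B)) * y ^ nullity (vpackaging P (?C B)) *
          (side_term (pdual (?R B)) x xs (edges (ribbon (?R B)) - X) * side_term (?R B) y ys X))"
      unfolding minor(1)
      by (rule sum.cong[OF refl]) (use minor(2)[unfolded minor(1)] in simp)
    then show ?thesis
      unfolding tutte_side_terms[of "?R B"] sum_distrib_left .
  qed
  have "tutte P x xs y ys = (\<Sum>B | feasible G B.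
      x ^ nullity (bpackaging P (?D B)) * y ^ nullity (vpackaging P (?C B)) * tutte (?R B) x xs y ys)"
    unfolding tutte_side_terms[of P] sum_intervals[OF assms(3,2)]
    by (rule sum.cong[OF refl]) (use inner in simp)
  also have "\<dots> = (\<Sum>B | feasible G B. (\<lambda>Q.
       x ^ nullity (bpackaging P (ext_dead (ribbon P) r Q \<union> ext_live_nonor (ribbon P) r Q)) *
       y ^ nullity (vpackaging P (int_dead (ribbon P) r Q \<union> int_live_nonor (ribbon P) r Q)) *
       tutte
         (pcontract_set (int_dead (ribbon P) r Q \<union> int_live_nonor (ribbon P) r Q)
           (pdelete_set (ext_dead (ribbon P) r Q \<union> ext_live_nonor (ribbon P) r Q) P))
         x xs y ys) (spanning_subgraph G B))"
    by (rule sum.cong[OF refl]) (simp add: feasible_def int_fixed_eq ext_fixed_eq)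
  \<comment> \<open>Feasible sets are replaced by quasi-trees, which determine their edge
    sets.\<close>
  finally show ?thesis
    unfolding quasi_trees_eq sum.reindex[OF inj_spanning_subgraph] comp_def .
qed

end
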